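(* Let $g>0$ and $\kappa>0$ be fixed. For each fixed $x\in\mathbb{C}\setminus\mathbb{R}$ the resolvent $W_1(x)$ of the Gaussian ensemble $\mathrm{G}\beta\mathrm{E}^*(g)$ (see context) has, as $N\to\infty$, the large $N$ expansion $$\frac{g}{N}W_1(x)=\sum_{l=0}^{6}\left(\frac{g}{\sqrt{\kappa}N}\right)^{l}W_1^{l}(x)+O(N^{-7}),$$ where, with $h=\sqrt{\kappa}-1/\sqrt{\kappa}$ and $y=\sqrt{x^2-4g}$, $$W_1^0=\tfrac12[x-y],\qquad W_1^1=\tfrac{h}{2}\left[\frac1y-\frac{x}{y^2}\right],\qquad W_1^2=h^2\left[-\frac{x}{y^4}+\frac{x^2+g}{y^5}\right]+\frac{g}{y^5},$$ $$W_1^3=5h^3\left[\frac{x^2+g}{y^7}-\frac{x^3+2gx}{y^8}\right]+\frac{h}{2}\left[\frac{x^2+6g}{y^7}-\frac{x^3+30gx}{y^8}\right],$$ $$W_1^4=h^4\left[-\frac{37x^3+92gx}{y^{10}}+\frac{37x^4+123gx^2+21g^2}{y^{11}}\right]+h^2\left[-\frac{23x^3+180gx}{2y^{10}}+\frac{23x^4+454gx^2+176g^2}{2y^{11}}\right]+\frac{21g(x^2+g)}{y^{11}},$$ $$W_1^5=h^5\left[\frac{353x^4+1527gx^2+399g^2}{y^{13}}-\frac{353x^5+1766gx^3+848g^2x}{y^{14}}\right]+h^3\left[\frac{445x^4+4332gx^2+1512g^2}{2y^{13}}-\frac{445x^5+7714gx^3+7440g^2x}{2y^{14}}\right]$$ $$\qquad+h\left[\frac{21(x^4+20gx^2+14g^2)}{2y^{13}}-\frac{3(7x^5+628gx^3+1200g^2x)}{2y^{14}}\right],$$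 $$W_1^6=h^6\left[-\frac{4081x^5+26392gx^3+18976g^2x}{y^{16}}+\frac{4081x^6+28625gx^4+26832g^2x^2+1738g^3}{y^{17}}\right]$$ $$\qquad+h^4\left[-\frac{8567x^5+101288gx^3+93600g^2x}{2y^{16}}+\frac{8567x^6+147556gx^4+243180g^2x^2+31236g^3}{2y^{17}}\right]$$ $$\qquad+h^2\left[-\frac{618x^5+13104gx^3+18000g^2x}{y^{16}}+\frac{618x^6+32043gx^4+91299g^2x^2+16834g^3}{y^{17}}\right]+\frac{11g(135x^4+558gx^2+158g^2)}{y^{17}}.$$
   Context: For $g,\kappa>0$ and a positive integer $N$, $\mathrm{G}\beta\mathrm{E}^*(g)$ (with $\beta=2\kappa$) is the probability law on $(\lambda_1,\dots,\lambda_N)\in\mathbb{R}^N$ with density proportional to $\prod_{l=1}^N e^{-N\kappa\lambda_l^2/(2g)}\prod_{1\le j<k\le N}|\lambda_k-\lambda_j|^{2\kappa}$. The resolvent is $W_1(x)=\left\langle\sum_{j=1}^N\frac1{x-\lambda_j}\right\rangle$, where $\langle\cdot\rangle$ is the average with respect to this law. The function $y(x)=\sqrt{x^2-4g}$ is the branch analytic on $\mathbb{C}\setminus[-2\sqrt g,2\sqrt g]$ with $y(x)\sim x$ as $x\to\infty$. *)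

theory Defs
  imports "HOL-Analysis.Analysis" "HOL-Library.Landau_Symbols"
begin

text \<open>Vectors in \<open>\<real>\<^sup>N\<close> are the elements of \<open>\<Pi>\<^sub>M j\<in>{..<N}. lborel\<close>, indexed from \<open>0\<close>, because \<open>N\<close>
  is the variable of the asymptotics and cannot be a type.\<close>

definition gbe_weight :: "real \<Rightarrow> real \<Rightarrow> nat \<Rightarrow> (nat \<Rightarrow> real) \<Rightarrow> real" where
  "gbe_weight g \<kappa> N v =
     (\<Prod>l<N. exp (- (real N * \<kappa> * (v l)\<^sup>2 / (2 * g)))) *
     (\<Prod>k<N. \<Prod>j<k. \<bar>v k - v j\<bar> powr (2 * \<kappa>))"

definition gbe_partition :: "real \<Rightarrow> real \<Rightarrow> nat \<Rightarrow> real" where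
  "gbe_partition g \<kappa> N = (\<integral>v. gbe_weight g \<kappa> N v \<partial>(\<Pi>\<^sub>M j\<in>{..<N}. lborel))"

definition gbe_law :: "real \<Rightarrow> real \<Rightarrow> nat \<Rightarrow> (nat \<Rightarrow> real) measure" where
  "gbe_law g \<kappa> N =
     density (\<Pi>\<^sub>M j\<in>{..<N}. lborel)
       (\<lambda>v. ennreal (gbe_weight g \<kappa> N v / gbe_partition g \<kappa> N))"

definition gbe_resolvent :: "real \<Rightarrow> real \<Rightarrow> nat \<Rightarrow> complex \<Rightarrow> complex" where
  "gbe_resolvent g \<kappa> N x = (\<integral>v. (\<Sum>j<N. 1 / (x - complex_of_real (v j))) \<partial>gbe_law g \<kappa> N)"

definition is_resolvent_sqrt :: "real \<Rightarrow> (complex \<Rightarrow> complex) \<Rightarrow> bool" where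
  "is_resolvent_sqrt g y \<longleftrightarrow>
     y analytic_on (- complex_of_real ` {- 2 * sqrt g .. 2 * sqrt g}) \<and>
     (\<forall>x \<in> - complex_of_real ` {- 2 * sqrt g .. 2 * sqrt g}. (y x)\<^sup>2 = x\<^sup>2 - 4 * of_real g) \<and>
     y \<sim>[at_infinity] (\<lambda>x. x)"

text \<open>The branch exists; by analyticity and the condition at infinity it is unique off the cut.\<close>

lemma is_resolvent_sqrt_exists:
  assumes "g > 0"
  shows "is_resolvent_sqrt g (\<lambda>x. x * csqrt (1 - 4 * of_real g / x\<^sup>2))"
proof -
  let ?C = "complex_of_real ` {- 2 * sqrt g .. 2 * sqrt g}"
  have nz: "x \<noteq> 0" if "x \<in> - ?C" for x
  proof
    assume "x = 0"
    then have "x = complex_of_real 0" by simp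
    moreover have "(0::real) \<in> {- 2 * sqrt g .. 2 * sqrt g}" using assms by simp
    ultimately show False using that by blast
  qed
  have cut: "1 - 4 * of_real g / x\<^sup>2 \<notin> \<real>\<^sub>\<le>\<^sub>0" if x: "x \<in> - ?C" for x
  proof
    assume "1 - 4 * of_real g / x\<^sup>2 \<in> \<real>\<^sub>\<le>\<^sub>0"
    then obtain r where r: "r \<le> 0" "1 - 4 * of_real g / x\<^sup>2 = of_real r"
      by (auto elim!: nonpos_Reals_cases)
    define t where "t = 4 * g / (1 - r)"
    have t: "0 \<le> t" "t \<le> 4 * g"
      using assms r(1) by (auto simp: t_def field_simps mult_nonneg_nonpos)
    have r1: "1 - complex_of_real r \<noteq> 0"
      using r(1) by (metis diff_eq_diff_eq diff_self of_real_1 of_real_eq_iff not_one_le_zero)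
    have "(1 - of_real r) * x\<^sup>2 = 4 * of_real g"
      using r(2) nz[OF x] by (simp add: field_simps)
    then have "x\<^sup>2 = of_real t"
      using r1 by (simp add: t_def field_simps)
    also have "\<dots> = (of_real (sqrt t))\<^sup>2"
      using t by (simp flip: of_real_power)
    finally have "x = of_real (sqrt t) \<or> x = of_real (- sqrt t)"
      by (simp add: power2_eq_iff)
    moreover have "sqrt t \<le> 2 * sqrt g"
      using t by (metis real_sqrt_four real_sqrt_le_iff real_sqrt_mult)
    moreover have "0 \<le> sqrt t" using t by simp
    ultimately have "sqrt t \<in> {- 2 * sqrt g .. 2 * sqrt g}" "- sqrt t \<in> {- 2 * sqrt g .. 2 * sqrt g}"
      unfolding atLeastAtMost_iff by linarith+
    then have "x \<in> ?C"
      using \<open>x = of_real (sqrt t) \<or> x = of_real (- sqrt t)\<close> by blast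
    then show False using x by simp
  qed
  have "(\<lambda>x. x * csqrt (1 - 4 * of_real g / x\<^sup>2)) analytic_on (- ?C)"
    using nz cut by (intro analytic_intros) auto
  moreover have "\<forall>x \<in> - ?C. (x * csqrt (1 - 4 * of_real g / x\<^sup>2))\<^sup>2 = x\<^sup>2 - 4 * of_real g"
    using nz by (auto simp: power_mult_distrib field_simps)
  moreover have "(\<lambda>x. x * csqrt (1 - 4 * of_real g / x\<^sup>2)) \<sim>[at_infinity] (\<lambda>x. x)"
    unfolding asymp_equiv_def
  proof (rule Lim_transform_eventually)
    have "((\<lambda>x. 1 - 4 * complex_of_real g * (inverse x)\<^sup>2) \<longlongrightarrow> 1 - 4 * of_real g * 0\<^sup>2) at_infinity"
      by (intro tendsto_intros tendsto_inverse_0)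
    then have "((\<lambda>x. 1 - 4 * complex_of_real g / x\<^sup>2) \<longlongrightarrow> 1) at_infinity"
      by (simp add: divide_inverse power_inverse)
    moreover have "isCont csqrt 1"
      by (rule continuous_at_csqrt) auto
    ultimately have "((\<lambda>x. csqrt (1 - 4 * complex_of_real g / x\<^sup>2)) \<longlongrightarrow> csqrt 1) at_infinity"
      by (rule isCont_tendsto_compose[rotated])
    then show "((\<lambda>x. csqrt (1 - 4 * complex_of_real g / x\<^sup>2)) \<longlongrightarrow> 1) at_infinity"
      by simp
    have "eventually (\<lambda>x::complex. x \<noteq> 0) at_infinity"
      unfolding eventually_at_infinity by (rule exI[of _ 1]) auto
    then show "eventually (\<lambda>x. csqrt (1 - 4 * complex_of_real g / x\<^sup>2) =
        (if x * csqrt (1 - 4 * of_real g / x\<^sup>2) = 0 \<and> x = 0 then 1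
         else x * csqrt (1 - 4 * of_real g / x\<^sup>2) / x)) at_infinity"
      by eventually_elim simp
  qed
  ultimately show ?thesis
    by (simp add: is_resolvent_sqrt_def)
qed

definition resolvent_coeffs :: "complex \<Rightarrow> complex \<Rightarrow> complex \<Rightarrow> complex \<Rightarrow> complex list" where
  "resolvent_coeffs g h x y =
   [ 1 / 2 * (x - y),

     h / 2 * (1 / y - x / y^2),

     h^2 * (- (x / y^4) + (x^2 + g) / y^5)
     + g / y^5,

     5 * h^3 * ((x^2 + g) / y^7 - (x^3 + 2*g*x) / y^8)
     + h / 2 * ((x^2 + 6*g) / y^7 - (x^3 + 30*g*x) / y^8),

     h^4 * (- ((37*x^3 + 92*g*x) / y^10)
            + (37*x^4 + 123*g*x^2 + 21*g^2) / y^11)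
     + h^2 * (- ((23*x^3 + 180*g*x) / (2 * y^10))
              + (23*x^4 + 454*g*x^2 + 176*g^2) / (2 * y^11))
     + 21*g*(x^2 + g) / y^11,

     h^5 * ((353*x^4 + 1527*g*x^2 + 399*g^2) / y^13
            - (353*x^5 + 1766*g*x^3 + 848*g^2*x) / y^14)
     + h^3 * ((445*x^4 + 4332*g*x^2 + 1512*g^2) / (2 * y^13)
              - (445*x^5 + 7714*g*x^3 + 7440*g^2*x) / (2 * y^14))
     + h * (21*(x^4 + 20*g*x^2 + 14*g^2) / (2 * y^13)
            - 3*(7*x^5 + 628*g*x^3 + 1200*g^2*x) / (2 * y^14)),

     h^6 * (- ((4081*x^5 + 26392*g*x^3 + 18976*g^2*x) / y^16)
            + (4081*x^6 + 28625*g*x^4 + 26832*g^2*x^2 + 1738*g^3) / y^17)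
     + h^4 * (- ((8567*x^5 + 101288*g*x^3 + 93600*g^2*x) / (2 * y^16))
              + (8567*x^6 + 147556*g*x^4 + 243180*g^2*x^2 + 31236*g^3) / (2 * y^17))
     + h^2 * (- ((618*x^5 + 13104*g*x^3 + 18000*g^2*x) / y^16)
              + (618*x^6 + 32043*g*x^4 + 91299*g^2*x^2 + 16834*g^3) / y^17)
     + 11*g*(135*x^4 + 558*g*x^2 + 158*g^2) / y^17 ]"

end

theory Submission
  imports Defs "HOL-Probability.Distributions"
begin

text \<open>
  Let \<open>T k = (\<Sum>j. (x - \<lambda> j) powi (- k))\<close>. Moving every eigenvalue by \<open>\<lambda> j \<mapsto> \<lambda> j + t * f (\<lambda> j)\<close> with
  \<open>f u = (x - u) powi (- a)\<close> multiplies the Vandermonde factor by a smooth bounded function of \<open>t\<close>,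
  so differentiating the invariance of the integral at \<open>t = 0\<close> gives the loop equations for every
  \<open>\<kappa> > 0\<close>, without boundary terms at coinciding eigenvalues. With this choice of \<open>f\<close> they form a
  closed system for the mixed moments of the \<open>T k\<close> at the single point \<open>x\<close>.

  The loop equation for \<open>a = 1\<close> says that \<open>s = T 1 / N\<close> nearly solves \<open>g * s\<^sup>2 - x * s + 1 = 0\<close>. Tested
  against \<open>cnj Q ^ p * Q ^ (p - 1)\<close>, where \<open>Q\<close> is the left-hand side divided by \<open>g\<close>, it bounds all
  moments of \<open>N * Q\<close>. The second root has imaginary part of the sign opposite to that of \<open>Im s\<close>, so
  \<open>s\<close> stays away from it and all moments of the fluctuations \<open>T 1 - N * m\<close> are bounded in \<open>N\<close>;
  the higher \<open>T k\<close> follow by the same argument and induction.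

  In rescaled fluctuations the loop equations express a moment through moments of smaller total
  index, up to terms with an extra factor \<open>1 / N\<close>. Together with the a priori bound this yields
  expansions of all moments to any order, with recursively computable coefficients, which are
  polynomials in \<open>u = x / y\<close> and \<open>h\<close>.
\<close>

text \<open>The powers of \<open>1 / (x - u)\<close> are chosen because their derivative, their
  divided difference and their product with \<open>u\<close> are again polynomials in such powers.
  So only the \<open>T k\<close> appear, and every function involved is bounded on the real line
  although the eigenvalues are not. The test function works because the loop equation multiplies
  \<open>N * Q\<close> by a factor of order \<open>N\<close>, while each remaining term is at most
  of order \<open>N\<close> times a lower power of \<open>N * Q\<close>. The factors
  \<open>N\<close> cancel and the moment of order \<open>2 * p\<close> is bounded by lower ones. The
  obstacle in the expansion is that the loop equations also contain moments of larger total index.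
  All of these carry the extra \<open>1 / N\<close>, hence are needed to one order less. The
  induction is therefore on the order first and on the total index second, and it starts from moment
  bounds for all index lists at once. The statistics are scaled by powers of \<open>y\<close> and by
  \<open>sqrt \<kappa>\<close> so that \<kappa>, \<open>g\<close>, \<open>x\<close> and
  \<open>y\<close> enter the recursion only through \<open>u\<close> and \<open>h\<close>.\<close>

abbreviation lborel_pow :: "nat \<Rightarrow> (nat \<Rightarrow> real) measure" where
  "lborel_pow N \<equiv> \<Pi>\<^sub>M j\<in>{..<N}. lborel"

section \<open>Uniform difference quotients\<close>

text \<open>\<open>F t\<close> tends to \<open>F0\<close> as \<open>t \<down> 0\<close>, with difference quotients converging to \<open>F1\<close> uniformly in \<open>v\<close>.
  Uniformity lets the derivative pass through any integral against a finite measure.\<close>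

definition udiff :: "(real \<Rightarrow> 'v \<Rightarrow> complex) \<Rightarrow> ('v \<Rightarrow> complex) \<Rightarrow> ('v \<Rightarrow> complex) \<Rightarrow> bool" where
  "udiff F F0 F1 \<longleftrightarrow> bounded (range F0) \<and> bounded (range F1) \<and>
     uniform_limit UNIV (\<lambda>t v. (F t v - F0 v) / complex_of_real t) F1 (at_right 0)"

lemma uniform_limit_of_real_0: "uniform_limit S (\<lambda>t v. complex_of_real t) (\<lambda>v. 0) (at_right 0)"
proof (rule uniform_limitI)
  fix e :: real assume "e > 0"
  then have "\<forall>\<^sub>F t in at_right (0::real). 0 < t \<and> t < e"
    by (intro eventually_at_rightI[of 0 e]) auto
  then show "\<forall>\<^sub>F t in at_right (0::real). \<forall>v\<in>S. dist (complex_of_real t) 0 < e"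
    by eventually_elim auto
qed

lemma eventually_at_right_pos: "\<forall>\<^sub>F t in at_right (0::real). t > 0"
  by (simp add: eventually_at_right_less)

lemma udiff_uniform_limit:
  assumes "udiff F F0 F1"
  shows "uniform_limit UNIV F F0 (at_right 0)"
proof -
  have "uniform_limit UNIV (\<lambda>t v. F0 v + complex_of_real t * ((F t v - F0 v) / complex_of_real t))
          (\<lambda>v. F0 v + 0 * F1 v) (at_right 0)"
    using assms unfolding udiff_def
    by (intro uniform_limit_add uniform_limit_const uniform_lim_mult uniform_limit_of_real_0) (auto simp: image_def)
  moreover have "\<forall>\<^sub>F t in at_right (0::real). \<forall>v\<in>UNIV. F0 v + complex_of_real t * ((F t v - F0 v) / complex_of_real t) = F t v"
    using eventually_at_right_pos by eventually_elim auto
  ultimately show ?thesis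
    by (subst (asm) uniform_limit_cong[where g = F and i = F0]) auto
qed

lemma udiff_const: "udiff (\<lambda>t v. c) (\<lambda>v. c) (\<lambda>v. 0)"
  by (auto simp: udiff_def image_def intro: uniform_limit_const)

lemma udiff_add:
  assumes "udiff F F0 F1" "udiff H H0 H1"
  shows "udiff (\<lambda>t v. F t v + H t v) (\<lambda>v. F0 v + H0 v) (\<lambda>v. F1 v + H1 v)"
proof -
  have "uniform_limit UNIV (\<lambda>t v. (F t v - F0 v) / complex_of_real t + (H t v - H0 v) / complex_of_real t)
          (\<lambda>v. F1 v + H1 v) (at_right 0)"
    using assms unfolding udiff_def by (intro uniform_limit_intros) auto
  then show ?thesis
    using assms unfolding udiff_def
    by (auto intro!: bounded_plus_comp simp: add_divide_distrib diff_divide_distrib algebra_simps)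
qed

lemma bounded_range_mult:
  fixes F H :: "'v \<Rightarrow> complex"
  assumes "bounded (range F)" "bounded (range H)"
  shows "bounded (range (\<lambda>v. F v * H v))"
proof -
  from assms obtain a b where "\<And>v. norm (F v) \<le> a" "\<And>v. norm (H v) \<le> b"
    unfolding bounded_iff by auto
  then have "norm (F v * H v) \<le> a * b" for v
    unfolding norm_mult by (intro mult_mono) (auto intro: order_trans[OF norm_ge_zero])
  then show ?thesis unfolding bounded_iff by auto
qed

text \<open>Telescopes the difference of products. Uniform limits multiply when the limit functions
  are bounded, hence the bounds built into \<open>udiff\<close>.\<close>

lemma udiff_mult:
  assumes F: "udiff F F0 F1" and H: "udiff H H0 H1"
  shows "udiff (\<lambda>t v. F t v * H t v) (\<lambda>v. F0 v * H0 v) (\<lambda>v. F1 v * H0 v + F0 v * H1 v)"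
proof -
  have "uniform_limit UNIV
      (\<lambda>t v. (F t v - F0 v) / complex_of_real t * H t v + F0 v * ((H t v - H0 v) / complex_of_real t))
      (\<lambda>v. F1 v * H0 v + F0 v * H1 v) (at_right 0)"
    using assms udiff_uniform_limit[OF H] unfolding udiff_def
    by (intro uniform_limit_intros uniform_lim_mult) auto
  moreover have "(F t v - F0 v) / complex_of_real t * H t v + F0 v * ((H t v - H0 v) / complex_of_real t)
     = (F t v * H t v - F0 v * H0 v) / complex_of_real t" for t v
    by (simp add: algebra_simps add_divide_distrib diff_divide_distrib)
  ultimately show ?thesis
    using assms unfolding udiff_def
    by (auto intro: bounded_plus_comp bounded_range_mult)
qed

text \<open>A displacement changes weight and volume by factors that all equal 1 at
  \<open>t = 0\<close>, so the product rule loses its cofactors and becomes a sum.\<close>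

lemma udiff_prod_one:
  assumes "finite A" "\<And>i. i \<in> A \<Longrightarrow> udiff (F i) (\<lambda>v. 1) (F1 i)"
  shows "udiff (\<lambda>t v. \<Prod>i\<in>A. F i t v) (\<lambda>v. 1) (\<lambda>v. \<Sum>i\<in>A. F1 i v)"
  using assms
proof (induction A rule: finite_induct)
  case empty
  then show ?case using udiff_const[of 1] by simp
next
  case (insert i A)
  have "udiff (\<lambda>t v. F i t v * (\<Prod>i\<in>A. F i t v)) (\<lambda>v. 1 * 1) (\<lambda>v. F1 i v * 1 + 1 * (\<Sum>i\<in>A. F1 i v))"
    using insert by (intro udiff_mult) auto
  then show ?case using insert by simp
qed

text \<open>Since \<open>A t\<close> tends to 0 uniformly, differentiability of \<psi> at the single
  point 0 is enough. Caratheodory's slope function \<open>k\<close> avoids a division by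
  \<open>A t v\<close>, which may vanish.\<close>

lemma udiff_compose:
  assumes A: "udiff (\<lambda>t v. complex_of_real (A t v)) (\<lambda>v. 0) (\<lambda>v. complex_of_real (A1 v))"
    and \<psi>: "(\<psi> has_real_derivative d) (at 0)" "\<psi> 0 = 1"
  shows "udiff (\<lambda>t v. complex_of_real (\<psi> (A t v))) (\<lambda>v. 1) (\<lambda>v. complex_of_real (d * A1 v))"
proof -
  obtain k where k: "\<And>z. \<psi> z - \<psi> 0 = k z * (z - 0)" "isCont k 0" "k 0 = d"
    using \<psi>(1) unfolding CARAT_DERIV by auto
  have "uniform_limit UNIV (\<lambda>t v. complex_of_real (k (A t v))) (\<lambda>v. complex_of_real d) (at_right 0)"
  proof (rule uniform_limitI)
    fix e :: real assume "e > 0"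
    then obtain r where r: "r > 0" "\<And>z. \<bar>z\<bar> < r \<Longrightarrow> \<bar>k z - d\<bar> < e"
      using k(2,3) unfolding continuous_at_eps_delta by (metis dist_real_def diff_0_right)
    have "\<forall>\<^sub>F t in at_right 0. \<forall>v\<in>UNIV. dist (complex_of_real (A t v)) 0 < r"
      using uniform_limitD[OF udiff_uniform_limit[OF A] r(1)] .
    then show "\<forall>\<^sub>F t in at_right 0. \<forall>v\<in>UNIV. dist (complex_of_real (k (A t v))) (complex_of_real d) < e"
      by eventually_elim (use r(2) in \<open>auto simp: dist_norm simp flip: of_real_diff\<close>)
  qed
  then have "uniform_limit UNIV (\<lambda>t v. complex_of_real (k (A t v)) * ((complex_of_real (A t v) - 0) / complex_of_real t))
      (\<lambda>v. complex_of_real d * complex_of_real (A1 v)) (at_right 0)"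
    using A unfolding udiff_def by (intro uniform_lim_mult) (auto simp: image_def)
  moreover have "complex_of_real (k (A t v)) * ((complex_of_real (A t v) - 0) / complex_of_real t)
     = (complex_of_real (\<psi> (A t v)) - 1) / complex_of_real t" for t v
  proof -
    have "complex_of_real (\<psi> (A t v)) - 1 = complex_of_real (\<psi> (A t v) - \<psi> 0)" using \<psi>(2) by simp
    also have "\<dots> = complex_of_real (k (A t v)) * complex_of_real (A t v)" using k(1)[of "A t v"] by simp
    finally show ?thesis by (simp only: diff_zero times_divide_eq_right)
  qed
  moreover have "bounded (range (\<lambda>v. complex_of_real d * complex_of_real (A1 v)))"
    using A unfolding udiff_def by (intro bounded_range_mult) (auto simp: image_def)
  ultimately show ?thesis
    unfolding udiff_def by (simp only: of_real_mult) simp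
qed

text \<open>Only the components \<open>v j\<close> with \<open>j < N\<close> are moved; the others are outside \<open>\<real>\<^sup>N\<close>.\<close>

definition shift :: "nat \<Rightarrow> (real \<Rightarrow> real) \<Rightarrow> real \<Rightarrow> (nat \<Rightarrow> real) \<Rightarrow> nat \<Rightarrow> real" where
  "shift N f t v = (\<lambda>j\<in>{..<N}. v j + t * f (v j))"

definition ddir :: "nat \<Rightarrow> (real \<Rightarrow> real) \<Rightarrow> ((nat \<Rightarrow> real) \<Rightarrow> complex) \<Rightarrow> ((nat \<Rightarrow> real) \<Rightarrow> complex) \<Rightarrow> bool" where
  "ddir N f G D \<longleftrightarrow>
     G \<in> borel_measurable (lborel_pow N) \<and> D \<in> borel_measurable (lborel_pow N) \<and>
     udiff (\<lambda>t v. G (shift N f t v)) G D"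

text \<open>The direction \<open>f\<close> of a displacement is real; complex \<open>f\<close> are reached by \<open>\<complex>\<close>-linear extension.\<close>

definition vderiv :: "nat \<Rightarrow> (real \<Rightarrow> complex) \<Rightarrow> ((nat \<Rightarrow> real) \<Rightarrow> complex) \<Rightarrow> ((nat \<Rightarrow> real) \<Rightarrow> complex) \<Rightarrow> bool" where
  "vderiv N f G D \<longleftrightarrow> (\<exists>D1 D2. ddir N (\<lambda>u. Re (f u)) G D1 \<and> ddir N (\<lambda>u. Im (f u)) G D2 \<and>
     D = (\<lambda>v. D1 v + \<i> * D2 v))"

section \<open>Calculus of derivatives along displacements of the eigenvalues\<close>

lemma ddir_const: "ddir N f (\<lambda>v. c) (\<lambda>v. 0)"
  by (simp add: ddir_def udiff_const)

lemma ddir_add: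
  "ddir N f G D \<Longrightarrow> ddir N f H E \<Longrightarrow> ddir N f (\<lambda>v. G v + H v) (\<lambda>v. D v + E v)"
  unfolding ddir_def by (auto intro: udiff_add)

lemma ddir_mult:
  "ddir N f G D \<Longrightarrow> ddir N f H E \<Longrightarrow> ddir N f (\<lambda>v. G v * H v) (\<lambda>v. D v * H v + G v * E v)"
  unfolding ddir_def by (intro conjI borel_measurable_times borel_measurable_add udiff_mult) auto

lemma vderiv_const: "vderiv N f (\<lambda>v. c) (\<lambda>v. 0)"
  unfolding vderiv_def
  by (rule exI[of _ "\<lambda>v. 0"], rule exI[of _ "\<lambda>v. 0"]) (simp add: ddir_const)

lemma vderiv_add:
  assumes "vderiv N f G D" "vderiv N f H E"
  shows "vderiv N f (\<lambda>v. G v + H v) (\<lambda>v. D v + E v)"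
proof -
  from assms obtain D1 D2 E1 E2 where *: "ddir N (\<lambda>u. Re (f u)) G D1" "ddir N (\<lambda>u. Im (f u)) G D2"
    "D = (\<lambda>v. D1 v + \<i> * D2 v)" "ddir N (\<lambda>u. Re (f u)) H E1" "ddir N (\<lambda>u. Im (f u)) H E2"
    "E = (\<lambda>v. E1 v + \<i> * E2 v)"
    unfolding vderiv_def by blast
  show ?thesis unfolding vderiv_def
    by (rule exI[of _ "\<lambda>v. D1 v + E1 v"], rule exI[of _ "\<lambda>v. D2 v + E2 v"])
       (use * in \<open>auto intro!: ddir_add simp: algebra_simps\<close>)
qed

lemma vderiv_mult:
  assumes "vderiv N f G D" "vderiv N f H E"
  shows "vderiv N f (\<lambda>v. G v * H v) (\<lambda>v. D v * H v + G v * E v)"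
proof -
  from assms obtain D1 D2 E1 E2 where *: "ddir N (\<lambda>u. Re (f u)) G D1" "ddir N (\<lambda>u. Im (f u)) G D2"
    "D = (\<lambda>v. D1 v + \<i> * D2 v)" "ddir N (\<lambda>u. Re (f u)) H E1" "ddir N (\<lambda>u. Im (f u)) H E2"
    "E = (\<lambda>v. E1 v + \<i> * E2 v)"
    unfolding vderiv_def by blast
  show ?thesis unfolding vderiv_def
    by (rule exI[of _ "\<lambda>v. D1 v * H v + G v * E1 v"], rule exI[of _ "\<lambda>v. D2 v * H v + G v * E2 v"])
       (use * in \<open>auto intro!: ddir_mult simp: ring_distribs\<close>)
qed

lemma vderiv_cmult:
  assumes "vderiv N f G D"
  shows "vderiv N f (\<lambda>v. c * G v) (\<lambda>v. c * D v)"
  using vderiv_mult[OF vderiv_const[of N f c] assms] by simp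

lemma vderiv_sum:
  assumes "finite A" "\<And>i. i \<in> A \<Longrightarrow> vderiv N f (G i) (D i)"
  shows "vderiv N f (\<lambda>v. \<Sum>i\<in>A. G i v) (\<lambda>v. \<Sum>i\<in>A. D i v)"
  using assms by (induction A rule: finite_induct) (auto intro!: vderiv_const vderiv_add)

lemma vderiv_power:
  assumes "vderiv N f G D"
  shows "vderiv N f (\<lambda>v. G v ^ p) (\<lambda>v. of_nat p * G v ^ (p - 1) * D v)"
proof (induction p)
  case 0
  then show ?case using vderiv_const[of N f 1] by simp
next
  case (Suc p)
  show ?case
    using vderiv_mult[OF assms Suc] by (cases p) (simp_all add: algebra_simps)
qed

text \<open>By the resolvent identity the difference quotient is exactly \<open>f\<close> times the
  product of the displaced and the original resolvent. The bound \<open>1 / \<bar>Im z\<bar>\<close>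
  then makes the convergence uniform.\<close>

lemma udiff_resolvent:
  assumes z: "Im z \<noteq> 0" and f: "bounded (range f)" and j: "j < N"
  shows "udiff (\<lambda>t v. 1 / (z - complex_of_real (shift N f t v j))) (\<lambda>v. 1 / (z - complex_of_real (v j)))
           (\<lambda>v. complex_of_real (f (v j)) / (z - complex_of_real (v j))\<^sup>2)"
proof -
  let ?B = "1 / \<bar>Im z\<bar>"
  have nz: "z - complex_of_real a \<noteq> 0" for a using z by auto
  have B: "norm (1 / (z - complex_of_real a)) \<le> ?B" for a
  proof -
    have "\<bar>Im z\<bar> \<le> norm (z - complex_of_real a)" using abs_Im_le_cmod[of "z - complex_of_real a"] by simp
    then show ?thesis using z by (simp add: norm_divide frac_le)
  qed
  obtain K where K: "\<And>u. \<bar>f u\<bar> \<le> K" using f unfolding bounded_iff by auto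
  have K0: "K \<ge> 0" using K[of 0] by linarith
  have sh: "shift N f t v j = v j + t * f (v j)" for t v using j by (simp add: shift_def)
  let ?r = "\<lambda>t v. 1 / (z - complex_of_real (v j + t * f (v j)))"
  have diff: "?r t v - 1 / (z - complex_of_real (v j)) = complex_of_real t * (complex_of_real (f (v j)) * (?r t v * (1 / (z - complex_of_real (v j)))))" for t v
  proof -
    have "1 / a - 1 / b = (b - a) * (1 / a * (1 / b))" if "a \<noteq> 0" "b \<noteq> 0" for a b :: complex
      using that by (simp add: field_simps)
    from this[OF nz[of "v j + t * f (v j)"] nz[of "v j"]] show ?thesis by simp
  qed
  have u0: "uniform_limit UNIV ?r (\<lambda>v. 1 / (z - complex_of_real (v j))) (at_right 0)"
  proof (rule uniform_limitI)
    fix e :: real assume e: "e > 0"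
    \<comment> \<open>The summand 1 keeps \<open>C\<close> positive even if \<open>K = 0\<close>, so
      that \<open>e / C\<close> is a positive threshold.\<close>
    define C where "C = K * (?B * ?B) + 1"
    have C: "C > 0" using K0 unfolding C_def by (intro add_nonneg_pos mult_nonneg_nonneg) auto
    have "\<forall>\<^sub>F t in at_right (0::real). 0 < t \<and> t < e / C"
      using e C by (intro eventually_at_rightI[of 0 "e / C"]) auto
    then show "\<forall>\<^sub>F t in at_right 0. \<forall>v\<in>UNIV. dist (?r t v) (1 / (z - complex_of_real (v j))) < e"
    proof eventually_elim
      case (elim t)
      { fix v
        have *: "norm (complex_of_real (f (v j)) * (?r t v * (1 / (z - complex_of_real (v j))))) \<le> K * (?B * ?B)"
          unfolding norm_mult using K K0 B by (intro mult_mono) (auto simp del: of_real_add)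
        then have "norm (complex_of_real t * (complex_of_real (f (v j)) * (?r t v * (1 / (z - complex_of_real (v j)))))) \<le> t * (K * (?B * ?B))"
          using mult_left_mono[OF *, of t] elim by (simp only: norm_mult[of "complex_of_real t"] norm_of_real abs_of_pos less_imp_le)
        also have "\<dots> \<le> t * C" using elim unfolding C_def by (intro mult_left_mono) auto
        also have "\<dots> < e" using elim C by (metis pos_less_divide_eq)
        finally have "dist (?r t v) (1 / (z - complex_of_real (v j))) < e"
          unfolding dist_norm diff . }
      then show ?case by blast
    qed
  qed
  have bf: "bounded (range (\<lambda>v::nat\<Rightarrow>real. complex_of_real (f (v j))))"
    using K unfolding bounded_iff by auto
  have br: "bounded (range (\<lambda>v::nat\<Rightarrow>real. 1 / (z - complex_of_real (v j))))"
    unfolding bounded_iff using B by blast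
  have bfr: "bounded (range (\<lambda>v::nat\<Rightarrow>real. complex_of_real (f (v j)) * (1 / (z - complex_of_real (v j)))))"
    by (rule bounded_range_mult[OF bf br])
  have "uniform_limit UNIV (\<lambda>t v. (complex_of_real (f (v j)) * (1 / (z - complex_of_real (v j)))) * ?r t v)
     (\<lambda>v. (complex_of_real (f (v j)) * (1 / (z - complex_of_real (v j)))) * (1 / (z - complex_of_real (v j)))) (at_right 0)"
    by (intro uniform_lim_mult u0 bfr br uniform_limit_const)
  then have "uniform_limit UNIV (\<lambda>t v. (?r t v - 1 / (z - complex_of_real (v j))) / complex_of_real t)
      (\<lambda>v. complex_of_real (f (v j)) / (z - complex_of_real (v j))\<^sup>2) (at_right 0)"
  proof (rule uniform_limit_cong[THEN iffD1, rotated 2])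
    have "(complex_of_real (f (v j)) * (1 / (z - complex_of_real (v j)))) * ?r t v = (?r t v - 1 / (z - complex_of_real (v j))) / complex_of_real t"
      if "t > 0" for t v
      unfolding diff using that by (simp only: nonzero_mult_div_cancel_left of_real_eq_0_iff mult_ac)
    then show "\<forall>\<^sub>F t in at_right 0. \<forall>v\<in>UNIV. (complex_of_real (f (v j)) * (1 / (z - complex_of_real (v j)))) * ?r t v = (?r t v - 1 / (z - complex_of_real (v j))) / complex_of_real t"
      using eventually_at_right_pos by (auto elim!: eventually_mono)
  qed (simp add: power2_eq_square)
  then show ?thesis
    using br bounded_range_mult[OF bfr br] unfolding udiff_def sh by (simp add: power2_eq_square)
qed


lemma vderiv_resolvent:
  assumes z: "Im z \<noteq> 0" and f: "bounded (range f)" "f \<in> borel_measurable borel" and j: "j < N"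
  shows "vderiv N f (\<lambda>v. 1 / (z - complex_of_real (v j))) (\<lambda>v. f (v j) / (z - complex_of_real (v j))\<^sup>2)"
proof -
  have meas [measurable]: "(\<lambda>v. v j) \<in> measurable (lborel_pow N) borel"
    using measurable_component_singleton[of j "{..<N}" "\<lambda>_. lborel"] j by simp
  note [measurable] = f(2)
  have dd: "ddir N F (\<lambda>v. 1 / (z - complex_of_real (v j))) (\<lambda>v. complex_of_real (F (v j)) / (z - complex_of_real (v j))\<^sup>2)"
    if "bounded (range F)" and [measurable]: "F \<in> borel_measurable borel" for F
    unfolding ddir_def
  proof (intro conjI udiff_resolvent[OF z that(1) j])
    show "(\<lambda>v. 1 / (z - complex_of_real (v j))) \<in> borel_measurable (lborel_pow N)"
      by measurable
    show "(\<lambda>v. complex_of_real (F (v j)) / (z - complex_of_real (v j))\<^sup>2) \<in> borel_measurable (lborel_pow N)"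
      by measurable
  qed
  have b: "bounded (range (\<lambda>u. Re (f u)))" "bounded (range (\<lambda>u. Im (f u)))"
  proof -
    obtain K where "\<And>u. norm (f u) \<le> K" using f(1) unfolding bounded_iff by auto
    then show "bounded (range (\<lambda>u. Re (f u)))" "bounded (range (\<lambda>u. Im (f u)))"
      unfolding bounded_iff using order_trans[OF abs_Re_le_cmod] order_trans[OF abs_Im_le_cmod]
      by (auto intro!: exI[of _ K])
  qed
  have d1: "ddir N (\<lambda>u. Re (f u)) (\<lambda>v. 1 / (z - complex_of_real (v j))) (\<lambda>v. complex_of_real (Re (f (v j))) / (z - complex_of_real (v j))\<^sup>2)"
    by (rule dd[OF b(1)]) measurable
  have d2: "ddir N (\<lambda>u. Im (f u)) (\<lambda>v. 1 / (z - complex_of_real (v j))) (\<lambda>v. complex_of_real (Im (f (v j))) / (z - complex_of_real (v j))\<^sup>2)"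
    by (rule dd[OF b(2)]) measurable
  have "f u / w = complex_of_real (Re (f u)) / w + \<i> * (complex_of_real (Im (f u)) / w)" for u w
    by (subst (1) complex_eq[of "f u"]) (simp add: add_divide_distrib)
  then have "(\<lambda>v::nat\<Rightarrow>real. f (v j) / (z - complex_of_real (v j))\<^sup>2) =
     (\<lambda>v. complex_of_real (Re (f (v j))) / (z - complex_of_real (v j))\<^sup>2 + \<i> * (complex_of_real (Im (f (v j))) / (z - complex_of_real (v j))\<^sup>2))"
    by blast
  then show ?thesis
    unfolding vderiv_def using d1 d2 by blast
qed

text \<open>The \<open>T k\<close> of the overview at a general point \<open>z\<close>: besides
  \<open>x\<close>, the point \<open>cnj x\<close> occurs, because it carries the conjugate of a
  statistic.\<close>

definition pstat :: "nat \<Rightarrow> complex \<Rightarrow> nat \<Rightarrow> (nat \<Rightarrow> real) \<Rightarrow> complex" where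
  "pstat N z k v = (\<Sum>j<N. (1 / (z - complex_of_real (v j))) ^ k)"

lemma vderiv_pstat:
  assumes z: "Im z \<noteq> 0" and f: "bounded (range f)" "f \<in> borel_measurable borel"
  shows "vderiv N f (pstat N z k) (\<lambda>v. \<Sum>j<N. of_nat k * f (v j) * (1 / (z - complex_of_real (v j))) ^ (k + 1))"
proof -
  \<comment> \<open>At \<open>k = 0\<close> the truncated exponent \<open>k - 1\<close> does no
    harm, as the factor \<open>of_nat k\<close> vanishes.\<close>
  have eq: "of_nat k * (1 / w) ^ (k - 1) * (c / w\<^sup>2) = of_nat k * c * (1 / w) ^ (k + 1)" for c w :: complex
    by (cases k) (simp_all add: power2_eq_square)
  have "vderiv N f (\<lambda>v. \<Sum>j<N. (1 / (z - complex_of_real (v j))) ^ k)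
     (\<lambda>v. \<Sum>j<N. of_nat k * (1 / (z - complex_of_real (v j))) ^ (k - 1) * (f (v j) / (z - complex_of_real (v j))\<^sup>2))"
    by (intro vderiv_sum vderiv_power vderiv_resolvent z f) auto
  then show ?thesis unfolding eq pstat_def[abs_def] .
qed

section \<open>Change of variables\<close>

text \<open>It suffices to measure intervals. The preimage of an interval under the increasing
  bijection \<phi> is again an interval, over which the fundamental theorem of calculus integrates
  the derivative.\<close>

lemma distr_density_deriv_lborel:
  fixes \<phi> \<phi>' :: "real \<Rightarrow> real"
  assumes der: "\<And>u. (\<phi> has_real_derivative \<phi>' u) (at u)"
    and pos: "\<And>u. \<phi>' u > 0" and [measurable]: "\<phi>' \<in> borel_measurable borel"
    and surj: "surj \<phi>"
  shows "distr (density lborel (\<lambda>u. ennreal (\<phi>' u))) borel \<phi> = lborel"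
proof (rule lborel_eqI[symmetric])
  have mono: "strict_mono \<phi>"
    using DERIV_pos_imp_increasing der pos by (metis strict_monoI)
  have cont: "continuous_on UNIV \<phi>"
    using der by (meson DERIV_isCont continuous_at_imp_continuous_on)
  then have [measurable]: "\<phi> \<in> borel_measurable borel"
    by (rule borel_measurable_continuous_onI)
  fix l u :: real
  assume "\<And>b. b \<in> Basis \<Longrightarrow> l \<bullet> b \<le> u \<bullet> b"
  then have lu: "l \<le> u" by simp
  obtain a b where ab: "\<phi> a = l" "\<phi> b = u" using surj by (metis surjD)
  have le: "a \<le> b" using lu ab mono by (metis strict_mono_less_eq)
  have "emeasure (distr (density lborel (\<lambda>u. ennreal (\<phi>' u))) borel \<phi>) (box l u) =
     (\<integral>\<^sup>+x. ennreal (\<phi>' x) * indicator (\<phi> -` box l u) x \<partial>lborel)"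
    using measurable_sets_borel[OF \<open>\<phi> \<in> borel_measurable borel\<close>, of "box l u"]
    by (subst emeasure_distr, simp, simp, subst emeasure_density) auto
  also have "\<phi> -` box l u = {a<..<b}"
    using ab strict_mono_less[OF mono] by (auto simp: box_real)
  also have "(\<integral>\<^sup>+x. ennreal (\<phi>' x) * indicator {a<..<b} x \<partial>lborel) = (\<integral>\<^sup>+x. ennreal (\<phi>' x) * indicator {a..b} x \<partial>lborel)"
  proof (rule nn_integral_cong_AE)
    show "AE x in lborel. ennreal (\<phi>' x) * indicator {a<..<b} x = ennreal (\<phi>' x) * indicator {a..b} x"
      using AE_lborel_singleton[of a] AE_lborel_singleton[of b]
      by eventually_elim (auto simp: indicator_def)
  qed
  also have "\<dots> = ennreal (\<phi> b - \<phi> a)"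
    using der pos le by (intro nn_integral_FTC_Icc) (auto intro: less_imp_le has_field_derivative_at_within)
  finally show "emeasure (distr (density lborel (\<lambda>u. ennreal (\<phi>' u))) borel \<phi>) (box l u) = ennreal (\<Prod>b\<in>Basis. (u - l) \<bullet> b)"
    using ab by simp
qed simp

text \<open>Each eigenvalue is displaced by a function of itself alone, so both the map and the
  density act coordinatewise. By uniqueness of the product measure only rectangles have to be
  compared, and there the integral factorises.\<close>

lemma distr_density_prod_PiM_lborel:
  fixes \<phi> \<phi>' :: "real \<Rightarrow> real"
  assumes der: "\<And>u. (\<phi> has_real_derivative \<phi>' u) (at u)"
    and pos: "\<And>u. \<phi>' u > 0" and meas' [measurable]: "\<phi>' \<in> borel_measurable borel"
    and surj: "surj \<phi>" and fin: "finite I"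
  shows "distr (density (\<Pi>\<^sub>M j\<in>I. lborel) (\<lambda>v. ennreal (\<Prod>j\<in>I. \<phi>' (v j)))) (\<Pi>\<^sub>M j\<in>I. lborel)
      (\<lambda>v. \<lambda>j\<in>I. \<phi> (v j)) = (\<Pi>\<^sub>M j\<in>I. lborel)" (is "?P = _")
proof -
  interpret product_sigma_finite "\<lambda>_. lborel :: real measure" by standard
  let ?M = "\<Pi>\<^sub>M j\<in>I. (lborel :: real measure)"
  have cont: "continuous_on UNIV \<phi>"
    using der by (meson DERIV_isCont continuous_at_imp_continuous_on)
  then have meas [measurable]: "\<phi> \<in> borel_measurable borel"
    by (rule borel_measurable_continuous_onI)
  have shm [measurable]: "(\<lambda>v. \<lambda>j\<in>I. \<phi> (v j)) \<in> measurable ?M ?M"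
    by (rule measurable_restrict) measurable
  show ?thesis
  proof (rule PiM_eqI[OF fin])
    fix A assume A: "\<And>i. i \<in> I \<Longrightarrow> A i \<in> sets (lborel :: real measure)"
    have APi: "Pi\<^sub>E I A \<in> sets ?M" using A fin by (intro sets_PiM_I_finite) auto
    have pm: "(\<lambda>v. ennreal (\<Prod>j\<in>I. \<phi>' (v j))) \<in> borel_measurable ?M" by measurable
    have "emeasure ?P (Pi\<^sub>E I A) =
      (\<integral>\<^sup>+v. ennreal (\<Prod>j\<in>I. \<phi>' (v j)) * indicator ((\<lambda>v. \<lambda>j\<in>I. \<phi> (v j)) -` Pi\<^sub>E I A \<inter> space ?M) v \<partial>?M)"
      using APi shm pm by (subst emeasure_distr) (auto simp: emeasure_density)
    also have "\<dots> = (\<integral>\<^sup>+v. (\<Prod>j\<in>I. ennreal (\<phi>' (v j)) * indicator (\<phi> -` A j) (v j)) \<partial>?M)"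
    proof (rule nn_integral_cong)
      fix v assume v: "v \<in> space ?M"
      have "indicator ((\<lambda>v. \<lambda>j\<in>I. \<phi> (v j)) -` Pi\<^sub>E I A \<inter> space ?M) v = (\<Prod>j\<in>I. indicator (\<phi> -` A j) (v j) :: ennreal)"
        using v fin by (auto simp: indicator_def PiE_iff prod_zero_iff)
      then show "ennreal (\<Prod>j\<in>I. \<phi>' (v j)) * indicator ((\<lambda>v. \<lambda>j\<in>I. \<phi> (v j)) -` Pi\<^sub>E I A \<inter> space ?M) v =
        (\<Prod>j\<in>I. ennreal (\<phi>' (v j)) * indicator (\<phi> -` A j) (v j))"
        using pos by (simp add: prod.distrib prod_ennreal less_imp_le)
    qed
    also have "\<dots> = (\<Prod>j\<in>I. \<integral>\<^sup>+u. ennreal (\<phi>' u) * indicator (\<phi> -` A j) u \<partial>lborel)"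
      using A fin measurable_sets[OF meas] by (intro product_nn_integral_prod) auto
    also have "\<dots> = (\<Prod>j\<in>I. emeasure lborel (A j))"
    proof (rule prod.cong[OF refl])
      fix j assume "j \<in> I"
      then have Aj [measurable]: "A j \<in> sets borel" using A by simp
      have "emeasure lborel (A j) = emeasure (distr (density lborel (\<lambda>u. ennreal (\<phi>' u))) borel \<phi>) (A j)"
        using distr_density_deriv_lborel[OF der pos meas' surj] by simp
      also have "\<dots> = (\<integral>\<^sup>+u. ennreal (\<phi>' u) * indicator (\<phi> -` A j) u \<partial>lborel)"
        using measurable_sets[OF meas Aj] by (subst emeasure_distr) (auto simp: emeasure_density)
      finally show "(\<integral>\<^sup>+u. ennreal (\<phi>' u) * indicator (\<phi> -` A j) u \<partial>lborel) = emeasure lborel (A j)" by simp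
    qed
    finally show "emeasure ?P (Pi\<^sub>E I A) = (\<Prod>i\<in>I. emeasure lborel (A i))" .
  qed simp
qed

text \<open>Intermediate value theorem on the interval from \<open>w - K\<close> to
  \<open>w + K\<close>.\<close>

lemma surj_of_bounded_perturbation:
  fixes f :: "real \<Rightarrow> real"
  assumes "continuous_on UNIV f" "\<And>u. \<bar>f u\<bar> \<le> K"
  shows "surj (\<lambda>u. u + f u)"
proof (rule surjI)
  fix w
  have "\<exists>u\<ge>w - K. u \<le> w + K \<and> u + f u = w"
    using assms(2)[of "w - K"] assms(2)[of "w + K"] 
    by (intro IVT') (auto intro!: continuous_intros continuous_on_subset[OF assms(1)])
  then show "(\<lambda>u. u + f u) (SOME u. u + f u = w) = w" by (metis (mono_tags, lifting) someI_ex)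
qed

text \<open>This invariance is what the loop equations differentiate. The condition
  \<open>t * K < 1\<close> keeps the Jacobian factors positive, which makes the displacement
  increasing in each coordinate.\<close>

lemma integral_PiM_shift:
  fixes F :: "(nat \<Rightarrow> real) \<Rightarrow> complex"
  assumes der: "\<And>u. (f has_real_derivative f' u) (at u)"
    and [measurable]: "f' \<in> borel_measurable borel"
    and K: "\<And>u. \<bar>f u\<bar> \<le> K" "\<And>u. \<bar>f' u\<bar> \<le> K" and t: "0 < t" "t * K < 1"
    and F: "integrable (lborel_pow N) F"
  shows "integrable (lborel_pow N) (\<lambda>v. (\<Prod>j<N. 1 + t * f' (v j)) *\<^sub>R F (shift N f t v))"
    and "(\<integral>v. (\<Prod>j<N. 1 + t * f' (v j)) *\<^sub>R F (shift N f t v) \<partial>(lborel_pow N)) =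
      (\<integral>v. F v \<partial>(lborel_pow N))"
proof -
  let ?M = "lborel_pow N"
  let ?J = "\<lambda>v. \<Prod>j<N. 1 + t * f' (v j)"
  have pos: "1 + t * f' u > 0" for u
  proof -
    have "\<bar>t * f' u\<bar> \<le> t * K" using K(2)[of u] t by (simp add: abs_mult)
    then show ?thesis using t by linarith
  qed
  have derphi: "((\<lambda>u. u + t * f u) has_real_derivative 1 + t * f' u) (at u)" for u
    by (auto intro!: derivative_eq_intros der)
  have contf: "continuous_on UNIV f"
    using der by (meson DERIV_isCont continuous_at_imp_continuous_on)
  have surj: "surj (\<lambda>u. u + t * f u)"
    using K(1) t by (intro surj_of_bounded_perturbation[where K = "t * K"] continuous_intros contf)
      (simp add: abs_mult)
  have D: "distr (density ?M (\<lambda>v. ennreal (?J v))) ?M (shift N f t) = ?M"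
    using distr_density_prod_PiM_lborel[OF derphi pos _ surj, of "{..<N}"] by (simp add: shift_def[abs_def])
  have [measurable]: "f \<in> borel_measurable borel"
    using contf by (rule borel_measurable_continuous_onI)
  have sh [measurable]: "shift N f t \<in> measurable ?M ?M"
    unfolding shift_def[abs_def] by (rule measurable_restrict) measurable
  have Fm [measurable]: "F \<in> borel_measurable ?M" using F by simp
  have Jm [measurable]: "?J \<in> borel_measurable ?M" by measurable
  have J0: "AE v in ?M. 0 \<le> ?J v" using pos by (intro AE_I2 prod_nonneg) (auto intro: less_imp_le)
  have FD: "integrable (distr (density ?M (\<lambda>v. ennreal (?J v))) ?M (shift N f t)) F" using F D by simp
  then have "integrable (density ?M (\<lambda>v. ennreal (?J v))) (\<lambda>v. F (shift N f t v))"
    by (subst (asm) integrable_distr_eq) auto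
  then show "integrable ?M (\<lambda>v. ?J v *\<^sub>R F (shift N f t v))"
    by (subst (asm) integrable_density) (auto simp: J0)
  have "(\<integral>v. F v \<partial>?M) = (\<integral>v. F v \<partial>distr (density ?M (\<lambda>v. ennreal (?J v))) ?M (shift N f t))"
    using D by simp
  also have "\<dots> = (\<integral>v. F (shift N f t v) \<partial>density ?M (\<lambda>v. ennreal (?J v)))"
    by (subst integral_distr) auto
  also have "\<dots> = (\<integral>v. ?J v *\<^sub>R F (shift N f t v) \<partial>?M)"
    by (subst integral_density) (auto simp: J0)
  finally show "(\<integral>v. ?J v *\<^sub>R F (shift N f t v) \<partial>?M) = (\<integral>v. F v \<partial>?M)" by simp
qed

section \<open>The Gaussian ensemble as a probability measure\<close>

lemma gbe_weight_nonneg: "gbe_weight g \<kappa> N v \<ge> 0"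
  unfolding gbe_weight_def by (intro mult_nonneg_nonneg prod_nonneg) auto

lemma gbe_weight_measurable [measurable]:
  "gbe_weight g \<kappa> N \<in> borel_measurable (lborel_pow N)"
proof -
  have c [measurable]: "(\<lambda>v. v l) \<in> borel_measurable (lborel_pow N)" if "l < N" for l
    using measurable_component_singleton[of l "{..<N}" "\<lambda>_. lborel :: real measure"] that by simp
  have "(\<lambda>v. exp (- (real N * \<kappa> * (v l)\<^sup>2 / (2 * g)))) \<in> borel_measurable (lborel_pow N)" if "l < N" for l
    using c[OF that] by measurable
  moreover have "(\<lambda>v. \<bar>v k - v j\<bar> powr (2 * \<kappa>)) \<in> borel_measurable (lborel_pow N)" if "k < N" "j < k" for k j
  proof -
    have "j < N" using that by simp
    note [measurable] = c[OF that(1)] c[OF this]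
    show ?thesis by measurable
  qed
  ultimately show ?thesis
    unfolding gbe_weight_def[abs_def] by (intro borel_measurable_times borel_measurable_prod) auto
qed

text \<open>The real exponent is rounded up to a natural number \<open>n\<close>, and
  \<open>(1 + \<bar>u\<bar>) ^ n\<close> is at most \<open>2 ^ n * (1 + \<bar>u\<bar> ^ n)\<close>.
  What remains are absolute moments of a normal density.\<close>

lemma integrable_exp_powr:
  fixes c p :: real
  assumes "c > 0" "p \<ge> 0"
  shows "integrable lborel (\<lambda>u. exp (- (c * u\<^sup>2)) * (1 + \<bar>u\<bar>) powr p)"
proof -
  define n where "n = nat \<lceil>p\<rceil>"
  \<comment> \<open>The standard deviation for which \<open>exp (- (c * u\<^sup>2))\<close> is a
    multiple of the centred normal density; \<open>d\<close> below is the multiple.\<close>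
  define \<sigma> where "\<sigma> = sqrt (1 / (2 * c))"
  have \<sigma>: "\<sigma> > 0" "\<sigma>\<^sup>2 = 1 / (2 * c)" using assms by (auto simp: \<sigma>_def)
  have nd: "normal_density 0 \<sigma> u = 1 / sqrt (2 * pi * \<sigma>\<^sup>2) * exp (- (c * u\<^sup>2))" for u
    using \<sigma> assms by (simp add: normal_density_def field_simps)
  define d where "d = sqrt (2 * pi * \<sigma>\<^sup>2)"
  have d: "d > 0" using \<sigma>(2) assms(1) by (simp add: d_def)
  have "integrable lborel (\<lambda>u. d * 2 ^ n * (normal_density 0 \<sigma> u + normal_density 0 \<sigma> u * \<bar>u - 0\<bar> ^ n))"
    using \<sigma> by (intro integrable_mult_right Bochner_Integration.integrable_add integrable_normal_moment_abs integrable_normal_density)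
  then show ?thesis
  proof (rule Bochner_Integration.integrable_bound)
    show "AE u in lborel. norm (exp (- (c * u\<^sup>2)) * (1 + \<bar>u\<bar>) powr p) \<le>
        norm (d * 2 ^ n * (normal_density 0 \<sigma> u + normal_density 0 \<sigma> u * \<bar>u - 0\<bar> ^ n))"
    proof (rule AE_I2)
      fix u :: real
      have "(1 + \<bar>u\<bar>) powr p \<le> (1 + \<bar>u\<bar>) powr real n"
        using assms by (intro powr_mono) (auto simp: n_def)
      also have "\<dots> = (1 + \<bar>u\<bar>) ^ n" by (simp add: powr_realpow)
      also have "\<dots> \<le> (2 * max 1 \<bar>u\<bar>) ^ n" by (intro power_mono) auto
      also have "\<dots> = 2 ^ n * max 1 \<bar>u\<bar> ^ n" by (simp add: power_mult_distrib)
      also have "max 1 \<bar>u\<bar> ^ n \<le> 1 + \<bar>u\<bar> ^ n" by (auto simp: max_def)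
      finally have le: "(1 + \<bar>u\<bar>) powr p \<le> 2 ^ n * (1 + \<bar>u\<bar> ^ n)" by simp
      have "exp (- (c * u\<^sup>2)) = d * normal_density 0 \<sigma> u" unfolding nd using d by (simp flip: d_def)
      then have "norm (exp (- (c * u\<^sup>2)) * (1 + \<bar>u\<bar>) powr p) \<le> d * normal_density 0 \<sigma> u * (2 ^ n * (1 + \<bar>u\<bar> ^ n))"
        using le d by (simp add: abs_mult mult_left_mono)
      also have "\<dots> = d * 2 ^ n * (normal_density 0 \<sigma> u + normal_density 0 \<sigma> u * \<bar>u - 0\<bar> ^ n)"
        by (simp add: algebra_simps)
      finally show "norm (exp (- (c * u\<^sup>2)) * (1 + \<bar>u\<bar>) powr p) \<le>
        norm (d * 2 ^ n * (normal_density 0 \<sigma> u + normal_density 0 \<sigma> u * \<bar>u - 0\<bar> ^ n))"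
        by (simp only: real_norm_def abs_ge_self order_trans[OF _ abs_ge_self])
    qed
  qed measurable
qed

text \<open>Every difference of two eigenvalues is at most \<open>P\<close>, the product of all
  \<open>1 + \<bar>v l\<bar>\<close>. Bounding each Vandermonde factor by the same \<open>P\<close>
  is crude, but it turns the weight into a product of functions of one variable. The number
  \<open>m\<close> counts the pairs.\<close>

lemma integrable_gbe_weight:
  assumes g: "g > 0" and \<kappa>: "\<kappa> > 0"
  shows "integrable (lborel_pow N) (gbe_weight g \<kappa> N)"
proof -
  interpret product_sigma_finite "\<lambda>_. lborel :: real measure" by standard
  show ?thesis
  \<comment> \<open>For \<open>N = 0\<close> the Gaussian rate \<open>c\<close> would be 0; there
    the integral is over a one-point space.\<close>
  proof (cases "N = 0")
    case True
    have "integrable (\<Pi>\<^sub>M j\<in>{}. (lborel :: real measure)) (gbe_weight g \<kappa> 0)"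
      unfolding PiM_empty by (rule integrable_count_space) simp
    then show ?thesis using True by simp
  next
    case False
    define c where "c = real N * \<kappa> / (2 * g)"
    have c: "c > 0" using g \<kappa> False by (simp add: c_def)
    define m where "m = (\<Sum>k<N. real k)"
    define p where "p = 2 * \<kappa> * m"
    have p: "p \<ge> 0" using \<kappa> by (simp add: p_def m_def sum_nonneg)
    have "integrable (lborel_pow N) (\<lambda>v. \<Prod>l<N. exp (- (c * (v l)\<^sup>2)) * (1 + \<bar>v l\<bar>) powr p)"
      by (intro product_integrable_prod integrable_exp_powr c p) auto
    then show ?thesis
    proof (rule Bochner_Integration.integrable_bound)
      show "AE v in lborel_pow N. norm (gbe_weight g \<kappa> N v) \<le> norm (\<Prod>l<N. exp (- (c * (v l)\<^sup>2)) * (1 + \<bar>v l\<bar>) powr p)"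
      proof (rule AE_I2)
        fix v :: "nat \<Rightarrow> real"
        define P where "P = (\<Prod>l<N. 1 + \<bar>v l\<bar>)"
        have P: "P \<ge> 1" unfolding P_def by (intro prod_ge_1) auto
        have le: "\<bar>v k - v j\<bar> \<le> P" if "k < N" "j < k" for k j
        proof -
          have "\<bar>v k - v j\<bar> \<le> (1 + \<bar>v k\<bar>) * (1 + \<bar>v j\<bar>)"
            using abs_triangle_ineq4[of "v k" "v j"] by (simp add: algebra_simps) (smt (verit) mult_nonneg_nonneg abs_ge_zero)
          also have "\<dots> = (\<Prod>l\<in>{k,j}. 1 + \<bar>v l\<bar>)" using that by simp
          also have "\<dots> \<le> P" unfolding P_def using that by (intro prod_mono2) auto
          finally show ?thesis .
        qed
        have "(\<Prod>k<N. \<Prod>j<k. \<bar>v k - v j\<bar> powr (2 * \<kappa>)) \<le> (\<Prod>k<N. \<Prod>j<k. P powr (2 * \<kappa>))"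
          using le \<kappa> by (intro prod_mono conjI prod_nonneg powr_mono2) auto
        also have "\<dots> = (\<Prod>k<N. P powr (2 * \<kappa> * real k))"
          using P by (simp add: powr_power mult.commute)
        also have "\<dots> = P powr p"
          using P unfolding p_def m_def sum_distrib_left by (subst powr_sum) auto
        also have "\<dots> = (\<Prod>l<N. (1 + \<bar>v l\<bar>) powr p)"
          unfolding P_def by (subst prod_powr_distrib) auto
        finally have "gbe_weight g \<kappa> N v \<le> (\<Prod>l<N. exp (- (c * (v l)\<^sup>2))) * (\<Prod>l<N. (1 + \<bar>v l\<bar>) powr p)"
          unfolding gbe_weight_def c_def by (intro mult_mono prod_nonneg) (auto simp: mult_ac)
        also have "\<dots> = (\<Prod>l<N. exp (- (c * (v l)\<^sup>2)) * (1 + \<bar>v l\<bar>) powr p)" by (simp add: prod.distrib)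
        finally show "norm (gbe_weight g \<kappa> N v) \<le> norm (\<Prod>l<N. exp (- (c * (v l)\<^sup>2)) * (1 + \<bar>v l\<bar>) powr p)"
          using gbe_weight_nonneg[of g \<kappa> N v] by simp
      qed
    qed measurable
  qed
qed

lemma gbe_partition_pos:
  assumes g: "g > 0" and \<kappa>: "\<kappa> > 0"
  shows "gbe_partition g \<kappa> N > 0"
proof -
  interpret product_sigma_finite "\<lambda>_. lborel :: real measure" by standard
  let ?M = "lborel_pow N"
  have "gbe_partition g \<kappa> N \<noteq> 0"
  proof
    assume "gbe_partition g \<kappa> N = 0"
    then have AE0: "AE v in ?M. gbe_weight g \<kappa> N v = 0"
      unfolding gbe_partition_def
      by (subst (asm) integral_nonneg_eq_0_iff_AE[OF integrable_gbe_weight[OF g \<kappa>]]) (auto simp: gbe_weight_nonneg)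
    \<comment> \<open>The sides are disjoint intervals, so the coordinates of a point of
      \<open>?B\<close> are distinct and its weight is positive, while \<open>?B\<close> has
      positive volume.\<close>
    let ?B = "Pi\<^sub>E {..<N} (\<lambda>l. {real l .. real l + 1/2})"
    have "emeasure ?M ?B = (\<Prod>l<N. emeasure lborel {real l .. real l + 1/2})"
      by (intro emeasure_PiM) auto
    also have "\<dots> \<noteq> 0" by (simp add: prod_zero_iff ennreal_eq_0_iff)
    finally have "emeasure ?M ?B \<noteq> 0" .
    moreover have "AE v in ?M. v \<notin> ?B"
      using AE0
    proof eventually_elim
      case (elim v)
      have "gbe_weight g \<kappa> N v > 0" if "v \<in> ?B"
      proof -
        have "v k - v j \<noteq> 0" if jk: "k < N" "j < k" for k j
        proof -
          have "v k \<ge> real k" "v j \<le> real j + 1/2" using \<open>v \<in> ?B\<close> jk by (auto simp: PiE_iff Ball_def)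
          then show ?thesis using jk by linarith
        qed
        then show ?thesis unfolding gbe_weight_def by (intro mult_pos_pos prod_pos) (auto simp: less_le)
      qed
      then show ?case using elim by auto
    qed
    then have "emeasure ?M ?B = 0"
      by (subst (asm) AE_iff_measurable[where N = ?B]) (auto intro!: sets_PiM_I_finite simp: space_PiM)
    ultimately show False by simp
  qed
  moreover have "gbe_partition g \<kappa> N \<ge> 0"
    unfolding gbe_partition_def by (intro integral_nonneg_AE) (auto simp: gbe_weight_nonneg)
  ultimately show ?thesis by simp
qed

lemma gbe_law_sets [simp, measurable_cong]: "sets (gbe_law g \<kappa> N) = sets (lborel_pow N)"
  by (simp add: gbe_law_def)

lemma prob_space_gbe_law:
  assumes g: "g > 0" and \<kappa>: "\<kappa> > 0"
  shows "prob_space (gbe_law g \<kappa> N)"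
proof (rule prob_spaceI)
  let ?M = "lborel_pow N"
  have Z: "gbe_partition g \<kappa> N > 0" by (rule gbe_partition_pos[OF g \<kappa>])
  have int: "integrable ?M (\<lambda>v. gbe_weight g \<kappa> N v / gbe_partition g \<kappa> N)"
    using integrable_gbe_weight[OF g \<kappa>] by simp
  have "emeasure (gbe_law g \<kappa> N) (space (gbe_law g \<kappa> N)) =
     (\<integral>\<^sup>+v. ennreal (gbe_weight g \<kappa> N v / gbe_partition g \<kappa> N) * indicator (space ?M) v \<partial>?M)"
    unfolding gbe_law_def by (subst emeasure_density) auto
  also have "\<dots> = (\<integral>\<^sup>+v. ennreal (gbe_weight g \<kappa> N v / gbe_partition g \<kappa> N) \<partial>?M)"
    by (intro nn_integral_cong) simp
  also have "\<dots> = ennreal (\<integral>v. gbe_weight g \<kappa> N v / gbe_partition g \<kappa> N \<partial>?M)"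
    using Z by (intro nn_integral_eq_integral int) (auto simp: gbe_weight_nonneg)
  also have "\<dots> = 1" using Z by (simp add: gbe_partition_def)
  finally show "emeasure (gbe_law g \<kappa> N) (space (gbe_law g \<kappa> N)) = 1" .
qed

lemma integral_gbe_law:
  fixes F :: "(nat \<Rightarrow> real) \<Rightarrow> complex"
  assumes g: "g > 0" and \<kappa>: "\<kappa> > 0" and [measurable]: "F \<in> borel_measurable (lborel_pow N)"
  shows "(\<integral>v. F v \<partial>gbe_law g \<kappa> N) =
    (\<integral>v. gbe_weight g \<kappa> N v *\<^sub>R F v \<partial>(lborel_pow N)) / complex_of_real (gbe_partition g \<kappa> N)"
proof -
  have Z: "gbe_partition g \<kappa> N > 0" by (rule gbe_partition_pos[OF g \<kappa>])
  have "(\<integral>v. F v \<partial>gbe_law g \<kappa> N) = (\<integral>v. (gbe_weight g \<kappa> N v / gbe_partition g \<kappa> N) *\<^sub>R F v \<partial>(lborel_pow N))"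
    unfolding gbe_law_def using Z gbe_weight_nonneg by (subst integral_density) auto
  also have "\<dots> = (\<integral>v. (gbe_weight g \<kappa> N v *\<^sub>R F v) / complex_of_real (gbe_partition g \<kappa> N) \<partial>(lborel_pow N))"
    by (simp add: scaleR_conv_of_real)
  finally show ?thesis by simp
qed

section \<open>Loop equations\<close>

lemma udiff_linear:
  assumes "bounded (range a)"
  shows "udiff (\<lambda>t v. complex_of_real t * a v) (\<lambda>v. 0) a"
  unfolding udiff_def
proof (intro conjI assms)
  show "uniform_limit UNIV (\<lambda>t v. (complex_of_real t * a v - 0) / complex_of_real t) a (at_right 0)"
  proof (rule uniform_limit_cong[THEN iffD2, rotated 2])
    show "uniform_limit UNIV (\<lambda>t. a) a (at_right (0::real))" by (rule uniform_limit_const)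
    show "\<forall>\<^sub>F t in at_right 0. \<forall>v\<in>UNIV. (complex_of_real t * a v - 0) / complex_of_real t = a v"
      using eventually_at_right_pos by eventually_elim simp
  qed simp
qed (simp add: image_def)

lemma bounded_range_of_real:
  assumes "\<And>v. \<bar>a v\<bar> \<le> K"
  shows "bounded (range (\<lambda>v. complex_of_real (a v)))"
  using assms unfolding bounded_iff by auto

text \<open>With the divided difference \<open>q\<close> of \<open>f\<close>, a displaced
  Vandermonde factor is the original one times \<open>1 + t * q\<close>. Its zeros stay inside
  \<open>gbe_weight\<close>, and the quotient is controlled uniformly as soon as \<open>q\<close> is
  bounded, also where eigenvalues coincide.\<close>

lemma gbe_weight_shift:
  assumes q: "\<And>a b. f a - f b = q a b * (a - b)"
  shows "gbe_weight g \<kappa> N (shift N f t v) = gbe_weight g \<kappa> N v *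
    ((\<Prod>l<N. exp (- (real N * \<kappa> / (2 * g) * (2 * t * (v l * f (v l)) + t\<^sup>2 * (f (v l))\<^sup>2)))) *
     (\<Prod>k<N. \<Prod>j<k. \<bar>1 + t * q (v k) (v j)\<bar> powr (2 * \<kappa>)))"
proof -
  have "(\<Prod>l<N. exp (- (real N * \<kappa> * (shift N f t v l)\<^sup>2 / (2 * g)))) =
    (\<Prod>l<N. exp (- (real N * \<kappa> * (v l)\<^sup>2 / (2 * g))) * exp (- (real N * \<kappa> / (2 * g) * (2 * t * (v l * f (v l)) + t\<^sup>2 * (f (v l))\<^sup>2))))"
    by (intro prod.cong refl) (simp add: shift_def power2_eq_square algebra_simps add_divide_distrib flip: exp_add)
  moreover have "(\<Prod>k<N. \<Prod>j<k. \<bar>shift N f t v k - shift N f t v j\<bar> powr (2 * \<kappa>)) =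
    (\<Prod>k<N. \<Prod>j<k. \<bar>v k - v j\<bar> powr (2 * \<kappa>) * \<bar>1 + t * q (v k) (v j)\<bar> powr (2 * \<kappa>))"
  proof (intro prod.cong refl)
    fix k j assume "k \<in> {..<N}" "j \<in> {..<k}"
    then have "shift N f t v k - shift N f t v j = (v k - v j) + t * (f (v k) - f (v j))"
      by (simp add: shift_def algebra_simps)
    also have "\<dots> = (v k - v j) * (1 + t * q (v k) (v j))"
      unfolding q by (simp add: algebra_simps)
    finally show "\<bar>shift N f t v k - shift N f t v j\<bar> powr (2 * \<kappa>) =
        \<bar>v k - v j\<bar> powr (2 * \<kappa>) * \<bar>1 + t * q (v k) (v j)\<bar> powr (2 * \<kappa>)"
      by (simp add: abs_mult powr_mult)
  qed
  ultimately show ?thesis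
    unfolding gbe_weight_def by (simp add: prod.distrib mult_ac)
qed

lemma abs_one_plus_powr_deriv: "((\<lambda>s. \<bar>1 + s\<bar> powr p) has_real_derivative p) (at 0)"
proof (rule has_field_derivative_transform_within_open[where S = "{-1<..<1}"])
  show "((\<lambda>s. (1 + s) powr p) has_real_derivative p) (at 0)"
    by (auto intro!: derivative_eq_intros)
qed auto

text \<open>After the change of variables, \<open>G\<close> and \<open>S t\<close> have the same
  integral against the weight for all small \<open>t\<close>. Hence the difference quotient of
  \<open>S\<close> integrates to 0, and so does its uniform limit \<open>L * G + D\<close>. The
  three parts of \<open>L\<close> come from the Jacobian, the Gaussian factor and the Vandermonde
  factor.\<close>

lemma loop_equation_real:
  fixes f f' :: "real \<Rightarrow> real" and q :: "real \<Rightarrow> real \<Rightarrow> real"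
  assumes g: "g > 0" and \<kappa>: "\<kappa> > 0"
    and der: "\<And>u. (f has_real_derivative f' u) (at u)"
    and f'm: "f' \<in> borel_measurable borel"
    and K: "\<And>u. \<bar>f u\<bar> \<le> K" "\<And>u. \<bar>f' u\<bar> \<le> K" "\<And>u. \<bar>u * f u\<bar> \<le> K" "\<And>a b. \<bar>q a b\<bar> \<le> K"
    and q: "\<And>a b. f a - f b = q a b * (a - b)"
    and G: "ddir N f G D"
    and L: "\<And>v. L v = (\<Sum>l<N. f' (v l)) - real N * \<kappa> / g * (\<Sum>l<N. v l * f (v l)) + 2 * \<kappa> * (\<Sum>k<N. \<Sum>j<k. q (v k) (v j))"
    and Lm: "L \<in> borel_measurable (lborel_pow N)"
  shows "(\<integral>v. complex_of_real (L v) * G v + D v \<partial>gbe_law g \<kappa> N) = 0"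
proof -
  let ?M = "lborel_pow N"
  let ?w = "gbe_weight g \<kappa> N"
  define c where "c = real N * \<kappa> / (2 * g)"
  define E where "E t v = (\<Prod>l<N. exp (- (c * (2 * t * (v l * f (v l)) + t\<^sup>2 * (f (v l))\<^sup>2))))" for t and v :: "nat \<Rightarrow> real"
  define Q where "Q t v = (\<Prod>k<N. \<Prod>j<k. \<bar>1 + t * q (v k) (v j)\<bar> powr (2 * \<kappa>))" for t and v :: "nat \<Rightarrow> real"
  define J where "J t v = (\<Prod>j<N. 1 + t * f' (v j))" for t and v :: "nat \<Rightarrow> real"
  define S where "S t v = complex_of_real (E t v) * complex_of_real (Q t v) * complex_of_real (J t v) * G (shift N f t v)" for t v
  have Gm [measurable]: "G \<in> borel_measurable ?M" and Dm [measurable]: "D \<in> borel_measurable ?M"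
    and uG: "udiff (\<lambda>t v. G (shift N f t v)) G D"
    using G by (auto simp: ddir_def)
  note [measurable] = Lm
  have uE: "udiff (\<lambda>t v. complex_of_real (E t v)) (\<lambda>v. 1) (\<lambda>v. \<Sum>l<N. complex_of_real (1 * (- 2 * c * (v l * f (v l)))))"
    unfolding E_def of_real_prod
  proof (intro udiff_prod_one udiff_compose[where \<psi> = exp])
    fix l
    have b1: "bounded (range (\<lambda>v::nat\<Rightarrow>real. complex_of_real (- 2 * c * (v l * f (v l)))))"
      using K(3) by (intro bounded_range_of_real[where K = "2 * \<bar>c\<bar> * K"]) (simp add: abs_mult mult_left_mono)
    have b2: "bounded (range (\<lambda>v::nat\<Rightarrow>real. complex_of_real (- c * (f (v l))\<^sup>2)))"
    proof (rule bounded_range_of_real[where K = "\<bar>c\<bar> * K\<^sup>2"])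
      fix v :: "nat \<Rightarrow> real"
      have "(f (v l))\<^sup>2 \<le> K\<^sup>2" using K(1)[of "v l"] by (metis abs_ge_zero power2_abs power_mono)
      then show "\<bar>- c * (f (v l))\<^sup>2\<bar> \<le> \<bar>c\<bar> * K\<^sup>2" by (simp add: abs_mult mult_left_mono)
    qed
    \<comment> \<open>The term quadratic in \<open>t\<close> is written as a product of two linear
      ones, so that \<open>udiff_mult\<close> shows its derivative at 0 to vanish.\<close>
    have "udiff (\<lambda>t v. complex_of_real t * complex_of_real (- 2 * c * (v l * f (v l))) +
         complex_of_real t * 1 * (complex_of_real t * complex_of_real (- c * (f (v l))\<^sup>2)))
       (\<lambda>v. 0 + 0 * 0) (\<lambda>v. complex_of_real (- 2 * c * (v l * f (v l))) + (1 * 0 + 0 * complex_of_real (- c * (f (v l))\<^sup>2)))"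
      by (intro udiff_add udiff_mult udiff_linear b1 b2) (simp add: image_def)
    then show "udiff (\<lambda>t v. complex_of_real (- (c * (2 * t * (v l * f (v l)) + t\<^sup>2 * (f (v l))\<^sup>2)))) (\<lambda>v. 0)
        (\<lambda>v. complex_of_real (- 2 * c * (v l * f (v l))))"
      by (simp add: algebra_simps power2_eq_square)
    show "(exp has_real_derivative 1) (at 0)" by (auto intro!: derivative_eq_intros)
  qed auto
  have uQ: "udiff (\<lambda>t v. complex_of_real (Q t v)) (\<lambda>v. 1) (\<lambda>v. \<Sum>k<N. \<Sum>j<k. complex_of_real (2 * \<kappa> * q (v k) (v j)))"
    unfolding Q_def of_real_prod
  proof (intro udiff_prod_one udiff_compose[where \<psi> = "\<lambda>s. \<bar>1 + s\<bar> powr (2 * \<kappa>)"] abs_one_plus_powr_deriv)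
    fix k j
    have "udiff (\<lambda>t v. complex_of_real t * complex_of_real (q (v k) (v j))) (\<lambda>v. 0) (\<lambda>v. complex_of_real (q (v k) (v j)))"
      using K(4) by (intro udiff_linear bounded_range_of_real)
    then show "udiff (\<lambda>t v. complex_of_real (t * q (v k) (v j))) (\<lambda>v. 0) (\<lambda>v. complex_of_real (q (v k) (v j)))"
      by simp
  qed auto
  have uJ: "udiff (\<lambda>t v. complex_of_real (J t v)) (\<lambda>v. 1) (\<lambda>v. \<Sum>l<N. complex_of_real (f' (v l)))"
    unfolding J_def of_real_prod
  proof (intro udiff_prod_one)
    fix l
    have "udiff (\<lambda>t v. 1 + complex_of_real t * complex_of_real (f' (v l))) (\<lambda>v. 1 + 0) (\<lambda>v. 0 + complex_of_real (f' (v l)))"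
      using K(2) by (intro udiff_add udiff_const udiff_linear bounded_range_of_real)
    then show "udiff (\<lambda>t v. complex_of_real (1 + t * f' (v l))) (\<lambda>v. 1) (\<lambda>v. complex_of_real (f' (v l)))"
      by simp
  qed auto
  have uS: "udiff S G (\<lambda>v. complex_of_real (L v) * G v + D v)"
  proof -
    have c2: "real N * \<kappa> / g = 2 * c" using g by (simp add: c_def)
    have "(\<lambda>v. (((\<Sum>l<N. complex_of_real (1 * (- 2 * c * (v l * f (v l))))) * 1 + 1 * (\<Sum>k<N. \<Sum>j<k. complex_of_real (2 * \<kappa> * q (v k) (v j)))) * 1
           + 1 * 1 * (\<Sum>l<N. complex_of_real (f' (v l)))) * G v + 1 * 1 * 1 * D v) = (\<lambda>v. complex_of_real (L v) * G v + D v)"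
      unfolding L c2
      by (simp add: sum_distrib_left sum_negf algebra_simps)
    then show ?thesis
      using udiff_mult[OF udiff_mult[OF udiff_mult[OF uE uQ] uJ] uG] by (simp add: S_def[abs_def])
  qed
  obtain BG where BG: "\<And>v. norm (G v) \<le> BG"
    using uG unfolding udiff_def bounded_iff by auto
  obtain BL where BL: "\<And>v. norm (complex_of_real (L v) * G v + D v) \<le> BL"
    using uS unfolding udiff_def bounded_iff by auto
  have wint: "integrable ?M ?w" by (rule integrable_gbe_weight[OF g \<kappa>])
  have wF: "integrable ?M (\<lambda>v. ?w v *\<^sub>R F v)"
    if [measurable]: "F \<in> borel_measurable ?M" and "\<And>v. norm (F v) \<le> B" for F :: "(nat \<Rightarrow> real) \<Rightarrow> complex" and B
  proof (rule Bochner_Integration.integrable_bound)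
    show "integrable ?M (\<lambda>v. B * ?w v)" using wint by simp
    show "AE v in ?M. norm (?w v *\<^sub>R F v) \<le> norm (B * ?w v)"
    proof (rule AE_I2)
      fix v
      have "norm (?w v *\<^sub>R F v) = norm (F v) * ?w v" by (simp add: gbe_weight_nonneg)
      also have "\<dots> \<le> B * ?w v" using that(2) by (intro mult_right_mono gbe_weight_nonneg)
      finally show "norm (?w v *\<^sub>R F v) \<le> norm (B * ?w v)" using abs_ge_self[of "B * ?w v"] by simp
    qed
  qed measurable
  have wG: "integrable ?M (\<lambda>v. ?w v *\<^sub>R G v)" by (rule wF[OF _ BG]) measurable
  have wL: "integrable ?M (\<lambda>v. ?w v *\<^sub>R (complex_of_real (L v) * G v + D v))" by (rule wF[OF _ BL]) measurable
  have wS: "integrable ?M (\<lambda>v. ?w v *\<^sub>R S t v)" "(\<integral>v. ?w v *\<^sub>R S t v \<partial>?M) = (\<integral>v. ?w v *\<^sub>R G v \<partial>?M)"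
    if t: "0 < t" "t * K < 1" for t
  proof -
    have eq: "(\<Prod>j<N. 1 + t * f' (v j)) *\<^sub>R (?w (shift N f t v) *\<^sub>R G (shift N f t v)) = ?w v *\<^sub>R S t v" for v
      unfolding gbe_weight_shift[of f q, OF q] S_def E_def Q_def J_def c_def by (simp add: scaleR_conv_of_real mult_ac)
    show "integrable ?M (\<lambda>v. ?w v *\<^sub>R S t v)" "(\<integral>v. ?w v *\<^sub>R S t v \<partial>?M) = (\<integral>v. ?w v *\<^sub>R G v \<partial>?M)"
      using integral_PiM_shift[OF der f'm K(1,2) t wG] unfolding eq by blast+
  qed
  have W: "(\<integral>v. ?w v \<partial>?M) > 0" using gbe_partition_pos[OF g \<kappa>, of N] by (simp add: gbe_partition_def)
  let ?I = "\<integral>v. ?w v *\<^sub>R (complex_of_real (L v) * G v + D v) \<partial>?M"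
  have small: "norm ?I \<le> e * (\<integral>v. ?w v \<partial>?M)" if e: "e > 0" for e
  proof -
    have K0: "K \<ge> 0" using K(1)[of 0] by linarith
    have "\<forall>\<^sub>F t in at_right 0. \<forall>v\<in>UNIV. dist ((S t v - G v) / complex_of_real t) (complex_of_real (L v) * G v + D v) < e"
      using uS e unfolding udiff_def by (blast dest: uniform_limitD)
    \<comment> \<open>\<open>K + 1\<close> instead of \<open>K\<close>, because \<open>K\<close> may
      be 0; this range of \<open>t\<close> still gives \<open>t * K < 1\<close>.\<close>
    moreover have "\<forall>\<^sub>F t in at_right 0. t \<in> {0<..<1 / (K + 1)}"
      using K0 by (intro eventually_at_right_real) simp
    ultimately have "\<forall>\<^sub>F t in at_right 0. (\<forall>v\<in>UNIV. dist ((S t v - G v) / complex_of_real t) (complex_of_real (L v) * G v + D v) < e)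
        \<and> t \<in> {0<..<1 / (K + 1)}"
      by (rule eventually_conj)
    then obtain t where t: "\<And>v. dist ((S t v - G v) / complex_of_real t) (complex_of_real (L v) * G v + D v) < e"
      "0 < t" "t < 1 / (K + 1)"
      using eventually_happens[of _ "at_right (0::real)"] by (auto simp: trivial_limit_at_right_real)
    have "t * (K + 1) < 1" using t(3) K0 by (simp add: pos_less_divide_eq)
    then have tK: "t * K < 1" using t(2) by (simp add: algebra_simps)
    define H where "H = (\<lambda>v. ?w v *\<^sub>R (complex_of_real (L v) * G v + D v) - (?w v *\<^sub>R S t v - ?w v *\<^sub>R G v) / complex_of_real t)"
    have d: "integrable ?M (\<lambda>v. (?w v *\<^sub>R S t v - ?w v *\<^sub>R G v) / complex_of_real t)"
      using wS(1)[OF t(2) tK] wG by simp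
    have "(\<integral>v. (?w v *\<^sub>R S t v - ?w v *\<^sub>R G v) / complex_of_real t \<partial>?M) = 0"
      using wS[OF t(2) tK] wG by simp
    then have I: "?I = (\<integral>v. H v \<partial>?M)"
      unfolding H_def using wL d by (subst Bochner_Integration.integral_diff) auto
    have Hint: "integrable ?M H"
      unfolding H_def by (rule Bochner_Integration.integrable_diff[OF wL d])
    have "norm ?I \<le> (\<integral>v. norm (H v) \<partial>?M)"
      unfolding I by (rule integral_norm_bound)
    also have "\<dots> \<le> (\<integral>v. e * ?w v \<partial>?M)"
    proof (rule integral_mono)
      show "integrable ?M (\<lambda>v. norm (H v))" using Hint by (rule integrable_norm)
      show "integrable ?M (\<lambda>v. e * ?w v)" using wint by simp
    next
      fix v
      have "H v = ?w v *\<^sub>R ((complex_of_real (L v) * G v + D v) - (S t v - G v) / complex_of_real t)"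
        unfolding H_def by (simp add: scaleR_conv_of_real algebra_simps diff_divide_distrib)
      then have "norm (H v) = ?w v * dist ((S t v - G v) / complex_of_real t) (complex_of_real (L v) * G v + D v)"
        by (simp add: gbe_weight_nonneg dist_norm norm_minus_commute)
      also have "\<dots> \<le> ?w v * e" using t(1) by (intro mult_left_mono gbe_weight_nonneg less_imp_le)
      finally show "norm (H v) \<le> e * ?w v"
        by (simp add: mult.commute)
    qed
    finally show ?thesis by simp
  qed
  have "?I = 0"
  proof (rule ccontr)
    assume "?I \<noteq> 0"
    then have n: "norm ?I > 0" by simp
    have "norm ?I \<le> norm ?I / (2 * (\<integral>v. ?w v \<partial>?M)) * (\<integral>v. ?w v \<partial>?M)"
      using n W by (intro small) simp
    also have "\<dots> = norm ?I / 2" using W by simp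
    finally show False using n by linarith
  qed
  then show ?thesis
    by (subst integral_gbe_law[OF g \<kappa>]) (auto simp: scaleR_conv_of_real)
qed

lemma norm_inverse_diff_real_le:
  assumes "Im x \<noteq> 0"
  shows "norm (1 / (x - complex_of_real u)) \<le> 1 / \<bar>Im x\<bar>"
proof -
  have "\<bar>Im x\<bar> \<le> norm (x - complex_of_real u)" using abs_Im_le_cmod[of "x - complex_of_real u"] by simp
  then show ?thesis using assms by (simp add: norm_divide frac_le)
qed

text \<open>Replaces the pairs of the Vandermonde factor by a full square, which factorises into
  products of power sums, minus a diagonal, which is a single power sum.\<close>

lemma sum_symmetric_triangle:
  fixes s :: "nat \<Rightarrow> nat \<Rightarrow> complex"
  assumes "\<And>k j. s k j = s j k"
  shows "2 * (\<Sum>k<N. \<Sum>j<k. s k j) = (\<Sum>k<N. \<Sum>j<N. s k j) - (\<Sum>k<N. s k k)"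
proof (induction N)
  case (Suc N)
  have "(\<Sum>k<Suc N. \<Sum>j<Suc N. s k j) = (\<Sum>k<N. \<Sum>j<N. s k j) + (\<Sum>k<N. s k N) + (\<Sum>j<N. s N j) + s N N"
    by (simp add: sum.distrib)
  moreover have "(\<Sum>k<N. s k N) = (\<Sum>j<N. s N j)" using assms by (intro sum.cong) auto
  ultimately show ?case using Suc by (simp add: algebra_simps)
qed simp

lemma pstat_0 [simp]: "pstat N z 0 v = of_nat N"
  by (simp add: pstat_def)

lemma component_measurable:
  assumes "l < N"
  shows "(\<lambda>v. v l) \<in> borel_measurable (lborel_pow N)"
  using measurable_component_singleton[of l "{..<N}" "\<lambda>_. lborel :: real measure"] assms by simp

lemma pstat_measurable [measurable]: "pstat N z k \<in> borel_measurable (lborel_pow N)"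
  unfolding pstat_def[abs_def]
proof (rule borel_measurable_sum)
  fix j assume "j \<in> {..<N}"
  then have [measurable]: "(\<lambda>v. v j) \<in> borel_measurable (lborel_pow N)"
    by (intro component_measurable) simp
  show "(\<lambda>v. (1 / (z - complex_of_real (v j))) ^ k) \<in> borel_measurable (lborel_pow N)"
    by measurable
qed

lemma norm_pstat_le:
  assumes "Im z \<noteq> 0"
  shows "norm (pstat N z k v) \<le> real N * (1 / \<bar>Im z\<bar>) ^ k"
proof -
  have "norm (pstat N z k v) \<le> (\<Sum>j<N. (1 / \<bar>Im z\<bar>) ^ k)"
    unfolding pstat_def
    by (intro order_trans[OF norm_sum] sum_mono) (simp only: norm_power power_mono norm_ge_zero norm_inverse_diff_real_le[OF assms])
  then show ?thesis by simp
qed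

lemma ddir_bounded: "ddir N f G D \<Longrightarrow> bounded (range G) \<and> bounded (range D)"
  by (simp add: ddir_def udiff_def)

lemma integrable_gbe_law:
  fixes F :: "(nat \<Rightarrow> real) \<Rightarrow> 'b :: {banach, second_countable_topology}"
  assumes "g > 0" "\<kappa> > 0" and [measurable]: "F \<in> borel_measurable (lborel_pow N)" and "bounded (range F)"
  shows "integrable (gbe_law g \<kappa> N) F"
proof -
  interpret prob_space "gbe_law g \<kappa> N" using assms by (intro prob_space_gbe_law)
  obtain B where "\<And>v. norm (F v) \<le> B" using assms(4) unfolding bounded_iff by auto
  then show ?thesis by (intro integrable_const_bound[where B = B]) auto
qed

text \<open>Real eigenvalues can only be moved in real directions, so
  \<open>loop_equation_real\<close> is applied to the real and the imaginary part of the power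
  \<open>a\<close> of the resolvent, and the results are recombined. The auxiliary facts
  \<open>qf\<close> and \<open>uf\<close> express the divided difference and \<open>u * f u\<close>
  by the same resolvent, which closes the system.\<close>

lemma loop_equation:
  assumes g: "g > 0" and \<kappa>: "\<kappa> > 0" and x: "Im x \<noteq> 0" and a: "a > 0"
    and G: "vderiv N (\<lambda>u. (1 / (x - complex_of_real u)) ^ a) G D"
  shows "(\<integral>v. (of_real \<kappa> * ((\<Sum>i<a. pstat N x (i + 1) v * pstat N x (a - i) v) - of_nat a * pstat N x (a + 1) v)
     + of_nat a * pstat N x (a + 1) v
     - of_real (real N * \<kappa> / g) * (x * pstat N x a v - pstat N x (a - 1) v)) * G v + D v \<partial>gbe_law g \<kappa> N) = 0"
proof -
  let ?M = "lborel_pow N"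
  let ?R = "\<lambda>u::real. 1 / (x - complex_of_real u)"
  define f where "f u = ?R u ^ a" for u
  define f' where "f' u = of_nat a * ?R u ^ (a + 1)" for u
  define q where "q p r = (\<Sum>i<a. ?R p ^ (i + 1) * ?R r ^ (a - i))" for p r
  define B where "B = 1 / \<bar>Im x\<bar>"
  have B0: "B \<ge> 0" by (simp add: B_def)
  have B: "norm (?R u) \<le> B" for u unfolding B_def by (rule norm_inverse_diff_real_le[OF x])
  have nz: "x - complex_of_real u \<noteq> 0" for u using x by auto
  have fd: "(f has_vector_derivative f' u) (at u)" for u
  proof -
    have "((\<lambda>w. (1 / (x - w)) ^ a) has_field_derivative (of_nat a * (1 / (x - of_real u)) ^ (a + 1))) (at (of_real u))"
    proof -
      have "((\<lambda>w. 1 / (x - w)) has_field_derivative (1 / (x - of_real u))\<^sup>2) (at (of_real u))"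
        using nz[of u] by (auto intro!: derivative_eq_intros simp: power2_eq_square)
      from DERIV_power[OF this, of a] show ?thesis
        using a by (cases a) (simp_all add: power2_eq_square mult_ac)
    qed
    then show ?thesis unfolding f_def[abs_def] f'_def by (rule has_vector_derivative_real_field)
  qed
  have qf: "f p - f r = q p r * of_real (p - r)" for p r
  proof -
    have "f p - f r = (?R p - ?R r) * (\<Sum>i<a. ?R r ^ (a - Suc i) * ?R p ^ i)"
      unfolding f_def by (rule power_diff_sumr2)
    also have "?R p - ?R r = of_real (p - r) * (?R p * ?R r)"
      using nz[of p] nz[of r] by (simp add: field_simps)
    also have "of_real (p - r) * (?R p * ?R r) * (\<Sum>i<a. ?R r ^ (a - Suc i) * ?R p ^ i) = q p r * of_real (p - r)"
    proof -
      have "?R p * ?R r * (\<Sum>i<a. ?R r ^ (a - Suc i) * ?R p ^ i) = q p r"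
        unfolding q_def sum_distrib_left
      proof (intro sum.cong refl)
        fix i assume "i \<in> {..<a}"
        then have e: "a - i = Suc (a - Suc i)" by auto
        have "P * R * (R ^ (a - Suc i) * P ^ i) = P ^ (i + 1) * R ^ (a - i)" for P R :: complex
          unfolding e by simp
        then show "?R p * ?R r * (?R r ^ (a - Suc i) * ?R p ^ i) = ?R p ^ (i + 1) * ?R r ^ (a - i)" .
      qed
      from arg_cong[OF this, of "\<lambda>z. z * of_real (p - r)"] show ?thesis by (simp only: mult_ac)
    qed
    finally show ?thesis .
  qed
  have uf: "of_real u * f u = x * ?R u ^ a - ?R u ^ (a - 1)" for u
  proof -
    obtain b where b: "a = Suc b" using a by (cases a) auto
    have "of_real u * ?R u = x * ?R u - 1" using nz[of u] by (simp add: field_simps)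
    from arg_cong[OF this, of "\<lambda>z. z * ?R u ^ b"] show ?thesis
      unfolding f_def b by (simp only: diff_Suc_1 power_Suc left_diff_distrib mult_1_left mult.assoc)
  qed
  \<comment> \<open>Sum of the bounds for \<open>f\<close>, for its derivative and for
    \<open>u * f u\<close>. The middle summand also bounds \<open>q\<close>, which has
    \<open>a\<close> terms of total degree \<open>a + 1\<close>.\<close>
  define K where "K = B ^ a + real a * B ^ (a + 1) + (norm x * B ^ a + B ^ (a - 1))"
  have Rp: "norm (?R u ^ n) \<le> B ^ n" for u n unfolding norm_power by (intro power_mono B norm_ge_zero)
  have Kp: "B ^ n \<ge> 0" for n using B0 by simp
  have Ks: "B ^ a \<le> K" "real a * B ^ (a + 1) \<le> K" "norm x * B ^ a + B ^ (a - 1) \<le> K"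
    using Kp[of a] Kp[of "a + 1"] Kp[of "a - 1"] norm_ge_zero[of x] mult_nonneg_nonneg[OF norm_ge_zero[of x] Kp[of a]]
      mult_nonneg_nonneg[OF of_nat_0_le_iff[of a] Kp[of "a + 1"]] unfolding K_def by linarith+
  have Kf: "norm (f u) \<le> K" for u using Rp[of u a] Ks unfolding f_def by linarith
  have Kf': "norm (f' u) \<le> K" for u
  proof -
    have "norm (f' u) \<le> real a * B ^ (a + 1)"
      unfolding f'_def norm_mult using Rp[of u "a + 1"] by (simp add: mult_left_mono del: power_Suc)
    then show ?thesis using Ks by linarith
  qed
  have Kuf: "norm (of_real u * f u) \<le> K" for u
  proof -
    have "norm (of_real u * f u) \<le> norm x * B ^ a + B ^ (a - 1)"
      unfolding uf by (intro order_trans[OF norm_triangle_ineq4] add_mono Rp) (simp only: norm_mult mult_left_mono Rp norm_ge_zero)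
    then show ?thesis using Ks by linarith
  qed
  have Kq: "norm (q p r) \<le> K" for p r
  proof -
    have "norm (q p r) \<le> (\<Sum>i<a. B ^ (i + 1) * B ^ (a - i))"
      unfolding q_def by (intro order_trans[OF norm_sum] sum_mono) (simp only: norm_mult mult_mono Rp norm_ge_zero Kp)
    also have "\<dots> = (\<Sum>i<a. B ^ (a + 1))" by (intro sum.cong refl) (simp flip: power_add)
    finally show ?thesis using Ks by simp
  qed
  have fm [measurable]: "f \<in> borel_measurable borel" "f' \<in> borel_measurable borel"
    unfolding f_def[abs_def] f'_def[abs_def] by measurable
  have qm [measurable]: "(\<lambda>v. q (v k) (v j)) \<in> borel_measurable ?M" if "k < N" "j < N" for k j
    using component_measurable[OF that(1)] component_measurable[OF that(2)]
    unfolding q_def by measurable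
  define Lc where "Lc v = (\<Sum>l<N. f' (v l)) - of_real (real N * \<kappa> / g) * (\<Sum>l<N. of_real (v l) * f (v l))
      + of_real (2 * \<kappa>) * (\<Sum>k<N. \<Sum>j<k. q (v k) (v j))" for v :: "nat \<Rightarrow> real"
  have Lcm [measurable]: "Lc \<in> borel_measurable ?M"
    unfolding Lc_def[abs_def]
    by (intro borel_measurable_add borel_measurable_diff borel_measurable_times borel_measurable_const borel_measurable_sum qm
         measurable_compose[OF component_measurable] borel_measurable_of_real fm component_measurable) auto
  obtain D1 D2 where D: "ddir N (\<lambda>u. Re (f u)) G D1" "ddir N (\<lambda>u. Im (f u)) G D2" "D = (\<lambda>v. D1 v + \<i> * D2 v)"
    using G unfolding vderiv_def f_def by blast
  have ReL: "(\<Sum>l<N. Re (f' (v l))) - real N * \<kappa> / g * (\<Sum>l<N. v l * Re (f (v l))) + 2 * \<kappa> * (\<Sum>k<N. \<Sum>j<k. Re (q (v k) (v j))) = Re (Lc v)" for v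
    by (simp add: Lc_def Re_divide_of_real flip: of_real_mult of_real_divide)
  have ImL: "(\<Sum>l<N. Im (f' (v l))) - real N * \<kappa> / g * (\<Sum>l<N. v l * Im (f (v l))) + 2 * \<kappa> * (\<Sum>k<N. \<Sum>j<k. Im (q (v k) (v j))) = Im (Lc v)" for v
    by (simp add: Lc_def Im_divide_of_real flip: of_real_mult of_real_divide)
  have 1: "(\<integral>v. complex_of_real (Re (Lc v)) * G v + D1 v \<partial>gbe_law g \<kappa> N) = 0"
  proof (rule loop_equation_real[OF g \<kappa>, where f = "\<lambda>u. Re (f u)" and f' = "\<lambda>u. Re (f' u)" and q = "\<lambda>p r. Re (q p r)" and K = K and L = "\<lambda>v. Re (Lc v)"])
    show "((\<lambda>u. Re (f u)) has_real_derivative Re (f' u)) (at u)" for u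
      using bounded_linear.has_vector_derivative[OF bounded_linear_Re fd] by (simp add: has_real_derivative_iff_has_vector_derivative)
    show "\<bar>Re (f u)\<bar> \<le> K" "\<bar>Re (f' u)\<bar> \<le> K" for u using Kf[of u] Kf'[of u] abs_Re_le_cmod order_trans by blast+
    show "\<bar>u * Re (f u)\<bar> \<le> K" for u using order_trans[OF abs_Re_le_cmod Kuf[of u]] by simp
    show "\<bar>Re (q p r)\<bar> \<le> K" for p r using Kq[of p r] abs_Re_le_cmod order_trans by blast
    show "Re (f p) - Re (f r) = Re (q p r) * (p - r)" for p r using arg_cong[OF qf[of p r], of Re] by simp
    show "Re (Lc v) = (\<Sum>l<N. Re (f' (v l))) - real N * \<kappa> / g * (\<Sum>l<N. v l * Re (f (v l))) + 2 * \<kappa> * (\<Sum>k<N. \<Sum>j<k. Re (q (v k) (v j)))" for v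
      by (rule ReL[symmetric])
    show "ddir N (\<lambda>u. Re (f u)) G D1" by fact
  qed measurable
  have 2: "(\<integral>v. complex_of_real (Im (Lc v)) * G v + D2 v \<partial>gbe_law g \<kappa> N) = 0"
  proof (rule loop_equation_real[OF g \<kappa>, where f = "\<lambda>u. Im (f u)" and f' = "\<lambda>u. Im (f' u)" and q = "\<lambda>p r. Im (q p r)" and K = K and L = "\<lambda>v. Im (Lc v)"])
    show "((\<lambda>u. Im (f u)) has_real_derivative Im (f' u)) (at u)" for u
      using bounded_linear.has_vector_derivative[OF bounded_linear_Im fd] by (simp add: has_real_derivative_iff_has_vector_derivative)
    show "\<bar>Im (f u)\<bar> \<le> K" "\<bar>Im (f' u)\<bar> \<le> K" for u using Kf[of u] Kf'[of u] abs_Im_le_cmod order_trans by blast+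
    show "\<bar>u * Im (f u)\<bar> \<le> K" for u using order_trans[OF abs_Im_le_cmod Kuf[of u]] by simp
    show "\<bar>Im (q p r)\<bar> \<le> K" for p r using Kq[of p r] abs_Im_le_cmod order_trans by blast
    show "Im (f p) - Im (f r) = Im (q p r) * (p - r)" for p r using arg_cong[OF qf[of p r], of Im] by simp
    show "Im (Lc v) = (\<Sum>l<N. Im (f' (v l))) - real N * \<kappa> / g * (\<Sum>l<N. v l * Im (f (v l))) + 2 * \<kappa> * (\<Sum>k<N. \<Sum>j<k. Im (q (v k) (v j)))" for v
      by (rule ImL[symmetric])
    show "ddir N (\<lambda>u. Im (f u)) G D2" by fact
  qed measurable
  have Lcb: "bounded (range Lc)"
  proof -
    have "norm (Lc v) \<le> (\<Sum>l<N. K) + \<bar>real N * \<kappa> / g\<bar> * (\<Sum>l<N. K) + \<bar>2 * \<kappa>\<bar> * (\<Sum>k<N. \<Sum>j<k. K)" for v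
      unfolding Lc_def
      by (intro order_trans[OF norm_triangle_ineq] order_trans[OF norm_triangle_ineq4] add_mono
          order_trans[OF norm_sum] sum_mono Kf') (simp only: norm_mult norm_of_real,
          intro mult_left_mono abs_ge_zero order_trans[OF norm_sum] sum_mono Kq Kuf)+
    then show ?thesis unfolding bounded_iff by blast
  qed
  have bRe: "bounded (range (\<lambda>v. complex_of_real (Re (Lc v))))" "bounded (range (\<lambda>v. complex_of_real (Im (Lc v))))"
    using Lcb unfolding bounded_iff by (auto intro: order_trans[OF abs_Re_le_cmod] order_trans[OF abs_Im_le_cmod])
  have Gm [measurable]: "G \<in> borel_measurable ?M" "D1 \<in> borel_measurable ?M" "D2 \<in> borel_measurable ?M"
    using D unfolding ddir_def by auto
  have i1: "integrable (gbe_law g \<kappa> N) (\<lambda>v. complex_of_real (Re (Lc v)) * G v + D1 v)"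
  proof (rule integrable_gbe_law[OF g \<kappa>])
    show "(\<lambda>v. complex_of_real (Re (Lc v)) * G v + D1 v) \<in> borel_measurable ?M" by measurable
    show "bounded (range (\<lambda>v. complex_of_real (Re (Lc v)) * G v + D1 v))"
      using ddir_bounded[OF D(1)] by (intro bounded_plus_comp bounded_range_mult bRe) auto
  qed
  have i2: "integrable (gbe_law g \<kappa> N) (\<lambda>v. complex_of_real (Im (Lc v)) * G v + D2 v)"
  proof (rule integrable_gbe_law[OF g \<kappa>])
    show "(\<lambda>v. complex_of_real (Im (Lc v)) * G v + D2 v) \<in> borel_measurable ?M" by measurable
    show "bounded (range (\<lambda>v. complex_of_real (Im (Lc v)) * G v + D2 v))"
      using ddir_bounded[OF D(2)] by (intro bounded_plus_comp bounded_range_mult bRe) auto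
  qed
  have "(\<integral>v. Lc v * G v + D v \<partial>gbe_law g \<kappa> N) =
    (\<integral>v. (complex_of_real (Re (Lc v)) * G v + D1 v) + \<i> * (complex_of_real (Im (Lc v)) * G v + D2 v) \<partial>gbe_law g \<kappa> N)"
  proof (rule arg_cong[where f = "integral\<^sup>L _"], rule ext)
    fix v
    show "Lc v * G v + D v = (complex_of_real (Re (Lc v)) * G v + D1 v) + \<i> * (complex_of_real (Im (Lc v)) * G v + D2 v)"
    proof -
      have "Lc v * G v = (complex_of_real (Re (Lc v)) + \<i> * complex_of_real (Im (Lc v))) * G v"
        by (simp only: complex_eq[symmetric])
      then show ?thesis
        by (simp only: D(3) distrib_left distrib_right mult.assoc add_ac)
    qed
  qed
  also have "\<dots> = 0" using i1 i2 1 2 by simp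
  finally have E0: "(\<integral>v. Lc v * G v + D v \<partial>gbe_law g \<kappa> N) = 0" .
  have "Lc v = of_real \<kappa> * ((\<Sum>i<a. pstat N x (i + 1) v * pstat N x (a - i) v) - of_nat a * pstat N x (a + 1) v)
     + of_nat a * pstat N x (a + 1) v
     - of_real (real N * \<kappa> / g) * (x * pstat N x a v - pstat N x (a - 1) v)" for v
  proof -
    have qs: "q p r = q r p" for p r
    proof (cases "p = r")
      case False
      have "q p r * of_real (p - r) = q r p * of_real (p - r)"
      proof -
        have "q r p * of_real (p - r) = - (q r p * of_real (r - p))" by (simp add: algebra_simps)
        also have "\<dots> = f p - f r" unfolding qf[symmetric] by simp
        finally show ?thesis using qf[of p r] by (simp only:)
      qed
      then show ?thesis using False by simp
    qed simp
    have "of_real (2 * \<kappa>) * (\<Sum>k<N. \<Sum>j<k. q (v k) (v j)) = of_real \<kappa> * (2 * (\<Sum>k<N. \<Sum>j<k. q (v k) (v j)))"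
      by simp
    also have "2 * (\<Sum>k<N. \<Sum>j<k. q (v k) (v j)) = (\<Sum>k<N. \<Sum>j<N. q (v k) (v j)) - (\<Sum>k<N. q (v k) (v k))"
      by (rule sum_symmetric_triangle) (rule qs)
    also have "(\<Sum>k<N. \<Sum>j<N. q (v k) (v j)) = (\<Sum>i<a. pstat N x (i + 1) v * pstat N x (a - i) v)"
      unfolding q_def pstat_def sum_product
      by (simp only: sum.swap[where B = "{..<a}"])
    also have "(\<Sum>k<N. q (v k) (v k)) = of_nat a * pstat N x (a + 1) v"
    proof -
      have "q p p = of_nat a * ?R p ^ (a + 1)" for p
      proof -
        have "q p p = (\<Sum>i<a. ?R p ^ (a + 1))"
          unfolding q_def
        proof (intro sum.cong refl)
          fix i assume "i \<in> {..<a}"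
          then have "i + 1 + (a - i) = a + 1" by simp
          then show "?R p ^ (i + 1) * ?R p ^ (a - i) = ?R p ^ (a + 1)" by (simp only: power_add[symmetric])
        qed
        then show ?thesis by simp
      qed
      then show ?thesis unfolding pstat_def sum_distrib_left by (simp only:)
    qed
    finally have 1: "of_real (2 * \<kappa>) * (\<Sum>k<N. \<Sum>j<k. q (v k) (v j)) =
      of_real \<kappa> * ((\<Sum>i<a. pstat N x (i + 1) v * pstat N x (a - i) v) - of_nat a * pstat N x (a + 1) v)" .
    have 2: "(\<Sum>l<N. f' (v l)) = of_nat a * pstat N x (a + 1) v"
      unfolding f'_def pstat_def sum_distrib_left ..
    have 3: "(\<Sum>l<N. of_real (v l) * f (v l)) = x * pstat N x a v - pstat N x (a - 1) v"
      unfolding uf pstat_def sum_distrib_left sum_subtractf ..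
    show ?thesis unfolding Lc_def 1 2 3 by simp
  qed
  then show ?thesis using E0 by simp
qed

section \<open>Moments bounded uniformly in \<open>N\<close>\<close>

lemma cnj_pstat: "cnj (pstat N z k v) = pstat N (cnj z) k v"
  by (simp add: pstat_def)

definition nstat :: "nat \<Rightarrow> complex \<Rightarrow> nat \<Rightarrow> (nat \<Rightarrow> real) \<Rightarrow> complex" where
  "nstat N z k v = pstat N z k v / of_nat N"

lemma norm_nstat_le:
  assumes "Im z \<noteq> 0"
  shows "norm (nstat N z k v) \<le> (1 / \<bar>Im z\<bar>) ^ k"
proof (cases "N = 0")
  case False
  then show ?thesis
    using norm_pstat_le[OF assms, of N k v] by (simp add: nstat_def norm_divide pos_divide_le_eq mult.commute)
qed (simp add: nstat_def)

text \<open>One constant has to serve for all \<open>N\<close> at once, for the statistic and for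
  its derivative along \<open>f\<close>. Polynomials in the \<open>nstat\<close> have this
  property.\<close>

definition tame :: "(real \<Rightarrow> complex) \<Rightarrow> (nat \<Rightarrow> (nat \<Rightarrow> real) \<Rightarrow> complex) \<Rightarrow> bool" where
  "tame f X \<longleftrightarrow> (\<exists>C. \<forall>N. \<exists>D. vderiv N f (X N) D \<and> (\<forall>v. norm (X N v) \<le> C \<and> norm (D v) \<le> C))"

lemma tame_const: "tame f (\<lambda>N v. c)"
  unfolding tame_def by (rule exI[of _ "norm c"]) (auto intro!: exI[of _ "\<lambda>v. 0"] vderiv_const)

lemma tame_add:
  assumes "tame f X" "tame f Y"
  shows "tame f (\<lambda>N v. X N v + Y N v)"
proof -
  from assms obtain A B where A: "\<And>N. \<exists>D. vderiv N f (X N) D \<and> (\<forall>v. norm (X N v) \<le> A \<and> norm (D v) \<le> A)"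
    and B: "\<And>N. \<exists>D. vderiv N f (Y N) D \<and> (\<forall>v. norm (Y N v) \<le> B \<and> norm (D v) \<le> B)"
    unfolding tame_def by blast
  show ?thesis unfolding tame_def
  proof (intro exI[of _ "A + B"] allI)
    fix N
    obtain D E where D: "vderiv N f (X N) D" "\<And>v. norm (X N v) \<le> A" "\<And>v. norm (D v) \<le> A"
      and E: "vderiv N f (Y N) E" "\<And>v. norm (Y N v) \<le> B" "\<And>v. norm (E v) \<le> B"
      using A[of N] B[of N] by blast
    have "norm (X N v + Y N v) \<le> A + B" "norm (D v + E v) \<le> A + B" for v
      by (intro order_trans[OF norm_triangle_ineq] add_mono D E)+
    then show "\<exists>D. vderiv N f (\<lambda>v. X N v + Y N v) D \<and> (\<forall>v. norm (X N v + Y N v) \<le> A + B \<and> norm (D v) \<le> A + B)"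
      using vderiv_add[OF D(1) E(1)] by blast
  qed
qed

lemma tame_mult:
  assumes "tame f X" "tame f Y"
  shows "tame f (\<lambda>N v. X N v * Y N v)"
proof -
  from assms obtain A B where A: "\<And>N. \<exists>D. vderiv N f (X N) D \<and> (\<forall>v. norm (X N v) \<le> A \<and> norm (D v) \<le> A)"
    and B: "\<And>N. \<exists>D. vderiv N f (Y N) D \<and> (\<forall>v. norm (Y N v) \<le> B \<and> norm (D v) \<le> B)"
    unfolding tame_def by blast
  have A0: "A \<ge> 0" and B0: "B \<ge> 0" using A[of 0] B[of 0] norm_ge_zero order_trans by blast+
  show ?thesis unfolding tame_def
  proof (intro exI[of _ "2 * (A * B)"] allI)
    fix N
    obtain D E where D: "vderiv N f (X N) D" "\<And>v. norm (X N v) \<le> A" "\<And>v. norm (D v) \<le> A"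
      and E: "vderiv N f (Y N) E" "\<And>v. norm (Y N v) \<le> B" "\<And>v. norm (E v) \<le> B"
      using A[of N] B[of N] by blast
    have AB: "norm (X N v) * norm (Y N v) \<le> A * B" "norm (D v) * norm (Y N v) \<le> A * B" "norm (X N v) * norm (E v) \<le> A * B" for v
      by (intro mult_mono D E A0 norm_ge_zero)+
    have AB0: "A * B \<ge> 0" using A0 B0 by simp
    have "norm (X N v * Y N v) \<le> 2 * (A * B)" for v
      using AB(1)[of v] AB0 unfolding norm_mult by linarith
    moreover have "norm (D v * Y N v + X N v * E v) \<le> 2 * (A * B)" for v
      using norm_triangle_ineq[of "D v * Y N v" "X N v * E v"] AB(2,3)[of v] unfolding norm_mult by linarith
    ultimately show "\<exists>D. vderiv N f (\<lambda>v. X N v * Y N v) D \<and> (\<forall>v. norm (X N v * Y N v) \<le> 2 * (A * B) \<and> norm (D v) \<le> 2 * (A * B))"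
      using vderiv_mult[OF D(1) E(1)] by blast
  qed
qed

lemma tame_sum:
  assumes "finite I" "\<And>i. i \<in> I \<Longrightarrow> tame f (X i)"
  shows "tame f (\<lambda>N v. \<Sum>i\<in>I. X i N v)"
  using assms by (induction I rule: finite_induct) (auto intro!: tame_const tame_add)

lemma tame_nstat:
  assumes z: "Im z \<noteq> 0" and f: "\<And>u. norm (f u) \<le> F" "f \<in> borel_measurable borel"
  shows "tame f (\<lambda>N. nstat N z k)"
  unfolding tame_def
proof (intro exI allI)
  fix N
  let ?B = "1 / \<bar>Im z\<bar>"
  let ?D = "\<lambda>v::nat\<Rightarrow>real. \<Sum>j<N. of_nat k * f (v j) * (1 / (z - complex_of_real (v j))) ^ (k + 1)"
  let ?C = "?B ^ k + real k * F * ?B ^ (k + 1)"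
  have F0: "F \<ge> 0" using f(1) norm_ge_zero order_trans by blast
  have bf: "bounded (range f)" using f(1) unfolding bounded_iff by blast
  have B0: "?B ^ n \<ge> 0" for n by simp
  have kF0: "real k * F * ?B ^ (k + 1) \<ge> 0" using F0 B0[of "k + 1"] by (intro mult_nonneg_nonneg) auto
  have vd: "vderiv N f (nstat N z k) (\<lambda>v. 1 / of_nat N * ?D v)"
    using vderiv_cmult[OF vderiv_pstat[OF z bf f(2), of N k], of "1 / of_nat N"] by (simp add: nstat_def[abs_def])
  have "norm (?D v) \<le> real N * (real k * F * ?B ^ (k + 1))" for v
  proof -
    have "norm (?D v) \<le> (\<Sum>j<N. real k * F * ?B ^ (k + 1))"
    proof (intro order_trans[OF norm_sum] sum_mono)
      fix j
      have "norm ((1 / (z - complex_of_real (v j))) ^ (k + 1)) \<le> ?B ^ (k + 1)"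
        unfolding norm_power by (intro power_mono norm_inverse_diff_real_le z norm_ge_zero)
      then show "norm (of_nat k * f (v j) * (1 / (z - complex_of_real (v j))) ^ (k + 1)) \<le> real k * F * ?B ^ (k + 1)"
        unfolding norm_mult norm_of_nat using f(1) F0 by (intro mult_mono mult_nonneg_nonneg norm_ge_zero) auto
    qed
    then show ?thesis by simp
  qed
  then have "norm (1 / of_nat N * ?D v) \<le> real k * F * ?B ^ (k + 1)" for v
    using kF0 by (cases "N = 0") (simp_all add: norm_mult norm_divide pos_divide_le_eq mult.commute)
  then have "norm (1 / of_nat N * ?D v) \<le> ?C" for v using B0[of k] by (meson add_increasing)
  moreover have "norm (nstat N z k v) \<le> ?C" for v using norm_nstat_le[OF z, of N k v] kF0 by linarith
  ultimately show "vderiv N f (nstat N z k) (\<lambda>v. 1 / of_nat N * ?D v) \<and>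
      (\<forall>v. norm (nstat N z k v) \<le> ?C \<and> norm (1 / of_nat N * ?D v) \<le> ?C)"
    using vd by blast
qed

text \<open>The part of the loop equation of order \<open>N\<^sup>2\<close>, divided by
  \<open>\<kappa> * N\<^sup>2\<close>. For \<open>a = 1\<close>, \<open>N > 0\<close> and
  \<open>z = x\<close> it is the \<open>Q\<close> of the overview.\<close>

definition lstat :: "real \<Rightarrow> nat \<Rightarrow> complex \<Rightarrow> nat \<Rightarrow> (nat \<Rightarrow> real) \<Rightarrow> complex" where
  "lstat g N z a v = (\<Sum>i<a. nstat N z (i + 1) v * nstat N z (a - i) v)
     - (z * nstat N z a v - nstat N z (a - 1) v) / of_real g"

lemma cnj_lstat: "cnj (lstat g N z a v) = lstat g N (cnj z) a v"
  by (simp add: lstat_def nstat_def cnj_pstat)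

lemma tame_lstat:
  assumes z: "Im z \<noteq> 0" and f: "\<And>u. norm (f u) \<le> F" "f \<in> borel_measurable borel"
  shows "tame f (\<lambda>N. lstat g N z a)"
proof -
  have "tame f (\<lambda>N v. (\<Sum>i<a. nstat N z (i + 1) v * nstat N z (a - i) v)
     + ((- z / of_real g) * nstat N z a v + 1 / of_real g * nstat N z (a - 1) v))"
    by (intro tame_add tame_mult tame_sum tame_const tame_nstat[OF z f]) auto
  moreover have "(\<lambda>N v. (\<Sum>i<a. nstat N z (i + 1) v * nstat N z (a - i) v)
     + ((- z / of_real g) * nstat N z a v + 1 / of_real g * nstat N z (a - 1) v)) = (\<lambda>N. lstat g N z a)"
    by (simp add: lstat_def[abs_def] fun_eq_iff diff_divide_distrib)
  ultimately show ?thesis by simp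
qed

text \<open>Lets a moment estimate absorb its own lower-order terms.\<close>

lemma absorb_powers:
  fixes t A :: real
  assumes "t \<ge> 0" "A \<ge> 0" "p \<ge> 1"
  shows "A * t ^ (2 * p - 1) + A * t ^ (2 * p - 2) \<le> t ^ (2 * p) / 2 + 2 * A * (4 * A + 1) ^ (2 * p)"
\<comment> \<open>Above the threshold \<open>t \<ge> 1\<close> merges both terms into
  \<open>2 * A * t ^ (2 * p - 1)\<close>, and \<open>t \<ge> 4 * A\<close> makes that at most half
  of \<open>t ^ (2 * p)\<close>. Below it, all powers are at most the power \<open>2 * p\<close> of
  the threshold.\<close>
proof (cases "t \<ge> 4 * A + 1")
  case True
  obtain n where n: "p = Suc n" using assms(3) by (cases p) auto
  have "A * t ^ (2 * n + 1) + A * t ^ (2 * n) \<le> A * t ^ (2 * n + 1) + A * t ^ (2 * n + 1)"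
    using True assms by (intro add_left_mono mult_left_mono power_increasing) auto
  also have "\<dots> = (4 * A) * t ^ (2 * n + 1) / 2" by simp
  also have "\<dots> \<le> t * t ^ (2 * n + 1) / 2"
    using True assms by (intro divide_right_mono mult_right_mono) auto
  also have "\<dots> = t ^ (2 * p) / 2" by (simp add: n)
  also have "\<dots> \<le> t ^ (2 * p) / 2 + 2 * A * (4 * A + 1) ^ (2 * p)" using assms by simp
  finally show ?thesis by (simp add: n)
next
  case False
  let ?R = "4 * A + 1"
  have "t ^ m \<le> ?R ^ (2 * p)" if "m \<le> 2 * p" for m
  proof -
    have "t ^ m \<le> ?R ^ m" using False assms by (intro power_mono) auto
    also have "\<dots> \<le> ?R ^ (2 * p)" using assms that by (intro power_increasing) auto
    finally show ?thesis .
  qed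
  then have "A * t ^ (2 * p - 1) + A * t ^ (2 * p - 2) \<le> A * ?R ^ (2 * p) + A * ?R ^ (2 * p)"
    using assms by (intro add_mono mult_left_mono) auto
  also have "\<dots> \<le> t ^ (2 * p) / 2 + 2 * A * ?R ^ (2 * p)" using assms by simp
  finally show ?thesis .
qed

section \<open>Moment bounds for the left-hand sides of the loop equations\<close>

locale gbe =
  fixes g \<kappa> :: real and x :: complex
  assumes g: "g > 0" and \<kappa>: "\<kappa> > 0" and x: "Im x \<noteq> 0"
begin

definition mean :: "nat \<Rightarrow> ((nat \<Rightarrow> real) \<Rightarrow> complex) \<Rightarrow> complex" where
  "mean N F = (\<integral>v. F v \<partial>gbe_law g \<kappa> N)"

definition regular :: "nat \<Rightarrow> ((nat \<Rightarrow> real) \<Rightarrow> complex) \<Rightarrow> bool" where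
  "regular N F \<longleftrightarrow> F \<in> borel_measurable (lborel_pow N) \<and> bounded (range F)"

lemma regular_integrable: "regular N F \<Longrightarrow> integrable (gbe_law g \<kappa> N) F"
  unfolding regular_def by (intro integrable_gbe_law g \<kappa>) auto

lemma regular_const: "regular N (\<lambda>v. c)"
  by (auto simp: regular_def image_def)

lemma regular_add: "regular N F \<Longrightarrow> regular N G \<Longrightarrow> regular N (\<lambda>v. F v + G v)"
  unfolding regular_def by (auto intro: bounded_plus_comp)

lemma regular_mult: "regular N F \<Longrightarrow> regular N G \<Longrightarrow> regular N (\<lambda>v. F v * G v)"
  unfolding regular_def by (auto intro: bounded_range_mult)

lemma regular_pstat: "Im z \<noteq> 0 \<Longrightarrow> regular N (pstat N z k)"
  unfolding regular_def bounded_iff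
  by (auto intro!: pstat_measurable norm_pstat_le exI[of _ "real N * (1 / \<bar>Im z\<bar>) ^ k"] simp del: power_one_over)

lemma regular_vderiv:
  assumes "vderiv N f G D"
  shows "regular N G" "regular N D"
proof -
  obtain D1 D2 where *: "ddir N (\<lambda>u. Re (f u)) G D1" "ddir N (\<lambda>u. Im (f u)) G D2" "D = (\<lambda>v. D1 v + \<i> * D2 v)"
    using assms unfolding vderiv_def by blast
  show "regular N G" using * ddir_bounded by (auto simp: regular_def ddir_def)
  have "regular N D1" "regular N D2" using * ddir_bounded by (auto simp: regular_def ddir_def)
  then show "regular N D" unfolding *(3) by (intro regular_add regular_mult regular_const)
qed

lemma mean_add: "regular N F \<Longrightarrow> regular N G \<Longrightarrow> mean N (\<lambda>v. F v + G v) = mean N F + mean N G"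
  unfolding mean_def by (intro Bochner_Integration.integral_add regular_integrable)

lemma mean_cmult: "mean N (\<lambda>v. c * F v) = c * mean N F"
  unfolding mean_def by simp

lemma mean_const [simp]: "mean N (\<lambda>v. c) = c"
proof -
  interpret prob_space "gbe_law g \<kappa> N" by (rule prob_space_gbe_law[OF g \<kappa>])
  show ?thesis unfolding mean_def using prob_space by simp
qed

lemma integrable_norm_power:
  assumes "regular N F"
  shows "integrable (gbe_law g \<kappa> N) (\<lambda>v. norm (F v) ^ p)"
proof (rule integrable_gbe_law[OF g \<kappa>])
  have [measurable]: "F \<in> borel_measurable (lborel_pow N)" using assms by (simp add: regular_def)
  show "(\<lambda>v. norm (F v) ^ p) \<in> borel_measurable (lborel_pow N)" by measurable
  obtain B where "\<And>v. norm (F v) \<le> B" using assms unfolding regular_def bounded_iff by auto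
  then have "norm (norm (F v) ^ p) \<le> B ^ p" for v by (simp add: power_mono)
  then show "bounded (range (\<lambda>v. norm (F v) ^ p))" unfolding bounded_iff by blast
qed

text \<open>All orders are demanded together because a product needs moments of twice the order of
  its factors.\<close>

definition moment_bounded :: "(nat \<Rightarrow> (nat \<Rightarrow> real) \<Rightarrow> complex) \<Rightarrow> bool" where
  "moment_bounded X \<longleftrightarrow> (\<forall>N. regular N (X N)) \<and>
     (\<forall>p. \<exists>C. \<forall>N>0. (\<integral>v. norm (X N v) ^ p \<partial>gbe_law g \<kappa> N) \<le> C)"

lemma moment_boundedI:
  assumes "\<And>N. regular N (X N)"
    and "\<And>p. \<exists>C. \<forall>N>0. (\<integral>v. norm (X N v) ^ p \<partial>gbe_law g \<kappa> N) \<le> C"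
  shows "moment_bounded X"
  using assms by (simp add: moment_bounded_def)

lemma moment_bounded_uniform:
  assumes "\<And>N. regular N (X N)" "\<And>N v. N > 0 \<Longrightarrow> norm (X N v) \<le> C"
  shows "moment_bounded X"
proof (rule moment_boundedI)
  fix p
  have "(\<integral>v. norm (X N v) ^ p \<partial>gbe_law g \<kappa> N) \<le> C ^ p" if "N > 0" for N
  proof -
    interpret prob_space "gbe_law g \<kappa> N" by (rule prob_space_gbe_law[OF g \<kappa>])
    have "(\<integral>v. norm (X N v) ^ p \<partial>gbe_law g \<kappa> N) \<le> (\<integral>v. C ^ p \<partial>gbe_law g \<kappa> N)"
      using assms(2)[OF that] by (intro integral_mono integrable_norm_power assms(1) power_mono) auto
    then show ?thesis using prob_space by simp
  qed
  then show "\<exists>C. \<forall>N>0. (\<integral>v. norm (X N v) ^ p \<partial>gbe_law g \<kappa> N) \<le> C" by blast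
qed (rule assms(1))

lemma moment_bounded_add:
  assumes X: "moment_bounded X" and Y: "moment_bounded Y"
  shows "moment_bounded (\<lambda>N v. X N v + Y N v)"
proof (rule moment_boundedI)
  have r: "regular N (X N)" "regular N (Y N)" for N using assms by (auto simp: moment_bounded_def)
  then show "regular N (\<lambda>v. X N v + Y N v)" for N by (intro regular_add)
  fix p
  obtain A B where A: "\<And>N. N > 0 \<Longrightarrow> (\<integral>v. norm (X N v) ^ p \<partial>gbe_law g \<kappa> N) \<le> A"
    and B: "\<And>N. N > 0 \<Longrightarrow> (\<integral>v. norm (Y N v) ^ p \<partial>gbe_law g \<kappa> N) \<le> B"
    using X Y unfolding moment_bounded_def by metis
  have pt: "(norm (a + b)) ^ p \<le> 2 ^ p * (norm a ^ p + norm b ^ p)" for a b :: complex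
  proof -
    have "norm (a + b) ^ p \<le> (2 * max (norm a) (norm b)) ^ p"
      using norm_triangle_ineq[of a b] by (intro power_mono) auto
    also have "\<dots> = 2 ^ p * max (norm a) (norm b) ^ p" by (rule power_mult_distrib)
    also have "max (norm a) (norm b) ^ p \<le> norm a ^ p + norm b ^ p" by (auto simp: max_def)
    finally show ?thesis by simp
  qed
  have "(\<integral>v. norm (X N v + Y N v) ^ p \<partial>gbe_law g \<kappa> N) \<le> 2 ^ p * (A + B)" if N: "N > 0" for N
  proof -
    have "(\<integral>v. norm (X N v + Y N v) ^ p \<partial>gbe_law g \<kappa> N) \<le> (\<integral>v. 2 ^ p * (norm (X N v) ^ p + norm (Y N v) ^ p) \<partial>gbe_law g \<kappa> N)"
      using r by (intro integral_mono integrable_norm_power regular_add integrable_mult_right Bochner_Integration.integrable_add pt)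
    also have "\<dots> = 2 ^ p * ((\<integral>v. norm (X N v) ^ p \<partial>gbe_law g \<kappa> N) + (\<integral>v. norm (Y N v) ^ p \<partial>gbe_law g \<kappa> N))"
      using r by (simp add: Bochner_Integration.integral_add[OF integrable_norm_power integrable_norm_power])
    also have "\<dots> \<le> 2 ^ p * (A + B)" using A[OF N] B[OF N] by (intro mult_left_mono add_mono) auto
    finally show ?thesis .
  qed
  then show "\<exists>C. \<forall>N>0. (\<integral>v. norm (X N v + Y N v) ^ p \<partial>gbe_law g \<kappa> N) \<le> C" by blast
qed

lemma moment_bounded_mult:
  assumes X: "moment_bounded X" and Y: "moment_bounded Y"
  shows "moment_bounded (\<lambda>N v. X N v * Y N v)"
proof (rule moment_boundedI)
  have r: "regular N (X N)" "regular N (Y N)" for N using assms by (auto simp: moment_bounded_def)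
  then show "regular N (\<lambda>v. X N v * Y N v)" for N by (intro regular_mult)
  fix p
  obtain A B where A: "\<And>N. N > 0 \<Longrightarrow> (\<integral>v. norm (X N v) ^ (2 * p) \<partial>gbe_law g \<kappa> N) \<le> A"
    and B: "\<And>N. N > 0 \<Longrightarrow> (\<integral>v. norm (Y N v) ^ (2 * p) \<partial>gbe_law g \<kappa> N) \<le> B"
    using X Y unfolding moment_bounded_def by metis
  have pt: "(norm (a * b)) ^ p \<le> norm a ^ (2 * p) + norm b ^ (2 * p)" for a b :: complex
  proof -
    have "norm (a * b) ^ p = norm a ^ p * norm b ^ p" by (simp add: norm_mult power_mult_distrib)
    also have "\<dots> \<le> (norm a ^ p)\<^sup>2 + (norm b ^ p)\<^sup>2"
    proof -
      have "2 * (norm a ^ p * norm b ^ p) \<le> (norm a ^ p)\<^sup>2 + (norm b ^ p)\<^sup>2"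
        using sum_squares_bound[of "norm a ^ p" "norm b ^ p"] by (simp add: mult.assoc)
      moreover have "norm a ^ p * norm b ^ p \<ge> 0" by simp
      ultimately show ?thesis by linarith
    qed
    finally show ?thesis by (simp add: mult.commute flip: power_mult)
  qed
  have "(\<integral>v. norm (X N v * Y N v) ^ p \<partial>gbe_law g \<kappa> N) \<le> A + B" if N: "N > 0" for N
  proof -
    have "(\<integral>v. norm (X N v * Y N v) ^ p \<partial>gbe_law g \<kappa> N) \<le> (\<integral>v. norm (X N v) ^ (2 * p) + norm (Y N v) ^ (2 * p) \<partial>gbe_law g \<kappa> N)"
      using r by (intro integral_mono integrable_norm_power regular_mult Bochner_Integration.integrable_add pt)
    also have "\<dots> = (\<integral>v. norm (X N v) ^ (2 * p) \<partial>gbe_law g \<kappa> N) + (\<integral>v. norm (Y N v) ^ (2 * p) \<partial>gbe_law g \<kappa> N)"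
      using r by (intro Bochner_Integration.integral_add integrable_norm_power)
    also have "\<dots> \<le> A + B" using A[OF N] B[OF N] by linarith
    finally show ?thesis .
  qed
  then show "\<exists>C. \<forall>N>0. (\<integral>v. norm (X N v * Y N v) ^ p \<partial>gbe_law g \<kappa> N) \<le> C" by blast
qed

lemma moment_bounded_const: "moment_bounded (\<lambda>N v. c)"
  by (intro moment_bounded_uniform[where C = "norm c"] regular_const) simp

lemma moment_bounded_sum:
  "finite I \<Longrightarrow> (\<And>i. i \<in> I \<Longrightarrow> moment_bounded (X i)) \<Longrightarrow> moment_bounded (\<lambda>N v. \<Sum>i\<in>I. X i N v)"
  by (induction I rule: finite_induct) (auto intro: moment_bounded_const moment_bounded_add)

lemma moment_bounded_mean:
  assumes "moment_bounded X"
  shows "(\<lambda>N. mean N (X N)) \<in> O(\<lambda>N. 1)"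
proof -
  obtain C where C: "\<And>N. N > 0 \<Longrightarrow> (\<integral>v. norm (X N v) ^ 1 \<partial>gbe_law g \<kappa> N) \<le> C"
    using assms unfolding moment_bounded_def by metis
  have "norm (mean N (X N)) \<le> C" if "N > 0" for N
    unfolding mean_def using C[OF that] by (intro order_trans[OF integral_norm_bound]) simp
  then show ?thesis
    by (intro bigoI[where c = C]) (auto intro!: eventually_sequentiallyI[of 1])
qed

text \<open>Separates the powers of \<open>N\<close>. The factor \<open>1 - \<kappa>\<close>
  collects the Jacobian and the diagonal of the pair sum, which contribute the same power sum with
  weights \<open>1\<close> and \<open>- \<kappa>\<close>.\<close>

lemma mean_loop_equation:
  assumes N: "N > 0" and a: "a > 0" and G: "vderiv N (\<lambda>u. (1 / (x - complex_of_real u)) ^ a) G D"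
  shows "mean N (\<lambda>v. (of_real \<kappa> * (of_nat N)\<^sup>2 * lstat g N x a v
     + of_nat a * (1 - of_real \<kappa>) * pstat N x (a + 1) v) * G v + D v) = 0"
proof -
  have p: "pstat N x k v = of_nat N * nstat N x k v" for k v using N by (simp add: nstat_def)
  have e: "of_real \<kappa> * ((\<Sum>i<a. pstat N x (i + 1) v * pstat N x (a - i) v) - of_nat a * pstat N x (a + 1) v)
     + of_nat a * pstat N x (a + 1) v
     - of_real (real N * \<kappa> / g) * (x * pstat N x a v - pstat N x (a - 1) v)
    = of_real \<kappa> * (of_nat N)\<^sup>2 * lstat g N x a v + of_nat a * (1 - of_real \<kappa>) * pstat N x (a + 1) v" for v
  proof -
    have "(\<Sum>i<a. pstat N x (i + 1) v * pstat N x (a - i) v) = (of_nat N)\<^sup>2 * (\<Sum>i<a. nstat N x (i + 1) v * nstat N x (a - i) v)"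
      unfolding p sum_distrib_left by (intro sum.cong refl) (simp add: power2_eq_square mult_ac)
    then show ?thesis
      using g unfolding lstat_def p by (simp add: field_simps power2_eq_square)
  qed
  show ?thesis
    using loop_equation[OF g \<kappa> x a G] unfolding e mean_def .
qed

text \<open>The overview's test-function argument, for every \<open>a\<close>: the leading term
  becomes \<open>real N * \<kappa>\<close> times the absolute moment of order \<open>2 * p\<close>.
  The remaining terms are at most of order \<open>N\<close> times the powers
  \<open>2 * p - 1\<close> and \<open>2 * p - 2\<close>, which \<open>absorb_powers\<close>
  removes.\<close>

lemma moment_bounded_lstat:
  assumes a: "a > 0"
  shows "moment_bounded (\<lambda>N v. of_nat N * lstat g N x a v)"
proof -
  define B where "B = 1 / \<bar>Im x\<bar>"
  define f where "f u = (1 / (x - complex_of_real u)) ^ a" for u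
  have fB: "norm (f u) \<le> B ^ a" for u
    unfolding f_def norm_power B_def by (intro power_mono norm_inverse_diff_real_le x norm_ge_zero)
  have fm: "f \<in> borel_measurable borel" unfolding f_def[abs_def] by measurable
  have xc: "Im (cnj x) \<noteq> 0" using x by simp
  obtain C1 where C1: "\<And>N. \<exists>D. vderiv N f (lstat g N x a) D \<and> (\<forall>v. norm (lstat g N x a v) \<le> C1 \<and> norm (D v) \<le> C1)"
    using tame_lstat[where f = f, OF x fB fm] unfolding tame_def by blast
  obtain C2 where C2: "\<And>N. \<exists>D. vderiv N f (lstat g N (cnj x) a) D \<and> (\<forall>v. norm (lstat g N (cnj x) a v) \<le> C2 \<and> norm (D v) \<le> C2)"
    using tame_lstat[where f = f, OF xc fB fm] unfolding tame_def by blast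
  have C0: "C1 \<ge> 0" "C2 \<ge> 0" using C1[of 0] C2[of 0] norm_ge_zero order_trans by blast+
  let ?q = "\<lambda>N v. of_nat N * lstat g N x a v"
  have reg: "regular N (?q N)" for N
  proof -
    obtain D where "vderiv N f (lstat g N x a) D" using C1[of N] by blast
    then show ?thesis by (intro regular_mult regular_const regular_vderiv(1))
  qed
  have even: "\<exists>C. \<forall>N>0. (\<integral>v. norm (?q N v) ^ (2 * p) \<partial>gbe_law g \<kappa> N) \<le> C" if p: "p \<ge> 1" for p
  proof -
    \<comment> \<open>The first summand comes from the \<open>pstat\<close> term, the second from
      the derivative of the test function, each divided by the \<kappa> of the leading term.\<close>
    define A where "A = real a * \<bar>1 - \<kappa>\<bar> * B ^ (a + 1) / \<kappa> + 2 * real p * (C1 + C2) / \<kappa>"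
    have A1: "real a * \<bar>1 - \<kappa>\<bar> * B ^ (a + 1) / \<kappa> \<ge> 0" using \<kappa> by (simp add: B_def)
    have A2: "2 * real p * (C1 + C2) / \<kappa> \<ge> 0" using \<kappa> C0 by simp
    have A0: "A \<ge> 0" using A1 A2 by (simp add: A_def)
    define K where "K = 2 * A * (4 * A + 1) ^ (2 * p)"
    have "(\<integral>v. norm (?q N v) ^ (2 * p) \<partial>gbe_law g \<kappa> N) \<le> 2 * K" if N: "N > 0" for N
    proof -
      interpret prob_space "gbe_law g \<kappa> N" by (rule prob_space_gbe_law[OF g \<kappa>])
      let ?Q = "?q N"
      let ?I = "\<integral>v. norm (?Q v) ^ (2 * p) \<partial>gbe_law g \<kappa> N"
      \<comment> \<open>The conjugate of \<open>?Q\<close>, written as the same statistic at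
        \<open>cnj x\<close> so that the rules for \<open>vderiv\<close> apply to it.\<close>
      let ?Qc = "\<lambda>v. of_nat N * lstat g N (cnj x) a v"
      obtain D1 where D1: "vderiv N f (lstat g N x a) D1" "\<And>v. norm (D1 v) \<le> C1" using C1[of N] by blast
      obtain D2 where D2: "vderiv N f (lstat g N (cnj x) a) D2" "\<And>v. norm (D2 v) \<le> C2" using C2[of N] by blast
      let ?G = "\<lambda>v. ?Qc v ^ p * ?Q v ^ (p - 1)"
      let ?D = "\<lambda>v. (of_nat p * ?Qc v ^ (p - 1) * (of_nat N * D2 v)) * ?Q v ^ (p - 1)
          + ?Qc v ^ p * (of_nat (p - 1) * ?Q v ^ (p - 1 - 1) * (of_nat N * D1 v))"
      have vG: "vderiv N f ?G ?D"
        by (intro vderiv_mult vderiv_power vderiv_cmult D1 D2)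
      have nc: "norm (?Qc v) = norm (?Q v)" for v
        unfolding norm_mult by (simp flip: cnj_lstat)
      have QG: "?Q v * ?G v = complex_of_real (norm (?Q v) ^ (2 * p))" for v
      proof -
        have c: "?Qc v = cnj (?Q v)" by (simp add: cnj_lstat)
        obtain n where n: "p = Suc n" using p by (cases p) auto
        have "?Q v * ?G v = (?Q v * cnj (?Q v)) ^ p"
          unfolding c n by (simp add: power_mult_distrib)
        also have "?Q v * cnj (?Q v) = complex_of_real ((norm (?Q v))\<^sup>2)"
          by (simp only: complex_norm_square)
        finally show ?thesis by (simp flip: power_mult)
      qed
      have nD: "norm (?D v) \<le> real N * (2 * real p * (C1 + C2)) * norm (?Q v) ^ (2 * p - 2)" for v
      proof -
        have "norm (?D v) \<le> norm ((of_nat p * ?Qc v ^ (p - 1) * (of_nat N * D2 v)) * ?Q v ^ (p - 1))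
            + norm (?Qc v ^ p * (of_nat (p - 1) * ?Q v ^ (p - 1 - 1) * (of_nat N * D1 v)))"
          by (rule norm_triangle_ineq)
        also have "norm ((of_nat p * ?Qc v ^ (p - 1) * (of_nat N * D2 v)) * ?Q v ^ (p - 1)) = real p * real N * norm (D2 v) * norm (?Q v) ^ (2 * p - 2)"
        proof -
          have "2 * p - 2 = (p - 1) + (p - 1)" by simp
          then show ?thesis unfolding norm_mult[of _ "_ ^ _"] norm_mult[of _ "_ * D2 v"] norm_mult[of _ "D2 v"] norm_power nc
            by (simp only: power_add norm_of_nat mult_ac)
        qed
        also have "norm (?Qc v ^ p * (of_nat (p - 1) * ?Q v ^ (p - 1 - 1) * (of_nat N * D1 v))) = real (p - 1) * real N * norm (D1 v) * norm (?Q v) ^ (2 * p - 2)"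
        \<comment> \<open>For \<open>p = 1\<close> the truncated exponents disagree, but the factor
          \<open>p - 1\<close> makes both sides vanish.\<close>
        proof (cases "p = 1")
          case False
          then have "2 * p - 2 = p + (p - 1 - 1)" using p by simp
          then show ?thesis unfolding norm_mult[of "_ ^ _"] norm_mult[of _ "_ ^ _"] norm_mult[of _ "_ * D1 v"] norm_mult[of _ "D1 v"] norm_power nc
            by (simp only: power_add norm_of_nat mult_ac)
        qed simp
        also have "real p * real N * norm (D2 v) * norm (?Q v) ^ (2 * p - 2) + real (p - 1) * real N * norm (D1 v) * norm (?Q v) ^ (2 * p - 2)
          \<le> real p * real N * C2 * norm (?Q v) ^ (2 * p - 2) + real p * real N * C1 * norm (?Q v) ^ (2 * p - 2)"
          using D1(2)[of v] D2(2)[of v] C0 by (intro add_mono mult_right_mono mult_mono mult_nonneg_nonneg) auto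
        also have "\<dots> = real N * (real p * (C1 + C2)) * norm (?Q v) ^ (2 * p - 2)" by (simp add: algebra_simps)
        also have "\<dots> \<le> real N * (2 * real p * (C1 + C2)) * norm (?Q v) ^ (2 * p - 2)"
          using C0 by (intro mult_right_mono mult_left_mono) auto
        finally show ?thesis .
      qed
      have nG: "norm (?G v) = norm (?Q v) ^ (2 * p - 1)" for v
      proof -
        have "2 * p - 1 = p + (p - 1)" using p by simp
        then show ?thesis unfolding norm_mult[of "_ ^ _"] norm_power nc by (simp only: power_add)
      qed
      have rD: "regular N ?D" and rG: "regular N ?G" using regular_vderiv[OF vG] by auto
      let ?H = "\<lambda>v. of_nat a * (1 - of_real \<kappa>) * pstat N x (a + 1) v * ?G v + ?D v"
      have rH: "regular N ?H"
        by (intro regular_add regular_mult regular_const regular_pstat x rG rD)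
      have nH: "norm (?H v) \<le> real N * \<kappa> * (A * norm (?Q v) ^ (2 * p - 1) + A * norm (?Q v) ^ (2 * p - 2))" for v
      proof -
        have "norm (?H v) \<le> norm (of_nat a * (1 - of_real \<kappa>) * pstat N x (a + 1) v * ?G v) + norm (?D v)"
          by (rule norm_triangle_ineq)
        also have "norm (of_nat a * (1 - of_real \<kappa>) * pstat N x (a + 1) v * ?G v)
            = real a * \<bar>1 - \<kappa>\<bar> * norm (pstat N x (a + 1) v) * norm (?G v)"
        proof -
          have "norm (1 - complex_of_real \<kappa>) = \<bar>1 - \<kappa>\<bar>" by (metis norm_of_real of_real_1 of_real_diff)
          then show ?thesis unfolding norm_mult[of _ "?G v"] norm_mult[of _ "pstat N x (a + 1) v"] norm_mult[of "of_nat a"] by simp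
        qed
        also have "\<dots> \<le> real a * \<bar>1 - \<kappa>\<bar> * (real N * B ^ (a + 1)) * norm (?G v)"
          unfolding B_def by (intro mult_right_mono mult_left_mono norm_pstat_le x) auto
        also have "\<dots> = real N * \<kappa> * (real a * \<bar>1 - \<kappa>\<bar> * B ^ (a + 1) / \<kappa> * norm (?Q v) ^ (2 * p - 1))"
          unfolding nG using \<kappa> by simp
        also have "\<dots> \<le> real N * \<kappa> * (A * norm (?Q v) ^ (2 * p - 1))"
          unfolding A_def using A2 \<kappa> by (intro mult_left_mono mult_right_mono) auto
        also note nD[of v]
        also have "real N * (2 * real p * (C1 + C2)) * norm (?Q v) ^ (2 * p - 2) = real N * \<kappa> * (2 * real p * (C1 + C2) / \<kappa> * norm (?Q v) ^ (2 * p - 2))"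
          using \<kappa> by simp
        also have "\<dots> \<le> real N * \<kappa> * (A * norm (?Q v) ^ (2 * p - 2))"
          unfolding A_def using A1 \<kappa> by (intro mult_left_mono mult_right_mono) auto
        finally show ?thesis by (simp add: distrib_left)
      qed
      have N\<kappa>: "real N * \<kappa> > 0" using N \<kappa> by simp
      have "mean N (\<lambda>v. of_real (real N * \<kappa>) * (?Q v * ?G v) + ?H v) = 0"
      proof -
        have "(\<lambda>v. of_real (real N * \<kappa>) * (?Q v * ?G v) + ?H v) =
          (\<lambda>v. (of_real \<kappa> * (of_nat N)\<^sup>2 * lstat g N x a v + of_nat a * (1 - of_real \<kappa>) * pstat N x (a + 1) v) * ?G v + ?D v)"
        proof (rule ext)
          have e: "of_real (real N * \<kappa>) * (of_nat N * l * G) + (c * G + d) = (of_real \<kappa> * (of_nat N)\<^sup>2 * l + c) * G + d" for l G c d :: complex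
            by (simp add: algebra_simps power2_eq_square)
          show "of_real (real N * \<kappa>) * (?Q v * ?G v) + ?H v =
            (of_real \<kappa> * (of_nat N)\<^sup>2 * lstat g N x a v + of_nat a * (1 - of_real \<kappa>) * pstat N x (a + 1) v) * ?G v + ?D v" for v
            by (rule e)
        qed
        then show ?thesis using mean_loop_equation[OF N a vG[unfolded f_def]] by simp
      qed
      then have "of_real (real N * \<kappa>) * mean N (\<lambda>v. ?Q v * ?G v) + mean N ?H = 0"
        using mean_add[OF regular_mult[OF regular_const regular_mult[OF reg rG]] rH] mean_cmult by (simp only:)
      then have m1: "of_real (real N * \<kappa>) * mean N (\<lambda>v. ?Q v * ?G v) = - mean N ?H"
        by (rule eq_neg_iff_add_eq_0[THEN iffD2])
      have m2: "mean N (\<lambda>v. ?Q v * ?G v) = complex_of_real ?I"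
        unfolding QG mean_def by (rule integral_complex_of_real)
      have I0: "?I \<ge> 0"
        by (intro integral_nonneg_AE) auto
      have "norm (mean N ?H) = norm (- mean N ?H)" by (rule norm_minus_cancel[symmetric])
      also have "\<dots> = norm (complex_of_real (real N * \<kappa> * ?I))"
        unfolding m1[symmetric] m2 of_real_mult ..
      also have "\<dots> = real N * \<kappa> * ?I"
        unfolding norm_of_real by (rule abs_of_nonneg) (intro mult_nonneg_nonneg less_imp_le[OF N\<kappa>] I0)
      finally have "real N * \<kappa> * ?I = norm (mean N ?H)" by (rule sym)
      also have "\<dots> \<le> (\<integral>v. norm (?H v) \<partial>gbe_law g \<kappa> N)"
        unfolding mean_def by (rule integral_norm_bound)
      also have "\<dots> \<le> (\<integral>v. real N * \<kappa> * (norm (?Q v) ^ (2 * p) / 2 + K) \<partial>gbe_law g \<kappa> N)"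
      proof (rule integral_mono)
        show "integrable (gbe_law g \<kappa> N) (\<lambda>v. norm (?H v))" using regular_integrable[OF rH] by simp
        show "integrable (gbe_law g \<kappa> N) (\<lambda>v. real N * \<kappa> * (norm (?Q v) ^ (2 * p) / 2 + K))"
          using integrable_norm_power[OF reg] by simp
        fix v
        show "norm (?H v) \<le> real N * \<kappa> * (norm (?Q v) ^ (2 * p) / 2 + K)"
          using nH[of v] mult_left_mono[OF absorb_powers[OF norm_ge_zero[of "?Q v"] A0 p] less_imp_le[OF N\<kappa>]]
          unfolding K_def by linarith
      qed
      also have "\<dots> = real N * \<kappa> * (?I / 2 + K)"
        using integrable_norm_power[OF reg] prob_space by simp
      finally have "?I \<le> ?I / 2 + K"
        using N\<kappa> by (rule mult_left_le_imp_le)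
      then show ?thesis by simp
    qed
    then show ?thesis by blast
  qed
  show ?thesis
  proof (rule moment_boundedI[OF reg])
    fix p
    \<comment> \<open>Only even orders from 2 on are available so far; \<open>2 * Suc p\<close> lies
      above \<open>p\<close>, also for \<open>p = 0\<close>.\<close>
    obtain C where C: "\<And>N. N > 0 \<Longrightarrow> (\<integral>v. norm (?q N v) ^ (2 * Suc p) \<partial>gbe_law g \<kappa> N) \<le> C"
      using even[of "Suc p"] by auto
    have "(\<integral>v. norm (?q N v) ^ p \<partial>gbe_law g \<kappa> N) \<le> 1 + C" if N: "N > 0" for N
    proof -
      interpret prob_space "gbe_law g \<kappa> N" by (rule prob_space_gbe_law[OF g \<kappa>])
      have "t ^ p \<le> 1 + t ^ (2 * Suc p)" if "t \<ge> 0" for t :: real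
      proof (cases "t \<ge> 1")
        case True
        then have "t ^ p \<le> t ^ (2 * Suc p)" by (intro power_increasing) auto
        then show ?thesis by simp
      next
        case False
        then have "t ^ p \<le> 1" using that by (intro power_le_one) auto
        then show ?thesis using that by (intro order_trans[OF _ le_add_same_cancel1[THEN iffD2]]) auto
      qed
      then have "(\<integral>v. norm (?q N v) ^ p \<partial>gbe_law g \<kappa> N) \<le> (\<integral>v. 1 + norm (?q N v) ^ (2 * Suc p) \<partial>gbe_law g \<kappa> N)"
        by (intro integral_mono Bochner_Integration.integrable_add integrable_norm_power reg) auto
      also have "\<dots> = 1 + (\<integral>v. norm (?q N v) ^ (2 * Suc p) \<partial>gbe_law g \<kappa> N)"
        using prob_space by (subst Bochner_Integration.integral_add) (auto intro!: integrable_norm_power reg simp del: power_Suc mult_Suc_right)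
      also have "\<dots> \<le> 1 + C" using C[OF N] by simp
      finally show ?thesis .
    qed
    then show "\<exists>C. \<forall>N>0. (\<integral>v. norm (?q N v) ^ p \<partial>gbe_law g \<kappa> N) \<le> C" by blast
  qed
qed

end

text \<open>\<open>om u k = g * m k * y powi (k - 2)\<close>, where \<open>N * m k\<close> is the leading term of \<open>T k\<close> and
  \<open>u = x / y\<close>; the recursion is the loop equation at leading order.\<close>

function om :: "complex \<Rightarrow> nat \<Rightarrow> complex" where
  "om u 0 = (u\<^sup>2 - 1) / 4"
| "om u (Suc 0) = (u - 1) / 2"
| "om u (Suc (Suc n)) = om u (Suc n) + (\<Sum>j<n. om u (j + 2) * om u (n + 1 - j))"
  by pat_completeness auto
termination by (relation "Wellfounded.measure snd") auto

declare om.simps(3) [simp del]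

text \<open>For \<open>a > 1\<close> the two end terms of the sum each contain
  \<open>om u 1 = (u - 1) / 2\<close> and add up to \<open>(u - 1) * om u a\<close>. What is left of
  \<open>u * om u a\<close> is a single \<open>om u a\<close>, so the recursion defining
  \<open>om\<close> is this equation solved for it.\<close>

lemma om_convolution:
  assumes "a > 0"
  shows "(\<Sum>i<a. om u (i + 1) * om u (a - i)) = u * om u a - om u (a - 1)"
proof (cases "a = 1")
  case True
  then show ?thesis by (simp add: power2_eq_square field_simps)
next
  case False
  then obtain n where n: "a = Suc (Suc n)" using assms by (metis One_nat_def not0_implies_Suc less_not_refl)
  have "(\<Sum>i<a. om u (i + 1) * om u (a - i)) = om u 1 * om u a + (\<Sum>i<Suc n. om u (i + 2) * om u (Suc n - i))"
    unfolding n by (subst sum.lessThan_Suc_shift) simp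
  also have "(\<Sum>i<Suc n. om u (i + 2) * om u (Suc n - i)) = (\<Sum>j<n. om u (j + 2) * om u (n + 1 - j)) + om u a * om u 1"
    by (simp add: n)
  also have "(\<Sum>j<n. om u (j + 2) * om u (n + 1 - j)) = om u a - om u (a - 1)"
    using om.simps(3)[of u n] by (simp add: n)
  finally have "(\<Sum>i<a. om u (i + 1) * om u (a - i)) = om u 1 * om u a + (om u a - om u (a - 1) + om u a * om u 1)" .
  moreover have "(u - 1) / 2 * A + (A - B + A * ((u - 1) / 2)) = u * A - B" for A B :: complex
    by (simp add: field_simps)
  ultimately show ?thesis by (simp only: One_nat_def om.simps(2))
qed

text \<open>Removal by position: repeated entries are picked repeatedly, as the product rule for
  \<open>ymon\<close> requires.\<close>

fun picks :: "'a list \<Rightarrow> ('a \<times> 'a list) list" where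
  "picks [] = []"
| "picks (b # G) = (b, G) # map (\<lambda>(c, R). (c, b # R)) (picks G)"

section \<open>Fluctuations in rescaled variables\<close>

text \<open>Here \<open>y\<close> is the value of the square root at the single point
  \<open>x\<close>. The sign condition records the branch: the leading value
  \<open>(x - y) / 2\<close> of \<open>g * T 1 / N\<close> lies weakly on the same side of the real
  axis as that statistic itself.\<close>

locale gbe_branch = gbe +
  fixes y :: complex
  assumes y2: "y\<^sup>2 = x\<^sup>2 - 4 * of_real g"
    and branch: "Im (x - y) * Im x \<le> 0"
begin

lemma y_nz: "y \<noteq> 0"
proof
  assume "y = 0"
  then have "x\<^sup>2 = (of_real (2 * sqrt g))\<^sup>2"
    using y2 g by (simp add: power_mult_distrib flip: of_real_power)
  then have "x = of_real (2 * sqrt g) \<or> x = - of_real (2 * sqrt g)" by (simp only: power2_eq_iff)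
  then show False using x by auto
qed

definition u :: complex where "u = x / y"

definition h :: complex where "h = complex_of_real (sqrt \<kappa> - 1 / sqrt \<kappa>)"

text \<open>The expansion parameter of the theorem divided by \<open>y\<^sup>2\<close>, a
  normalisation that leaves \<open>u\<close> as the only trace of \<open>x\<close>, \<open>y\<close>
  and \<open>g\<close> in the recursion.\<close>

definition \<delta> :: "nat \<Rightarrow> complex" where
  "\<delta> N = complex_of_real (g / (sqrt \<kappa> * real N)) / y\<^sup>2"

lemma \<delta>_nz: "N > 0 \<Longrightarrow> \<delta> N \<noteq> 0"
  using g \<kappa> y_nz by (simp add: \<delta>_def)

lemma sqrt_\<kappa>_sq: "(complex_of_real (sqrt \<kappa>))\<^sup>2 = of_real \<kappa>"
  using \<kappa> by (simp flip: of_real_power)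

lemma sqrt_\<kappa>_nz: "complex_of_real (sqrt \<kappa>) \<noteq> 0"
  using \<kappa> by simp

lemma h_eq: "h * of_real (sqrt \<kappa>) = of_real \<kappa> - 1"
proof -
  have "(sqrt \<kappa> - 1 / sqrt \<kappa>) * sqrt \<kappa> = \<kappa> - 1" using \<kappa> by (simp add: left_diff_distrib)
  then show ?thesis unfolding h_def by (metis of_real_1 of_real_diff of_real_mult)
qed

lemma \<delta>_N: "N > 0 \<Longrightarrow> \<delta> N * of_real (sqrt \<kappa>) * of_nat N * y\<^sup>2 = of_real g"
  using \<kappa> y_nz by (simp add: \<delta>_def)

text \<open>\<open>\<delta> N * of_real (sqrt \<kappa>) * y ^ k * pstat N x k v\<close> has the large-\<open>N\<close> limit \<open>om u k\<close>;
  \<open>Y N k v\<close> is the fluctuation around it, on the scale on which it is of order one.\<close>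

definition p :: "nat \<Rightarrow> nat \<Rightarrow> (nat \<Rightarrow> real) \<Rightarrow> complex" where
  "p N k v = \<delta> N * of_real (sqrt \<kappa>) * y ^ k * pstat N x k v"

definition Y :: "nat \<Rightarrow> nat \<Rightarrow> (nat \<Rightarrow> real) \<Rightarrow> complex" where
  "Y N k v = (p N k v - om u k) / \<delta> N"

lemma p_Y: "N > 0 \<Longrightarrow> p N k v = om u k + \<delta> N * Y N k v"
  using \<delta>_nz by (simp add: Y_def)

lemma om_0: "om u 0 = of_real g / y\<^sup>2"
proof -
  have "x\<^sup>2 = y\<^sup>2 + 4 * of_real g" using y2 by simp
  then show ?thesis using y_nz by (simp add: u_def power_divide add_divide_distrib)
qed

text \<open>The statistic of index 0 is the constant \<open>N\<close>, so it does not fluctuate;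
  this is where the recursion for the moments stops.\<close>

lemma Y_0: "N > 0 \<Longrightarrow> Y N 0 v = 0"
  using \<delta>_N[of N] y_nz unfolding Y_def p_def om_0 by (simp add: field_simps)

lemma nstat_p: "N > 0 \<Longrightarrow> of_real g * y ^ k * nstat N x k v = p N k v * y\<^sup>2"
  using \<delta>_N[of N] by (simp add: nstat_def p_def field_simps)

lemma lstat_p:
  assumes N: "N > 0" and a: "a > 0"
  shows "(of_real g)\<^sup>2 * y ^ a * lstat g N x a v = y ^ 3 * ((\<Sum>i<a. p N (i + 1) v * p N (a - i) v) - u * p N a v + p N (a - 1) v)"
proof -
  let ?g = "complex_of_real g"
  have gnz: "?g \<noteq> 0" using g by simp
  obtain b where b: "a = Suc b" using a by (cases a) auto
  have 1: "?g\<^sup>2 * y ^ a * (\<Sum>i<a. nstat N x (i + 1) v * nstat N x (a - i) v) = y ^ 3 * (\<Sum>i<a. p N (i + 1) v * p N (a - i) v)"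
    unfolding sum_distrib_left
  proof (intro sum.cong refl)
    fix i assume "i \<in> {..<a}"
    \<comment> \<open>The exponents on the right add up to \<open>a + 1\<close>; the surplus factor
      \<open>y\<close> is cancelled at the end.\<close>
    then have e: "y ^ a * y = y ^ (i + 1) * y ^ (a - i)" by (simp flip: power_add power_Suc2)
    have "y * (?g\<^sup>2 * y ^ a * (nstat N x (i + 1) v * nstat N x (a - i) v)) = ?g\<^sup>2 * (y ^ a * y) * (nstat N x (i + 1) v * nstat N x (a - i) v)"
      by (simp only: mult_ac)
    also have "\<dots> = (?g * y ^ (i + 1) * nstat N x (i + 1) v) * (?g * y ^ (a - i) * nstat N x (a - i) v)"
      unfolding e by (simp only: power2_eq_square mult_ac)
    also have "\<dots> = y * (y ^ 3 * (p N (i + 1) v * p N (a - i) v))"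
      unfolding nstat_p[OF N] by (simp add: power2_eq_square power3_eq_cube mult_ac)
    finally show "?g\<^sup>2 * y ^ a * (nstat N x (i + 1) v * nstat N x (a - i) v) = y ^ 3 * (p N (i + 1) v * p N (a - i) v)"
      using y_nz by simp
  qed
  have 2: "?g\<^sup>2 * y ^ a * ((x * nstat N x a v - nstat N x (a - 1) v) / ?g) = y ^ 3 * (u * p N a v - p N (a - 1) v)"
  proof -
    have "?g\<^sup>2 * y ^ a * ((x * nstat N x a v - nstat N x (a - 1) v) / ?g) = x * (?g * y ^ a * nstat N x a v) - y * (?g * y ^ b * nstat N x b v)"
      using gnz by (simp add: b power2_eq_square field_simps)
    also have "\<dots> = y ^ 3 * (u * p N a v - p N (a - 1) v)"
      unfolding nstat_p[OF N] using y_nz by (simp add: b u_def power2_eq_square power3_eq_cube field_simps)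
    finally show ?thesis .
  qed
  show ?thesis
    unfolding lstat_def right_diff_distrib 1 2 by (simp add: algebra_simps)
qed

text \<open>Subtracts the leading-order equation \<open>om_convolution\<close>. The quadratic part
  is treated like a difference of squares: after reversing one sum, each \<open>Y\<close> is
  multiplied by a sum \<open>p + om\<close>. Keeping the random \<open>p\<close> there makes the
  equation linear in the top fluctuation \<open>Y N a\<close>.\<close>

lemma sum_p_om:
  assumes N: "N > 0" and a: "a > 0"
  shows "(\<Sum>i<a. p N (i + 1) v * p N (a - i) v) - u * p N a v + p N (a - 1) v =
    \<delta> N * ((\<Sum>i<a. Y N (i + 1) v * (p N (a - i) v + om u (a - i))) - u * Y N a v + Y N (a - 1) v)"
proof -
  have rev: "(\<Sum>i<a. om u (i + 1) * Y N (a - i) v) = (\<Sum>i<a. Y N (i + 1) v * om u (a - i))"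
  proof -
    have "(\<Sum>i<a. om u (i + 1) * Y N (a - i) v) = (\<Sum>i<a. om u (a - Suc i + 1) * Y N (a - (a - Suc i)) v)"
      by (subst sum.nat_diff_reindex[symmetric]) simp
    also have "\<dots> = (\<Sum>i<a. Y N (i + 1) v * om u (a - i))"
      by (intro sum.cong refl) (auto simp: Suc_diff_Suc)
    finally show ?thesis .
  qed
  have "p N (i + 1) v * p N (a - i) v = om u (i + 1) * om u (a - i) + \<delta> N * (Y N (i + 1) v * p N (a - i) v + om u (i + 1) * Y N (a - i) v)" for i
    unfolding p_Y[OF N] by (simp add: algebra_simps)
  then have "(\<Sum>i<a. p N (i + 1) v * p N (a - i) v) = (\<Sum>i<a. om u (i + 1) * om u (a - i))
      + \<delta> N * ((\<Sum>i<a. Y N (i + 1) v * p N (a - i) v) + (\<Sum>i<a. om u (i + 1) * Y N (a - i) v))"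
    by (simp only: sum.distrib sum_distrib_left distrib_left)
  also have "\<dots> = u * om u a - om u (a - 1) + \<delta> N * (\<Sum>i<a. Y N (i + 1) v * (p N (a - i) v + om u (a - i)))"
    unfolding rev om_convolution[OF a] by (simp add: sum.distrib distrib_left)
  finally show ?thesis
    unfolding p_Y[OF N, of a] p_Y[OF N, of "a - 1"] by (simp add: algebra_simps)
qed

lemma regular_Y: "regular N (Y N k)"
proof -
  have "regular N (\<lambda>v. (\<delta> N * of_real (sqrt \<kappa>) * y ^ k / \<delta> N) * pstat N x k v + (- om u k / \<delta> N))"
    by (intro regular_add regular_mult regular_const regular_pstat x)
  moreover have "Y N k = (\<lambda>v. (\<delta> N * of_real (sqrt \<kappa>) * y ^ k / \<delta> N) * pstat N x k v + (- om u k / \<delta> N))"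
    by (rule ext) (simp only: Y_def p_def diff_divide_distrib times_divide_eq_left diff_conv_add_uminus add_divide_distrib)
  ultimately show ?thesis by (simp only:)
qed

lemma moment_bounded_cong:
  assumes "moment_bounded X" "\<And>N. regular N (X' N)" "\<And>N v. N > 0 \<Longrightarrow> X N v = X' N v"
  shows "moment_bounded X'"
proof (rule moment_boundedI[OF assms(2)])
  fix q
  show "\<exists>C. \<forall>N>0. (\<integral>v. norm (X' N v) ^ q \<partial>gbe_law g \<kappa> N) \<le> C"
    using assms(1,3) unfolding moment_bounded_def by simp
qed

lemma Im_nstat_1: "Im (nstat N x 1 v) * Im x \<le> 0"
proof -
  have "Im (1 / (x - complex_of_real a)) * Im x \<le> 0" for a
  proof -
    have "Im (1 / (x - complex_of_real a)) * Im x = - (Im x * Im x) / ((Re x - a)\<^sup>2 + (Im x)\<^sup>2)"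
      by (simp add: Im_divide)
    also have "\<dots> \<le> 0" by (intro divide_nonpos_nonneg) auto
    finally show ?thesis .
  qed
  then have "(\<Sum>j<N. Im (1 / (x - complex_of_real (v j))) * Im x) \<le> 0" by (intro sum_nonpos)
  moreover have "Im (nstat N x 1 v) * Im x = (\<Sum>j<N. Im (1 / (x - complex_of_real (v j))) * Im x) / real N"
    by (simp add: nstat_def pstat_def sum_distrib_right)
  ultimately show ?thesis by (simp add: divide_nonpos_nonneg)
qed

text \<open>All three summands have imaginary parts of the same sign, by the choice of branch.\<close>

lemma pivot_bound: "norm (of_real g * nstat N x 1 v + (x - y) / 2 - x) \<ge> \<bar>Im x\<bar>"
proof -
  \<comment> \<open>This is \<open>g\<close> times the difference between
    \<open>nstat N x 1 v\<close> and \<open>(x + y) / (2 * g)\<close>, the second root mentioned in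
    the overview.\<close>
  let ?P = "of_real g * nstat N x 1 v + (x - y) / 2 - x"
  have "Im ?P * Im x = g * (Im (nstat N x 1 v) * Im x) + Im (x - y) * Im x / 2 - Im x * Im x"
    by (simp add: algebra_simps)
  also have "\<dots> \<le> - (Im x * Im x)"
    using mult_nonneg_nonpos[OF less_imp_le[OF g] Im_nstat_1[of N v]] branch by linarith
  finally have "\<bar>Im x\<bar> * \<bar>Im x\<bar> \<le> \<bar>Im ?P * Im x\<bar>"
    unfolding abs_mult_self_eq using abs_ge_minus_self[of "Im ?P * Im x"] by linarith
  then have "\<bar>Im x\<bar> * \<bar>Im x\<bar> \<le> \<bar>Im ?P\<bar> * \<bar>Im x\<bar>" unfolding abs_mult .
  then have "\<bar>Im x\<bar> \<le> \<bar>Im ?P\<bar>" by (rule mult_right_le_imp_le) (use x in simp)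
  also have "\<dots> \<le> norm ?P" by (rule abs_Im_le_cmod)
  finally show ?thesis .
qed

lemma moment_bounded_nstat: "moment_bounded (\<lambda>N v. nstat N x k v)"
proof (rule moment_bounded_uniform[where C = "(1 / \<bar>Im x\<bar>) ^ k"])
  show "regular N (nstat N x k)" for N
    unfolding nstat_def[abs_def] divide_inverse by (intro regular_mult regular_const regular_pstat x)
qed (rule norm_nstat_le[OF x])

text \<open>Solves \<open>sum_p_om\<close> for \<open>Y N a\<close>. Its coefficient
  \<open>p N 1 v + om u 1 - u\<close> is the quantity of \<open>pivot_bound\<close> divided by
  \<open>y\<close>, hence bounded away from 0. All else is either \<open>N * lstat\<close> or a
  \<open>Y\<close> of smaller index times a bounded statistic.\<close>

lemma moment_bounded_Y: "moment_bounded (\<lambda>N. Y N a)"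
proof (induction a rule: less_induct)
  case (less a)
  show ?case
  proof (cases "a = 0")
    case True
    show ?thesis
      by (rule moment_bounded_cong[OF moment_bounded_const[of 0] regular_Y]) (simp add: True Y_0)
  next
    case False
    then obtain b where b: "a = Suc b" by (cases a) auto
    let ?P = "\<lambda>N v. of_real g * nstat N x 1 v + (x - y) / 2 - x"
    \<comment> \<open>Equals \<open>p N k v\<close> for \<open>N > 0\<close>, written through
      \<open>nstat\<close> so that \<open>moment_bounded_nstat\<close> applies.\<close>
    let ?p = "\<lambda>N k v. of_real g * y ^ k / y\<^sup>2 * nstat N x k v"
    have Pnz: "?P N v \<noteq> 0" for N v
    proof -
      have "\<bar>Im x\<bar> > 0" using x by simp
      then have "norm (?P N v) > 0" using pivot_bound[of N v] by linarith
      then show ?thesis by simp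
    qed
    have rP: "regular N (\<lambda>v. 1 / ?P N v)" for N
      unfolding regular_def
    proof
      have [measurable]: "nstat N x 1 \<in> borel_measurable (lborel_pow N)"
        using moment_bounded_nstat[of 1] by (simp add: moment_bounded_def regular_def)
      show "(\<lambda>v. 1 / ?P N v) \<in> borel_measurable (lborel_pow N)" by measurable
      have "norm (1 / ?P N v) \<le> 1 / \<bar>Im x\<bar>" for v
        unfolding norm_divide norm_one using x by (intro frac_le pivot_bound) auto
      then show "bounded (range (\<lambda>v. 1 / ?P N v))" unfolding bounded_iff by blast
    qed
    have mP: "moment_bounded (\<lambda>N v. 1 / ?P N v)"
    proof (rule moment_bounded_uniform[where C = "1 / \<bar>Im x\<bar>", OF rP])
      show "norm (1 / ?P N v) \<le> 1 / \<bar>Im x\<bar>" for N v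
        unfolding norm_divide norm_one using x by (intro frac_le pivot_bound) auto
    qed
    have mb: "moment_bounded (\<lambda>N v. y * (1 / ?P N v) * ((of_real (sqrt \<kappa>) * of_real g * y ^ b) * (of_nat N * lstat g N x a v)
       + (-1) * ((\<Sum>i<b. Y N (i + 1) v * (?p N (a - i) v + om u (a - i))) + Y N b v)))"
      by (intro moment_bounded_mult moment_bounded_add moment_bounded_sum moment_bounded_const mP moment_bounded_lstat moment_bounded_nstat less)
        (auto simp: b)
    show ?thesis
    proof (rule moment_bounded_cong[OF mb regular_Y])
      fix N v assume N: "(N::nat) > 0"
      have pp: "?p N k v = p N k v" for k
        using nstat_p[OF N, of k v] y_nz by (simp add: field_simps)
      have y1: "y * (p N 1 v + om u 1 - u) = ?P N v"
        unfolding pp[of 1, symmetric] using y_nz by (simp add: u_def field_simps power2_eq_square)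
      have "(of_real g)\<^sup>2 * y ^ a * lstat g N x a v = y ^ 3 * (\<delta> N * ((\<Sum>i<a. Y N (i + 1) v * (p N (a - i) v + om u (a - i))) - u * Y N a v + Y N b v))"
        using lstat_p[OF N, of a v] sum_p_om[OF N, of a v] by (simp add: b)
      then have "of_nat N * of_real (sqrt \<kappa>) * ((of_real g)\<^sup>2 * y ^ a * lstat g N x a v) = of_nat N * of_real (sqrt \<kappa>) * (y ^ 3 * (\<delta> N * ((\<Sum>i<a. Y N (i + 1) v * (p N (a - i) v + om u (a - i))) - u * Y N a v + Y N b v)))"
        by simp
      also have "\<dots> = y * ((\<delta> N * of_real (sqrt \<kappa>) * of_nat N * y\<^sup>2) * ((\<Sum>i<a. Y N (i + 1) v * (p N (a - i) v + om u (a - i))) - u * Y N a v + Y N b v))"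
        by (simp only: power2_eq_square power3_eq_cube mult_ac)
      finally have "(of_real g * y) * (of_real (sqrt \<kappa>) * of_real g * y ^ b * (of_nat N * lstat g N x a v)) = (of_real g * y) * ((\<Sum>i<a. Y N (i + 1) v * (p N (a - i) v + om u (a - i))) - u * Y N a v + Y N b v)"
        unfolding \<delta>_N[OF N] by (simp only: b power2_eq_square power_Suc mult_ac)
      then have "of_real (sqrt \<kappa>) * of_real g * y ^ b * (of_nat N * lstat g N x a v) = (\<Sum>i<a. Y N (i + 1) v * (p N (a - i) v + om u (a - i))) - u * Y N a v + Y N b v"
        using g y_nz by simp
      also have "(\<Sum>i<a. Y N (i + 1) v * (p N (a - i) v + om u (a - i))) = (\<Sum>i<b. Y N (i + 1) v * (p N (a - i) v + om u (a - i))) + Y N a v * (p N 1 v + om u 1)"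
        by (simp add: b)
      finally have "of_real (sqrt \<kappa>) * of_real g * y ^ b * (of_nat N * lstat g N x a v) + (-1) * ((\<Sum>i<b. Y N (i + 1) v * (p N (a - i) v + om u (a - i))) + Y N b v) = (p N 1 v + om u 1 - u) * Y N a v"
        by (simp add: algebra_simps)
      then have "y * (1 / ?P N v) * ((of_real (sqrt \<kappa>) * of_real g * y ^ b) * (of_nat N * lstat g N x a v)
       + (-1) * ((\<Sum>i<b. Y N (i + 1) v * (p N (a - i) v + om u (a - i))) + Y N b v)) = (y * (p N 1 v + om u 1 - u)) * (1 / ?P N v) * Y N a v"
        by (simp only: mult_ac)
      also have "\<dots> = Y N a v" unfolding y1 using Pnz[of N v] by simp
      finally show "y * (1 / ?P N v) * ((of_real (sqrt \<kappa>) * of_real g * y ^ b) * (of_nat N * lstat g N x a v)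
       + (-1) * ((\<Sum>i<b. Y N (i + 1) v * (?p N (a - i) v + om u (a - i))) + Y N b v)) = Y N a v"
        unfolding pp .
    qed
  qed
qed

end

section \<open>Asymptotic expansion of the moments\<close>

lemma sum_list_picks: "(b, R) \<in> set (picks G) \<Longrightarrow> sum_list R \<le> (sum_list G :: nat)"
proof (induction G arbitrary: b R)
  case (Cons a G)
  then show ?case by (auto simp: le_Suc_eq)
qed simp

text \<open>\<open>coef u h l A\<close> is the coefficient of order \<open>l\<close> of the moment with index list \<open>A\<close>, read off from the loop
  equation for the head of \<open>A\<close>. Insertion keeps the lists sorted, so that few of them have to be evaluated.\<close>

function coef :: "complex \<Rightarrow> complex \<Rightarrow> nat \<Rightarrow> nat list \<Rightarrow> complex" where
  "coef u h l A = (case A of [] \<Rightarrow> if l = 0 then 1 else 0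
     | a # G \<Rightarrow> if a = 0 then 0 else
         coef u h l ((a - 1) # G)
         + (\<Sum>i\<leftarrow>[1..<a]. 2 * om u (a + 1 - i) * coef u h l (i # G))
         + (case l of 0 \<Rightarrow> 0 | Suc k \<Rightarrow> \<Sum>i\<leftarrow>[1..<a + 1]. coef u h k (insort i (insort (a + 1 - i) G)))
         - h * of_nat a * (om u (a + 1) * coef u h l G + (case l of 0 \<Rightarrow> 0 | Suc k \<Rightarrow> coef u h k (insort (a + 1) G)))
         + (\<Sum>(b, R)\<leftarrow>picks G. of_nat b * (om u (a + b + 1) * coef u h l R
              + (case l of 0 \<Rightarrow> 0 | Suc k \<Rightarrow> coef u h k (insort (a + b + 1) R)))))"
  by pat_completeness auto
termination
\<comment> \<open>Terms whose index sum may grow are taken at the previous order. All others keep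
  \<open>l\<close> and lower the index sum; for \<open>G\<close> and the lists from
  \<open>picks G\<close> this is so because the head \<open>a > 0\<close> is dropped.\<close>
proof (relation "measures [\<lambda>(u, h, l, A). l, \<lambda>(u, h, l, A). sum_list A]", goal_cases)
qed (auto dest: sum_list_picks)

declare coef.simps [simp del]

context gbe_branch
begin

definition ymon :: "nat \<Rightarrow> nat list \<Rightarrow> (nat \<Rightarrow> real) \<Rightarrow> complex" where
  "ymon N A v = (\<Prod>a\<leftarrow>A. Y N a v)"

lemma ymon_Nil [simp]: "ymon N [] v = 1"
  by (simp add: ymon_def)

lemma ymon_Cons [simp]: "ymon N (a # A) v = Y N a v * ymon N A v"
  by (simp add: ymon_def)

lemma ymon_insort [simp]: "ymon N (insort a A) v = Y N a v * ymon N A v"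
  by (induction A) (auto simp: mult_ac)

lemma moment_bounded_ymon: "moment_bounded (\<lambda>N. ymon N A)"
proof (induction A)
  case Nil
  have "moment_bounded (\<lambda>N v. 1)" by (rule moment_bounded_const)
  then show ?case by (simp add: ymon_def[abs_def])
next
  case (Cons a A)
  have "moment_bounded (\<lambda>N v. Y N a v * ymon N A v)"
    by (intro moment_bounded_mult moment_bounded_Y Cons)
  then show ?case by (simp add: ymon_def[abs_def])
qed

lemma regular_ymon: "regular N (ymon N A)"
  using moment_bounded_ymon[of A] by (simp add: moment_bounded_def)

text \<open>Along the power \<open>a\<close>, the power sum of index \<open>b\<close> has derivative
  \<open>b\<close> times the one of index \<open>a + b + 1\<close>, here split again into its limit
  and its fluctuation.\<close>

lemma vderiv_Y:
  assumes N: "N > 0"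
  shows "vderiv N (\<lambda>t. (1 / (x - complex_of_real t)) ^ a) (Y N b)
    (\<lambda>v. of_nat b * (om u (a + b + 1) + \<delta> N * Y N (a + b + 1) v) / (\<delta> N * y ^ (a + 1)))"
proof -
  let ?f = "\<lambda>t. (1 / (x - complex_of_real t)) ^ a"
  let ?c = "of_real (sqrt \<kappa>) * y ^ b"
  have "norm (?f t) \<le> (1 / \<bar>Im x\<bar>) ^ a" for t
    unfolding norm_power by (intro power_mono norm_inverse_diff_real_le x norm_ge_zero)
  then have bf: "bounded (range ?f)" unfolding bounded_iff by blast
  have fm: "?f \<in> borel_measurable borel" by measurable
  have "vderiv N ?f (\<lambda>v. ?c * pstat N x b v + (- om u b / \<delta> N))
    (\<lambda>v. ?c * (\<Sum>j<N. of_nat b * ?f (v j) * (1 / (x - complex_of_real (v j))) ^ (b + 1)) + 0)"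
    by (intro vderiv_add vderiv_cmult vderiv_const vderiv_pstat x bf fm)
  moreover have "(\<lambda>v. ?c * pstat N x b v + (- om u b / \<delta> N)) = Y N b"
    using \<delta>_nz[OF N] by (simp add: fun_eq_iff Y_def p_def diff_divide_distrib)
  moreover have "?c * (\<Sum>j<N. of_nat b * ?f (v j) * (1 / (x - complex_of_real (v j))) ^ (b + 1)) + 0
    = of_nat b * (om u (a + b + 1) + \<delta> N * Y N (a + b + 1) v) / (\<delta> N * y ^ (a + 1))" for v
  proof -
    have "(\<Sum>j<N. of_nat b * ?f (v j) * (1 / (x - complex_of_real (v j))) ^ (b + 1)) = of_nat b * pstat N x (a + b + 1) v"
      unfolding pstat_def sum_distrib_left by (intro sum.cong refl) (simp only: mult.assoc power_add[symmetric] add.assoc)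
    moreover have "om u (a + b + 1) + \<delta> N * Y N (a + b + 1) v = \<delta> N * y ^ (a + 1) * (?c * pstat N x (a + b + 1) v)"
      unfolding p_Y[OF N, symmetric] p_def by (simp add: power_add mult_ac)
    ultimately show ?thesis using \<delta>_nz[OF N] y_nz by simp
  qed
  ultimately show ?thesis by simp
qed

lemma vderiv_ymon:
  assumes N: "N > 0"
  shows "vderiv N (\<lambda>t. (1 / (x - complex_of_real t)) ^ a) (ymon N A)
    (\<lambda>v. \<Sum>(b, R)\<leftarrow>picks A. of_nat b * (om u (a + b + 1) + \<delta> N * Y N (a + b + 1) v) / (\<delta> N * y ^ (a + 1)) * ymon N R v)"
proof (induction A)
  case Nil
  then show ?case using vderiv_const[of N _ 1] by (simp add: ymon_def[abs_def])
next
  case (Cons c A)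
  let ?d = "\<lambda>b v. of_nat b * (om u (a + b + 1) + \<delta> N * Y N (a + b + 1) v) / (\<delta> N * y ^ (a + 1))"
  have "vderiv N (\<lambda>t. (1 / (x - complex_of_real t)) ^ a) (\<lambda>v. Y N c v * ymon N A v)
     (\<lambda>v. ?d c v * ymon N A v + Y N c v * (\<Sum>(b, R)\<leftarrow>picks A. ?d b v * ymon N R v))"
    by (intro vderiv_mult vderiv_Y N Cons)
  moreover have "(\<lambda>v. Y N c v * ymon N A v) = ymon N (c # A)" by (simp add: fun_eq_iff)
  moreover have "?d c v * ymon N A v + Y N c v * (\<Sum>(b, R)\<leftarrow>picks A. ?d b v * ymon N R v)
      = (\<Sum>(b, R)\<leftarrow>picks (c # A). ?d b v * ymon N R v)" for v
    by (simp add: sum_list_const_mult[symmetric] o_def case_prod_unfold mult_ac del: times_divide_eq_right times_divide_eq_left)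
  ultimately show ?case by simp
qed

definition M :: "nat list \<Rightarrow> nat \<Rightarrow> complex" where
  "M A N = mean N (ymon N A)"

text \<open>Exact for every \<open>N > 0\<close>. With \<open>p\<close> replaced by
  \<open>om + \<delta> * Y\<close>, the top term brings the coefficient
  \<open>2 * om u 1 = u - 1\<close>, which together with \<open>- u\<close> leaves exactly
  \<open>- 1\<close> in front of \<open>Y N a v\<close>. So the equation is solved for it without a
  division.\<close>

lemma loop_Y:
  assumes N: "N > 0" and a: "a > 0"
  shows "\<delta> N * of_real \<kappa> * (of_nat N)\<^sup>2 * y ^ (a + 1) * lstat g N x a v =
    (\<Sum>i\<leftarrow>[1..<a]. 2 * om u (a + 1 - i) * Y N i v) + \<delta> N * (\<Sum>i\<leftarrow>[1..<a + 1]. Y N i v * Y N (a + 1 - i) v)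
     - Y N a v + Y N (a - 1) v"
proof -
  have d2: "(\<delta> N)\<^sup>2 * of_real \<kappa> * (of_nat N)\<^sup>2 * y ^ 4 = (of_real g)\<^sup>2"
  proof -
    have "(\<delta> N)\<^sup>2 * of_real \<kappa> * (of_nat N)\<^sup>2 * y ^ 4 = (\<delta> N * of_real (sqrt \<kappa>) * of_nat N * y\<^sup>2)\<^sup>2"
      unfolding sqrt_\<kappa>_sq[symmetric] by (simp add: power_mult_distrib)
    then show ?thesis unfolding \<delta>_N[OF N] .
  qed
  let ?S = "(\<Sum>i<a. Y N (i + 1) v * (p N (a - i) v + om u (a - i))) - u * Y N a v + Y N (a - 1) v"
  have "(\<delta> N * y ^ 3) * (\<delta> N * of_real \<kappa> * (of_nat N)\<^sup>2 * y ^ (a + 1) * lstat g N x a v) =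
      ((\<delta> N)\<^sup>2 * of_real \<kappa> * (of_nat N)\<^sup>2 * y ^ 4) * y ^ a * lstat g N x a v"
    by (simp add: power2_eq_square power3_eq_cube power4_eq_xxxx mult_ac)
  also have "\<dots> = (\<delta> N * y ^ 3) * ?S"
    unfolding d2 lstat_p[OF N a] sum_p_om[OF N a] by (simp add: mult_ac)
  finally have 1: "\<delta> N * of_real \<kappa> * (of_nat N)\<^sup>2 * y ^ (a + 1) * lstat g N x a v = ?S"
    using \<delta>_nz[OF N] y_nz by simp
  obtain b where b: "a = Suc b" using a by (cases a) auto
  have r: "(\<Sum>i\<leftarrow>[1..<n + 1]. F i) = (\<Sum>i<n. F (i + 1))" for F :: "nat \<Rightarrow> complex" and n
    by (simp add: interv_sum_list_conv_sum_set_nat sum.reindex_bij_witness[of "{1..<n + 1}" "\<lambda>i. i + 1" "\<lambda>i. i - 1" "{..<n}"] flip: atLeast0LessThan sum.shift_bounds_Suc_ivl)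
  have "(\<Sum>i<a. Y N (i + 1) v * (p N (a - i) v + om u (a - i))) =
     (\<Sum>i<a. 2 * om u (a - i) * Y N (i + 1) v) + \<delta> N * (\<Sum>i<a. Y N (i + 1) v * Y N (a - i) v)"
    unfolding p_Y[OF N] sum_distrib_left sum.distrib[symmetric] by (intro sum.cong refl) (simp add: algebra_simps)
  also have "(\<Sum>i<a. 2 * om u (a - i) * Y N (i + 1) v) = (\<Sum>i<b. 2 * om u (a - i) * Y N (i + 1) v) + (u - 1) * Y N a v"
    by (simp add: b)
  also have "(\<Sum>i<b. 2 * om u (a - i) * Y N (i + 1) v) = (\<Sum>i\<leftarrow>[1..<b + 1]. 2 * om u (a + 1 - i) * Y N i v)"
    unfolding r by simp
  also have "(\<Sum>i<a. Y N (i + 1) v * Y N (a - i) v) = (\<Sum>i\<leftarrow>[1..<a + 1]. Y N i v * Y N (a + 1 - i) v)"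
    unfolding r by simp
  finally have 2: "(\<Sum>i<a. Y N (i + 1) v * (p N (a - i) v + om u (a - i))) =
     (\<Sum>i\<leftarrow>[1..<a]. 2 * om u (a + 1 - i) * Y N i v) + (u - 1) * Y N a v + \<delta> N * (\<Sum>i\<leftarrow>[1..<a + 1]. Y N i v * Y N (a + 1 - i) v)"
    by (simp add: b)
  show ?thesis unfolding 1 2 by (simp add: algebra_simps)
qed

lemma mean_sum_list:
  "(\<And>i. i \<in> set xs \<Longrightarrow> regular N (F i)) \<Longrightarrow> regular N (\<lambda>v. \<Sum>i\<leftarrow>xs. F i v) \<and> mean N (\<lambda>v. \<Sum>i\<leftarrow>xs. F i v) = (\<Sum>i\<leftarrow>xs. mean N (F i))"
  by (induction xs) (auto simp: regular_const mean_add intro: regular_add)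

text \<open>The loop equation tested against \<open>ymon N G\<close>; the recursion of
  \<open>coef\<close> is its termwise image. The sum over \<open>picks G\<close> is the derivative
  of the test function, and \<open>h\<close> enters through
  \<open>1 - \<kappa> = - h * sqrt \<kappa>\<close>. Terms without \<open>\<delta> N\<close> have a
  smaller index sum than \<open>a # G\<close>.\<close>

lemma M_loop:
  assumes N: "N > 0" and a: "a > 0"
  shows "M (a # G) N = M ((a - 1) # G) N
     + (\<Sum>i\<leftarrow>[1..<a]. 2 * om u (a + 1 - i) * M (i # G) N)
     + \<delta> N * (\<Sum>i\<leftarrow>[1..<a + 1]. M (insort i (insort (a + 1 - i) G)) N)
     - h * of_nat a * (om u (a + 1) * M G N + \<delta> N * M (insort (a + 1) G) N)
     + (\<Sum>(b, R)\<leftarrow>picks G. of_nat b * (om u (a + b + 1) * M R N + \<delta> N * M (insort (a + b + 1) R) N))"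
proof -
  let ?m = "\<lambda>A. ymon N A"
  have dy: "\<delta> N * y ^ (a + 1) \<noteq> 0" using \<delta>_nz[OF N] y_nz by simp
  let ?L = "\<lambda>v. of_real \<kappa> * (of_nat N)\<^sup>2 * lstat g N x a v + of_nat a * (1 - of_real \<kappa>) * pstat N x (a + 1) v"
  let ?D = "\<lambda>v. \<Sum>(b, R)\<leftarrow>picks G. of_nat b * (om u (a + b + 1) + \<delta> N * Y N (a + b + 1) v) / (\<delta> N * y ^ (a + 1)) * ?m R v"
  let ?s1 = "\<lambda>v. \<Sum>i\<leftarrow>[1..<a]. 2 * om u (a + 1 - i) * ?m (i # G) v"
  let ?s2 = "\<lambda>v. \<Sum>i\<leftarrow>[1..<a + 1]. ?m (insort i (insort (a + 1 - i) G)) v"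
  let ?s3 = "\<lambda>v. \<Sum>(b, R)\<leftarrow>picks G. of_nat b * (om u (a + b + 1) * ?m R v + \<delta> N * ?m (insort (a + b + 1) R) v)"
  have pp: "\<delta> N * y ^ (a + 1) * (of_nat a * (1 - of_real \<kappa>) * pstat N x (a + 1) v) = - h * of_nat a * (om u (a + 1) + \<delta> N * Y N (a + 1) v)" for v
  proof -
    have k: "1 - of_real \<kappa> = - h * of_real (sqrt \<kappa>)" using h_eq by (simp add: algebra_simps)
    show ?thesis unfolding p_Y[OF N, symmetric] p_def k by (simp add: mult_ac)
  qed
  have "mean N (\<lambda>v. ?L v * ?m G v + ?D v) = 0"
    by (rule mean_loop_equation[OF N a vderiv_ymon[OF N]])
  then have "0 = mean N (\<lambda>v. \<delta> N * y ^ (a + 1) * (?L v * ?m G v + ?D v))" by (simp add: mean_cmult)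
  also have "\<dots> = mean N (\<lambda>v. (-1) * ?m (a # G) v + (?m ((a - 1) # G) v + (?s1 v + (\<delta> N * ?s2 v
      + ((- h * of_nat a) * (om u (a + 1) * ?m G v + \<delta> N * ?m (insort (a + 1) G) v) + ?s3 v)))))"
  proof (rule arg_cong[where f = "mean N"], rule ext)
    fix v
    have D: "\<delta> N * y ^ (a + 1) * ?D v = ?s3 v"
      unfolding sum_list_const_mult[symmetric]
    proof (intro arg_cong[where f = sum_list] map_cong refl)
      fix bR
      have e: "c * (n * (o' + d * Yv) / c * m) = n * (o' * m + d * (Yv * m))" if "c \<noteq> 0" for c n o' d Yv m :: complex
        using that by (simp add: field_simps)
      show "\<delta> N * y ^ (a + 1) * (case bR of (b, R) \<Rightarrow> of_nat b * (om u (a + b + 1) + \<delta> N * Y N (a + b + 1) v) / (\<delta> N * y ^ (a + 1)) * ?m R v)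
        = (case bR of (b, R) \<Rightarrow> of_nat b * (om u (a + b + 1) * ?m R v + \<delta> N * ?m (insort (a + b + 1) R) v))"
        by (cases bR) (simp only: prod.case ymon_insort e[OF dy])
    qed
    have s1: "?s1 v = (\<Sum>i\<leftarrow>[1..<a]. 2 * om u (a + 1 - i) * Y N i v) * ?m G v"
      unfolding sum_list_mult_const[symmetric] by (simp add: mult.assoc)
    have s2: "?s2 v = (\<Sum>i\<leftarrow>[1..<a + 1]. Y N i v * Y N (a + 1 - i) v) * ?m G v"
      unfolding sum_list_mult_const[symmetric] by (simp add: mult.assoc)
    have "\<delta> N * y ^ (a + 1) * (?L v * ?m G v + ?D v) =
       (\<delta> N * of_real \<kappa> * (of_nat N)\<^sup>2 * y ^ (a + 1) * lstat g N x a v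
        + \<delta> N * y ^ (a + 1) * (of_nat a * (1 - of_real \<kappa>) * pstat N x (a + 1) v)) * ?m G v + \<delta> N * y ^ (a + 1) * ?D v"
      by (simp only: distrib_left distrib_right mult_ac)
    also have "\<dots> = (-1) * ?m (a # G) v + (?m ((a - 1) # G) v + (?s1 v + (\<delta> N * ?s2 v
      + ((- h * of_nat a) * (om u (a + 1) * ?m G v + \<delta> N * ?m (insort (a + 1) G) v) + ?s3 v))))"
    proof -
      have e: "(t1 + d * t2 - Ya + Yb + k * (o' + d * Yc)) * m + t3 = (-1) * (Ya * m) + (Yb * m + (t1 * m + (d * (t2 * m) + (k * (o' * m + d * (Yc * m)) + t3))))"
        for t1 t2 t3 d Ya Yb Yc k o' m :: complex by (simp add: algebra_simps)
      show ?thesis unfolding D pp loop_Y[OF N a] s1 s2 unfolding ymon_Cons ymon_insort by (rule e)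
    qed
    finally show "\<delta> N * y ^ (a + 1) * (?L v * ?m G v + ?D v) = (-1) * ?m (a # G) v + (?m ((a - 1) # G) v + (?s1 v + (\<delta> N * ?s2 v
      + ((- h * of_nat a) * (om u (a + 1) * ?m G v + \<delta> N * ?m (insort (a + 1) G) v) + ?s3 v))))" .
  qed
  also have "\<dots> = (-1) * M (a # G) N + (M ((a - 1) # G) N + ((\<Sum>i\<leftarrow>[1..<a]. 2 * om u (a + 1 - i) * M (i # G) N)
     + (\<delta> N * (\<Sum>i\<leftarrow>[1..<a + 1]. M (insort i (insort (a + 1 - i) G)) N)
     + ((- h * of_nat a) * (om u (a + 1) * M G N + \<delta> N * M (insort (a + 1) G) N)
     + (\<Sum>(b, R)\<leftarrow>picks G. of_nat b * (om u (a + b + 1) * M R N + \<delta> N * M (insort (a + b + 1) R) N))))))"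
  proof -
    have r1: "regular N ?s1 \<and> mean N ?s1 = (\<Sum>i\<leftarrow>[1..<a]. 2 * om u (a + 1 - i) * M (i # G) N)"
      using mean_sum_list[of "[1..<a]" N "\<lambda>i v. 2 * om u (a + 1 - i) * ?m (i # G) v", OF regular_mult[OF regular_const regular_ymon]]
      unfolding mean_cmult M_def .
    have r2: "regular N ?s2 \<and> mean N ?s2 = (\<Sum>i\<leftarrow>[1..<a + 1]. M (insort i (insort (a + 1 - i) G)) N)"
      using mean_sum_list[of "[1..<a + 1]" N "\<lambda>i. ?m (insort i (insort (a + 1 - i) G))", OF regular_ymon]
      unfolding M_def .
    have r3: "regular N ?s3 \<and> mean N ?s3 = (\<Sum>(b, R)\<leftarrow>picks G. of_nat b * (om u (a + b + 1) * M R N + \<delta> N * M (insort (a + b + 1) R) N))"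
    proof -
      let ?F = "\<lambda>bR v. of_nat (fst bR) * (om u (a + fst bR + 1) * ?m (snd bR) v + \<delta> N * ?m (insort (a + fst bR + 1) (snd bR)) v)"
      have F: "regular N (?F bR)" for bR by (intro regular_mult regular_add regular_const regular_ymon)
      have Fm: "mean N (?F bR) = of_nat (fst bR) * (om u (a + fst bR + 1) * M (snd bR) N + \<delta> N * M (insort (a + fst bR + 1) (snd bR)) N)" for bR
        unfolding mean_cmult M_def
        using mean_add[OF regular_mult[OF regular_const regular_ymon] regular_mult[OF regular_const regular_ymon]]
        by (simp only: mean_cmult)
      show ?thesis
        using mean_sum_list[of "picks G" N ?F] F Fm by (simp add: case_prod_unfold)
    qed
    have r4: "regular N (\<lambda>v. om u (a + 1) * ?m G v + \<delta> N * ?m (insort (a + 1) G) v)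
       \<and> mean N (\<lambda>v. om u (a + 1) * ?m G v + \<delta> N * ?m (insort (a + 1) G) v) = om u (a + 1) * M G N + \<delta> N * M (insort (a + 1) G) N"
      using mean_add[OF regular_mult[OF regular_const regular_ymon] regular_mult[OF regular_const regular_ymon], of N "om u (a + 1)" G "\<delta> N" "insort (a + 1) G"]
      unfolding M_def mean_cmult by (rule conjI[rotated]) (intro regular_add regular_mult regular_const regular_ymon)
    have mean6: "mean N (\<lambda>v. F1 v + (F2 v + (F3 v + (F4 v + (F5 v + F6 v))))) = mean N F1 + (mean N F2 + (mean N F3 + (mean N F4 + (mean N F5 + mean N F6))))"
      if "regular N F1" "regular N F2" "regular N F3" "regular N F4" "regular N F5" "regular N F6" for F1 F2 F3 F4 F5 F6
      using that by (simp add: mean_add regular_add)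
    note c = regular_mult[OF regular_const]
    show ?thesis
      by (rule trans[OF mean6[OF c[OF regular_ymon] regular_ymon conjunct1[OF r1] c[OF conjunct1[OF r2]] c[OF conjunct1[OF r4]] conjunct1[OF r3]]])
        (simp only: mean_cmult conjunct2[OF r1] conjunct2[OF r2] conjunct2[OF r3] conjunct2[OF r4] M_def)
  qed
  finally show ?thesis by (simp add: algebra_simps)
qed

text \<open>\<open>L\<close> counts the retained terms, so that \<open>L = 0\<close> says only that
  \<open>F\<close> is bounded as \<open>N\<close> grows, which is what the moment bounds
  provide.\<close>

definition expands :: "nat \<Rightarrow> (nat \<Rightarrow> complex) \<Rightarrow> (nat \<Rightarrow> complex) \<Rightarrow> bool" where
  "expands L F c \<longleftrightarrow> (\<lambda>N. F N - (\<Sum>l<L. c l * \<delta> N ^ l)) \<in> O(\<lambda>N. \<delta> N ^ L)"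

lemma expands_cong:
  assumes "expands L F c" "\<And>N. N > 0 \<Longrightarrow> F N = F' N" "\<And>l. l < L \<Longrightarrow> c l = c' l"
  shows "expands L F' c'"
proof -
  have "(\<Sum>l<L. c l * \<delta> N ^ l) = (\<Sum>l<L. c' l * \<delta> N ^ l)" for N using assms(3) by (intro sum.cong) auto
  moreover have "\<forall>\<^sub>F N in sequentially. F N - (\<Sum>l<L. c' l * \<delta> N ^ l) = F' N - (\<Sum>l<L. c' l * \<delta> N ^ l)"
    using assms(2) by (intro eventually_sequentiallyI[of 1]) auto
  then have "(\<lambda>N. F N - (\<Sum>l<L. c' l * \<delta> N ^ l)) \<in> O(\<lambda>N. \<delta> N ^ L) \<longleftrightarrow> (\<lambda>N. F' N - (\<Sum>l<L. c' l * \<delta> N ^ l)) \<in> O(\<lambda>N. \<delta> N ^ L)"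
    by (rule landau_o.big.in_cong)
  ultimately show ?thesis
    using assms(1) unfolding expands_def by simp
qed

lemma expands_0: "expands L (\<lambda>N. 0) (\<lambda>l. 0)"
  by (simp add: expands_def)

lemma expands_add:
  assumes "expands L F c" "expands L F' c'"
  shows "expands L (\<lambda>N. F N + F' N) (\<lambda>l. c l + c' l)"
proof -
  have "(\<lambda>N. (F N - (\<Sum>l<L. c l * \<delta> N ^ l)) + (F' N - (\<Sum>l<L. c' l * \<delta> N ^ l))) \<in> O(\<lambda>N. \<delta> N ^ L)"
    using assms unfolding expands_def by (rule sum_in_bigo)
  then show ?thesis unfolding expands_def by (simp add: distrib_right sum.distrib algebra_simps)
qed

lemma expands_cmult:
  assumes "expands L F c"
  shows "expands L (\<lambda>N. k * F N) (\<lambda>l. k * c l)"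
proof -
  have "(\<lambda>N. k * (F N - (\<Sum>l<L. c l * \<delta> N ^ l))) \<in> O(\<lambda>N. \<delta> N ^ L)"
  proof -
    have "(\<lambda>N. k * (F N - (\<Sum>l<L. c l * \<delta> N ^ l))) \<in> O(\<lambda>N. 1 * \<delta> N ^ L)"
      using assms unfolding expands_def by (intro landau_o.big.mult) auto
    then show ?thesis by simp
  qed
  then show ?thesis unfolding expands_def by (simp add: right_diff_distrib sum_distrib_left mult.assoc)
qed

lemma expands_sum_list:
  assumes "\<And>i. i \<in> set xs \<Longrightarrow> expands L (F i) (c i)"
  shows "expands L (\<lambda>N. \<Sum>i\<leftarrow>xs. F i N) (\<lambda>l. \<Sum>i\<leftarrow>xs. c i l)"
  using assms by (induction xs) (auto intro: expands_0 expands_add)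

lemma expands_\<delta>:
  assumes "expands L F c"
  shows "expands (Suc L) (\<lambda>N. \<delta> N * F N) (\<lambda>l. case l of 0 \<Rightarrow> 0 | Suc k \<Rightarrow> c k)"
proof -
  have "(\<lambda>N. \<delta> N * (F N - (\<Sum>l<L. c l * \<delta> N ^ l))) \<in> O(\<lambda>N. \<delta> N * \<delta> N ^ L)"
    using assms unfolding expands_def by (intro landau_o.big.mult) auto
  moreover have "(\<Sum>l<Suc L. (case l of 0 \<Rightarrow> 0 | Suc k \<Rightarrow> c k) * \<delta> N ^ l) = \<delta> N * (\<Sum>l<L. c l * \<delta> N ^ l)" for N
    unfolding sum.lessThan_Suc_shift by (simp add: sum_distrib_left mult_ac)
  ultimately show ?thesis unfolding expands_def by (simp add: right_diff_distrib)
qed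

text \<open>In \<open>M_loop\<close>, the terms with a factor \<open>\<delta> N\<close> are covered
  by the outer hypothesis, raised by one order through \<open>expands_\<delta>\<close>; the others
  have a smaller index sum and fall under the inner one.\<close>

theorem M_expands: "expands L (M A) (\<lambda>l. coef u h l A)"
proof (induction L arbitrary: A)
  case 0
  show ?case using moment_bounded_mean[OF moment_bounded_ymon[of A]] by (simp add: expands_def M_def[abs_def])
next
  case (Suc L)
  show ?case
  proof (induction "sum_list A" arbitrary: A rule: less_induct)
    case less
    show ?case
    proof (cases A)
      case Nil
      have "M [] N = 1" for N using mean_const[of N 1] by (simp add: M_def ymon_def[abs_def])
      moreover have "(\<Sum>l<Suc L. coef u h l [] * \<delta> N ^ l) = 1" for N
        unfolding sum.lessThan_Suc_shift by (simp add: coef.simps)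
      ultimately show ?thesis by (simp add: Nil expands_def)
    next
      case (Cons a G)
      show ?thesis
      proof (cases "a = 0")
        case True
        have "M A N = 0" if "N > 0" for N
        proof -
          have "ymon N A = (\<lambda>v. 0)" using Y_0[OF that] by (simp add: fun_eq_iff Cons True)
          then show ?thesis by (simp add: M_def)
        qed
        then show ?thesis
          by (intro expands_cong[OF expands_0]) (auto simp: Cons True coef.simps)
      next
        case False
        then have a: "a > 0" by simp
        have sm: "expands (Suc L) (M B) (\<lambda>l. coef u h l B)" if "sum_list B < sum_list A" for B
          using less that by blast
        have e1: "expands (Suc L) (M ((a - 1) # G)) (\<lambda>l. coef u h l ((a - 1) # G))"
          using a by (intro sm) (simp add: Cons)
        have e2: "expands (Suc L) (\<lambda>N. \<Sum>i\<leftarrow>[1..<a]. 2 * om u (a + 1 - i) * M (i # G) N) (\<lambda>l. \<Sum>i\<leftarrow>[1..<a]. 2 * om u (a + 1 - i) * coef u h l (i # G))"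
          by (intro expands_sum_list expands_cmult sm) (auto simp: Cons)
        have e3: "expands (Suc L) (\<lambda>N. \<delta> N * (\<Sum>i\<leftarrow>[1..<a + 1]. M (insort i (insort (a + 1 - i) G)) N))
            (\<lambda>l. case l of 0 \<Rightarrow> 0 | Suc k \<Rightarrow> \<Sum>i\<leftarrow>[1..<a + 1]. coef u h k (insort i (insort (a + 1 - i) G)))"
          by (intro expands_\<delta> expands_sum_list Suc)
        have e4: "expands (Suc L) (\<lambda>N. (- h * of_nat a) * (om u (a + 1) * M G N + \<delta> N * M (insort (a + 1) G) N))
            (\<lambda>l. (- h * of_nat a) * (om u (a + 1) * coef u h l G + (case l of 0 \<Rightarrow> 0 | Suc k \<Rightarrow> coef u h k (insort (a + 1) G))))"
          using a by (intro expands_cmult expands_add expands_\<delta> Suc sm) (simp add: Cons)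
        have e5: "expands (Suc L) (\<lambda>N. \<Sum>bR\<leftarrow>picks G. of_nat (fst bR) * (om u (a + fst bR + 1) * M (snd bR) N + \<delta> N * M (insort (a + fst bR + 1) (snd bR)) N))
           (\<lambda>l. \<Sum>bR\<leftarrow>picks G. of_nat (fst bR) * (om u (a + fst bR + 1) * coef u h l (snd bR)
              + (case l of 0 \<Rightarrow> 0 | Suc k \<Rightarrow> coef u h k (insort (a + fst bR + 1) (snd bR)))))"
        proof (intro expands_sum_list expands_cmult expands_add expands_\<delta> Suc sm)
          fix bR assume "bR \<in> set (picks G)"
          then show "sum_list (snd bR) < sum_list A"
            using sum_list_picks[of "fst bR" "snd bR" G] a by (simp add: Cons)
        qed
        show ?thesis
          by (rule expands_cong[OF expands_add[OF expands_add[OF expands_add[OF expands_add[OF e1 e2] e3] e4] e5]])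
            (use False in \<open>auto simp: Cons M_loop[OF _ a] coef.simps[of u h _ "a # G"] case_prod_unfold\<close>)
      qed
    qed
  qed
qed

end

section \<open>Values of the coefficients\<close>

lemma om_recs:
  "om u 2 = om u 1"
  "om u 3 = om u 2 + om u 2 * om u 2"
  "om u 4 = om u 3 + 2 * (om u 2 * om u 3)"
  "om u 5 = om u 4 + 2 * (om u 2 * om u 4) + om u 3 * om u 3"
  "om u 6 = om u 5 + 2 * (om u 2 * om u 5) + 2 * (om u 3 * om u 4)"
  "om u 7 = om u 6 + 2 * (om u 2 * om u 6) + 2 * (om u 3 * om u 5) + om u 4 * om u 4"
proof -
  show "om u 2 = om u 1"
    using om.simps(3)[of u 0] by (simp add: eval_nat_numeral del: om.simps)
  show "om u 3 = om u 2 + om u 2 * om u 2"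
    using om.simps(3)[of u 1] by (simp add: eval_nat_numeral del: om.simps)
  show "om u 4 = om u 3 + 2 * (om u 2 * om u 3)"
    using om.simps(3)[of u 2] by (simp add: eval_nat_numeral del: om.simps)
  show "om u 5 = om u 4 + 2 * (om u 2 * om u 4) + om u 3 * om u 3"
    using om.simps(3)[of u 3] by (simp add: eval_nat_numeral del: om.simps)
  show "om u 6 = om u 5 + 2 * (om u 2 * om u 5) + 2 * (om u 3 * om u 4)"
    using om.simps(3)[of u 4] by (simp add: eval_nat_numeral del: om.simps)
  show "om u 7 = om u 6 + 2 * (om u 2 * om u 6) + 2 * (om u 3 * om u 5) + om u 4 * om u 4"
    using om.simps(3)[of u 5] by (simp add: eval_nat_numeral del: om.simps)
qed

text \<open>Index 7 is the largest that \<open>coef u h 5 [1]\<close> meets: its index sums stay at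
  or below 6, and \<open>om\<close> is taken at an index at most one above them.\<close>

lemma om_values [simp]:
  "om u 1 = (u - 1) / 2"
  "om u 2 = (u - 1) / 2"
  "om u 3 = (u^2 - 1) / 4"
  "om u 4 = (u^3 - u) / 4"
  "om u 5 = (5*u^4 - 6*u^2 + 1) / 16"
  "om u 6 = (7*u^5 - 10*u^3 + 3*u) / 16"
  "om u 7 = (21*u^6 - 35*u^4 + 15*u^2 - 1) / 32"
proof -
  show 1: "om u 1 = (u - 1) / 2"
    by simp
  show 2: "om u 2 = (u - 1) / 2"
    unfolding om_recs(1) 1 by (simp add: field_simps power2_eq_square, algebra?)
  show 3: "om u 3 = (u^2 - 1) / 4"
    unfolding om_recs(2) 1 2 by (simp add: field_simps power2_eq_square, algebra?)
  show 4: "om u 4 = (u^3 - u) / 4"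
    unfolding om_recs(3) 1 2 3 by (simp add: field_simps power2_eq_square, algebra?)
  show 5: "om u 5 = (5*u^4 - 6*u^2 + 1) / 16"
    unfolding om_recs(4) 1 2 3 4 by (simp add: field_simps power2_eq_square, algebra?)
  show 6: "om u 6 = (7*u^5 - 10*u^3 + 3*u) / 16"
    unfolding om_recs(5) 1 2 3 4 5 by (simp add: field_simps power2_eq_square, algebra?)
  show 7: "om u 7 = (21*u^6 - 35*u^4 + 15*u^2 - 1) / 32"
    unfolding om_recs(6) 1 2 3 4 5 6 by (simp add: field_simps power2_eq_square, algebra?)
qed

lemma coef_Nil [simp]: "coef u h l [] = (if l = 0 then 1 else 0)"
  by (simp add: coef.simps)

lemma coef_Cons_0 [simp]: "coef u h l (0 # G) = 0"
  by (simp add: coef.simps)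

text \<open>The numeral \<open>1\<close> is kept in place of \<open>Suc 0\<close>, so that the argument lists below are matched literally.\<close>

lemma upt_values:
  "[1..<2] = [1]"
  "[1..<3] = [1, 2]"
  "[1..<4] = [1, 2, 3]"
  "[1..<5] = [1, 2, 3, 4]"
  "[1..<6] = [1, 2, 3, 4, 5]"
  "[1..<7] = [1, 2, 3, 4, 5, 6]"
  by (simp_all add: upt_rec)

lemma case_nat_1: "(case 1 of 0 \<Rightarrow> a | Suc k \<Rightarrow> f k) = f 0"
  by (simp add: One_nat_def)

context
  notes One_nat_def [simp del] One_nat_def [symmetric, simp] upt_values [simp] case_nat_1 [simp]
begin

text \<open>Lowering the order by one raises the index sum by at most one. Hence
  \<open>coef u h 5 [1]\<close> needs only the sorted lists whose index sum plus order is at most 6,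
  and exactly these are tabulated. Order and then index sum increase down the table, so each
  unfolding meets only values already known to the simplifier. The entries for \<open>[1]\<close>
  are those used for the resolvent.\<close>

lemma coef_0_1 [simp]:
  "coef u h 0 [1] = (h*(- (u) + 1)) / 2"
  by (subst coef.simps) (simp add: field_simps, algebra?)

lemma coef_0_11 [simp]:
  "coef u h 0 [1, 1] = (h^2*(u^2 - 2*u + 1) + (u^2 - 1)) / 4"
  by (subst coef.simps) (simp add: field_simps, algebra?)

lemma coef_0_2 [simp]:
  "coef u h 0 [2] = (h*(- (2*u^2) + u + 1)) / 2"
  by (subst coef.simps) (simp add: field_simps, algebra?)

lemma coef_0_111 [simp]:
  "coef u h 0 [1, 1, 1] = (h^3*(- (u^3) + 3*u^2 - 3*u + 1) + h*(- (3*u^3) + 3*u^2 + 3*u - 3)) / 8"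
  by (subst coef.simps) (simp add: field_simps, algebra?)

lemma coef_0_12 [simp]:
  "coef u h 0 [1, 2] = (h^2*(2*u^3 - 3*u^2 + 1) + (2*u^3 - 2*u)) / 4"
  by (subst coef.simps) (simp add: field_simps, algebra?)

lemma coef_0_3 [simp]:
  "coef u h 0 [3] = (h*(- (8*u^3) + 3*u^2 + 6*u - 1)) / 4"
  by (subst coef.simps) (simp add: field_simps, algebra?)

lemma coef_0_1111 [simp]:
  "coef u h 0 [1, 1, 1, 1] = (h^4*(u^4 - 4*u^3 + 6*u^2 - 4*u + 1) + h^2*(6*u^4 - 12*u^3 + 12*u - 6) + (3*u^4 - 6*u^2 + 3)) / 16"
  by (subst coef.simps) (simp add: field_simps, algebra?)

lemma coef_0_112 [simp]:
  "coef u h 0 [1, 1, 2] = (h^3*(- (2*u^4) + 5*u^3 - 3*u^2 - u + 1) + h*(- (6*u^4) + 5*u^3 + 7*u^2 - 5*u - 1)) / 8"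
  by (subst coef.simps) (simp add: field_simps, algebra?)

lemma coef_0_13 [simp]:
  "coef u h 0 [1, 3] = (h^2*(16*u^4 - 22*u^3 - 6*u^2 + 14*u - 2) + (15*u^4 - 18*u^2 + 3)) / 16"
  by (subst coef.simps) (simp add: field_simps, algebra?)

lemma coef_0_22 [simp]:
  "coef u h 0 [2, 2] = (h^2*(8*u^4 - 8*u^3 - 6*u^2 + 4*u + 2) + (9*u^4 - 10*u^2 + 1)) / 8"
  by (subst coef.simps) (simp add: field_simps, algebra?)

lemma coef_0_4 [simp]:
  "coef u h 0 [4] = (h*(- (16*u^4) + 5*u^3 + 16*u^2 - 3*u - 2)) / 4"
  by (subst coef.simps) (simp add: field_simps, algebra?)

lemma coef_0_11111 [simp]:
  "coef u h 0 [1, 1, 1, 1, 1] = (h^5*(- (u^5) + 5*u^4 - 10*u^3 + 10*u^2 - 5*u + 1)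
    + h^3*(- (10*u^5) + 30*u^4 - 20*u^3 - 20*u^2 + 30*u - 10)
    + h*(- (15*u^5) + 15*u^4 + 30*u^3 - 30*u^2 - 15*u + 15)) / 32"
  by (subst coef.simps) (simp add: field_simps, algebra?)

lemma coef_0_1112 [simp]:
  "coef u h 0 [1, 1, 1, 2] = (h^4*(2*u^5 - 7*u^4 + 8*u^3 - 2*u^2 - 2*u + 1)
    + h^2*(12*u^5 - 21*u^4 - 6*u^3 + 24*u^2 - 6*u - 3)
    + (6*u^5 - 12*u^3 + 6*u)) / 16"
  by (subst coef.simps) (simp add: field_simps, algebra?)

lemma coef_0_113 [simp]:
  "coef u h 0 [1, 1, 3] = (h^3*(- (8*u^5) + 19*u^4 - 8*u^3 - 10*u^2 + 8*u - 1)
    + h*(- (23*u^5) + 18*u^4 + 32*u^3 - 22*u^2 - 9*u + 4)) / 16"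
  by (subst coef.simps) (simp add: field_simps, algebra?)

lemma coef_0_122 [simp]:
  "coef u h 0 [1, 2, 2] = (h^3*(- (8*u^5) + 16*u^4 - 2*u^3 - 10*u^2 + 2*u + 2)
    + h*(- (25*u^5) + 17*u^4 + 34*u^3 - 18*u^2 - 9*u + 1)) / 16"
  by (subst coef.simps) (simp add: field_simps, algebra?)

lemma coef_0_14 [simp]:
  "coef u h 0 [1, 4] = (h^2*(16*u^5 - 21*u^4 - 11*u^3 + 19*u^2 - u - 2) + (14*u^5 - 20*u^3 + 6*u)) / 8"
  by (subst coef.simps) (simp add: field_simps, algebra?)

lemma coef_0_23 [simp]:
  "coef u h 0 [2, 3] = (h^2*(16*u^5 - 14*u^4 - 17*u^3 + 11*u^2 + 5*u - 1) + (18*u^5 - 24*u^3 + 6*u)) / 8"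
  by (subst coef.simps) (simp add: field_simps, algebra?)

lemma coef_0_5 [simp]:
  "coef u h 0 [5] = (h*(- (128*u^5) + 35*u^4 + 160*u^3 - 30*u^2 - 40*u + 3)) / 16"
  by (subst coef.simps) (simp add: field_simps, algebra?)

lemma coef_0_111111 [simp]:
  "coef u h 0 [1, 1, 1, 1, 1, 1] = (h^6*(u^6 - 6*u^5 + 15*u^4 - 20*u^3 + 15*u^2 - 6*u + 1)
    + h^4*(15*u^6 - 60*u^5 + 75*u^4 - 75*u^2 + 60*u - 15)
    + h^2*(45*u^6 - 90*u^5 - 45*u^4 + 180*u^3 - 45*u^2 - 90*u + 45)
    + (15*u^6 - 45*u^4 + 45*u^2 - 15)) / 64"
  by (subst coef.simps) (simp add: field_simps, algebra?)

lemma coef_0_11112 [simp]: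
  "coef u h 0 [1, 1, 1, 1, 2] = (h^5*(- (2*u^6) + 9*u^5 - 15*u^4 + 10*u^3 - 3*u + 1)
    + h^3*(- (20*u^6) + 54*u^5 - 22*u^4 - 52*u^3 + 48*u^2 - 2*u - 6)
    + h*(- (30*u^6) + 27*u^5 + 63*u^4 - 54*u^3 - 36*u^2 + 27*u + 3)) / 32"
  by (subst coef.simps) (simp add: field_simps, algebra?)

lemma coef_0_1113 [simp]:
  "coef u h 0 [1, 1, 1, 3] = (h^4*(16*u^6 - 54*u^5 + 54*u^4 + 4*u^3 - 36*u^2 + 18*u - 2)
    + h^2*(93*u^6 - 156*u^5 - 75*u^4 + 216*u^3 - 33*u^2 - 60*u + 15)
    + (45*u^6 - 99*u^4 + 63*u^2 - 9)) / 64"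
  by (subst coef.simps) (simp add: field_simps, algebra?)

lemma coef_0_1122 [simp]:
  "coef u h 0 [1, 1, 2, 2] = (h^4*(8*u^6 - 24*u^5 + 18*u^4 + 8*u^3 - 12*u^2 + 2)
    + h^2*(49*u^6 - 74*u^5 - 47*u^4 + 96*u^3 - u^2 - 22*u - 1)
    + (25*u^6 - 51*u^4 + 27*u^2 - 1)) / 32"
  by (subst coef.simps) (simp add: field_simps, algebra?)

lemma coef_0_114 [simp]:
  "coef u h 0 [1, 1, 4] = (h^3*(- (16*u^6) + 37*u^5 - 10*u^4 - 30*u^3 + 20*u^2 + u - 2)
    + h*(- (44*u^6) + 33*u^5 + 72*u^4 - 48*u^3 - 30*u^2 + 15*u + 2)) / 16"
  by (subst coef.simps) (simp add: field_simps, algebra?)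

lemma coef_0_123 [simp]:
  "coef u h 0 [1, 2, 3] = (h^3*(- (32*u^6) + 60*u^5 + 6*u^4 - 56*u^3 + 12*u^2 + 12*u - 2)
    + h*(- (98*u^6) + 63*u^5 + 155*u^4 - 82*u^3 - 60*u^2 + 19*u + 3)) / 32"
  by (subst coef.simps) (simp add: field_simps, algebra?)

lemma coef_0_15 [simp]:
  "coef u h 0 [1, 5] = (h^2*(128*u^6 - 163*u^5 - 125*u^4 + 190*u^3 + 10*u^2 - 43*u + 3)
    + (105*u^6 - 175*u^4 + 75*u^2 - 5)) / 32"
  by (subst coef.simps) (simp add: field_simps, algebra?)

lemma coef_0_222 [simp]:
  "coef u h 0 [2, 2, 2] = (h^3*(- (16*u^6) + 24*u^5 + 12*u^4 - 22*u^3 - 6*u^2 + 6*u + 2)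
    + h*(- (54*u^6) + 27*u^5 + 87*u^4 - 30*u^3 - 36*u^2 + 3*u + 3)) / 16"
  by (subst coef.simps) (simp add: field_simps, algebra?)

lemma coef_0_24 [simp]:
  "coef u h 0 [2, 4] = (h^2*(32*u^6 - 26*u^5 - 43*u^4 + 27*u^3 + 17*u^2 - 5*u - 2) + (35*u^6 - 55*u^4 + 21*u^2 - 1)) / 8"
  by (subst coef.simps) (simp add: field_simps, algebra?)

lemma coef_0_33 [simp]:
  "coef u h 0 [3, 3] = (h^2*(64*u^6 - 48*u^5 - 87*u^4 + 52*u^3 + 30*u^2 - 12*u + 1) + (75*u^6 - 117*u^4 + 45*u^2 - 3)) / 16"
  by (subst coef.simps) (simp add: field_simps, algebra?)

lemma coef_0_6 [simp]:
  "coef u h 0 [6] = (h*(- (256*u^6) + 63*u^5 + 384*u^4 - 70*u^3 - 144*u^2 + 15*u + 8)) / 16"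
  by (subst coef.simps) (simp add: field_simps, algebra?)

lemma coef_1_1 [simp]:
  "coef u h 1 [1] = (h^2*(5*u^2 - 4*u - 1) + (u^2 - 1)) / 4"
  by (subst coef.simps) (simp add: field_simps, algebra?)

lemma coef_1_11 [simp]:
  "coef u h 1 [1, 1] = (h^3*(- (5*u^3) + 9*u^2 - 3*u - 1) + h*(- (12*u^3) + 5*u^2 + 10*u - 3)) / 4"
  by (subst coef.simps) (simp add: field_simps, algebra?)

lemma coef_1_2 [simp]:
  "coef u h 1 [2] = (h^2*(25*u^3 - 16*u^2 - 13*u + 4) + (5*u^3 - 5*u)) / 4"
  by (subst coef.simps) (simp add: field_simps, algebra?)

lemma coef_1_111 [simp]:
  "coef u h 1 [1, 1, 1] = (h^4*(15*u^4 - 42*u^3 + 36*u^2 - 6*u - 3)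
    + h^2*(84*u^4 - 108*u^3 - 48*u^2 + 84*u - 12)
    + (35*u^4 - 46*u^2 + 11)) / 16"
  by (subst coef.simps) (simp add: field_simps, algebra?)

lemma coef_1_12 [simp]:
  "coef u h 1 [1, 2] = (h^3*(- (35*u^4) + 54*u^3 - 22*u + 3) + h*(- (84*u^4) + 30*u^3 + 86*u^2 - 22*u - 10)) / 8"
  by (subst coef.simps) (simp add: field_simps, algebra?)

lemma coef_1_3 [simp]:
  "coef u h 1 [3] = (h^2*(175*u^4 - 96*u^3 - 140*u^2 + 48*u + 13) + (35*u^4 - 40*u^2 + 5)) / 8"
  by (subst coef.simps) (simp add: field_simps, algebra?)

lemma coef_1_1111 [simp]:
  "coef u h 1 [1, 1, 1, 1] = (h^5*(- (5*u^5) + 19*u^4 - 26*u^3 + 14*u^2 - u - 1)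
    + h^3*(- (49*u^5) + 108*u^4 - 26*u^3 - 80*u^2 + 51*u - 4)
    + h*(- (68*u^5) + 47*u^4 + 106*u^3 - 64*u^2 - 38*u + 17)) / 8"
  by (subst coef.simps) (simp add: field_simps, algebra?)

lemma coef_1_112 [simp]:
  "coef u h 1 [1, 1, 2] = (h^4*(45*u^5 - 112*u^4 + 64*u^3 + 30*u^2 - 29*u + 2)
    + h^2*(252*u^5 - 288*u^4 - 224*u^3 + 276*u^2 + 12*u - 28)
    + (105*u^5 - 154*u^3 + 49*u)) / 16"
  by (subst coef.simps) (simp add: field_simps, algebra?)

lemma coef_1_13 [simp]:
  "coef u h 1 [1, 3] = (h^3*(- (215*u^5) + 318*u^4 + 70*u^3 - 220*u^2 + 33*u + 14)
    + h*(- (478*u^5) + 158*u^4 + 600*u^3 - 152*u^2 - 146*u + 18)) / 16"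
  by (subst coef.simps) (simp add: field_simps, algebra?)

lemma coef_1_22 [simp]:
  "coef u h 1 [2, 2] = (h^3*(- (50*u^5) + 57*u^4 + 35*u^3 - 37*u^2 - 9*u + 4)
    + h*(- (139*u^5) + 41*u^4 + 169*u^3 - 35*u^2 - 38*u + 2)) / 4"
  by (subst coef.simps) (simp add: field_simps, algebra?)

lemma coef_1_4 [simp]:
  "coef u h 1 [4] = (h^2*(525*u^5 - 256*u^4 - 560*u^3 + 192*u^2 + 115*u - 16) + (105*u^5 - 140*u^3 + 35*u)) / 8"
  by (subst coef.simps) (simp add: field_simps, algebra?)

lemma coef_1_11111 [simp]:
  "coef u h 1 [1, 1, 1, 1, 1] = (h^6*(25*u^6 - 120*u^5 + 225*u^4 - 200*u^3 + 75*u^2 - 5)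
    + h^4*(375*u^6 - 1180*u^5 + 955*u^4 + 480*u^3 - 995*u^2 + 380*u - 15)
    + h^2*(1085*u^6 - 1660*u^5 - 1235*u^4 + 2600*u^3 - 65*u^2 - 940*u + 215)
    + (335*u^6 - 765*u^4 + 525*u^2 - 95)) / 64"
  by (subst coef.simps) (simp add: field_simps, algebra?)

lemma coef_1_1112 [simp]:
  "coef u h 1 [1, 1, 1, 2] = (h^5*(- (55*u^6) + 190*u^5 - 209*u^4 + 36*u^3 + 71*u^2 - 34*u + 1)
    + h^3*(- (539*u^6) + 1080*u^5 + 11*u^4 - 1072*u^3 + 435*u^2 + 136*u - 51)
    + h*(- (748*u^6) + 470*u^5 + 1294*u^4 - 700*u^3 - 584*u^2 + 230*u + 38)) / 32"
  by (subst coef.simps) (simp add: field_simps, algebra?)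

lemma coef_1_113 [simp]:
  "coef u h 1 [1, 1, 3] = (h^4*(255*u^6 - 620*u^5 + 269*u^4 + 348*u^3 - 283*u^2 + 16*u + 15)
    + h^2*(1347*u^6 - 1488*u^5 - 1551*u^4 + 1796*u^3 + 297*u^2 - 420*u + 19)
    + (530*u^6 - 900*u^4 + 402*u^2 - 32)) / 32"
  by (subst coef.simps) (simp add: field_simps, algebra?)

lemma coef_1_122 [simp]:
  "coef u h 1 [1, 2, 2] = (h^4*(240*u^6 - 500*u^5 + 82*u^4 + 340*u^3 - 112*u^2 - 64*u + 14)
    + h^2*(1425*u^6 - 1392*u^5 - 1725*u^4 + 1564*u^3 + 459*u^2 - 300*u - 31)
    + (625*u^6 - 1011*u^4 + 403*u^2 - 17)) / 32"
  by (subst coef.simps) (simp add: field_simps, algebra?)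

lemma coef_1_14 [simp]:
  "coef u h 1 [1, 4] = (h^3*(- (605*u^6) + 870*u^5 + 380*u^4 - 836*u^3 + 63*u^2 + 142*u - 14)
    + h*(- (1243*u^6) + 390*u^5 + 1858*u^4 - 468*u^3 - 683*u^2 + 110*u + 36)) / 16"
  by (subst coef.simps) (simp add: field_simps, algebra?)

lemma coef_1_23 [simp]:
  "coef u h 1 [2, 3] = (h^3*(- (550*u^6) + 570*u^5 + 565*u^4 - 524*u^3 - 168*u^2 + 98*u + 9)
    + h*(- (1529*u^6) + 410*u^5 + 2216*u^4 - 444*u^3 - 773*u^2 + 82*u + 38)) / 16"
  by (subst coef.simps) (simp add: field_simps, algebra?)

lemma coef_1_5 [simp]:
  "coef u h 1 [5] = (h^2*(5775*u^6 - 2560*u^5 - 7665*u^4 + 2560*u^3 + 2485*u^2 - 480*u - 115)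
    + (1155*u^6 - 1785*u^4 + 665*u^2 - 35)) / 32"
  by (subst coef.simps) (simp add: field_simps, algebra?)

lemma coef_2_1 [simp]:
  "coef u h 2 [1] = (h^3*(- (30*u^3) + 25*u^2 + 10*u - 5) + h*(- (17*u^3) + 5*u^2 + 15*u - 3)) / 4"
  by (subst coef.simps) (simp add: field_simps, algebra?)

lemma coef_2_11 [simp]:
  "coef u h 2 [1, 1] = (h^4*(145*u^4 - 260*u^3 + 66*u^2 + 68*u - 19)
    + h^2*(636*u^4 - 404*u^3 - 520*u^2 + 260*u + 28)
    + (105*u^4 - 126*u^2 + 21)) / 16"
  by (subst coef.simps) (simp add: field_simps, algebra?)

lemma coef_2_2 [simp]:
  "coef u h 2 [2] = (h^3*(- (240*u^4) + 175*u^3 + 150*u^2 - 75*u - 10)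
    + h*(- (136*u^4) + 35*u^3 + 141*u^2 - 25*u - 15)) / 4"
  by (subst coef.simps) (simp add: field_simps, algebra?)

lemma coef_2_111 [simp]:
  "coef u h 2 [1, 1, 1] = (h^5*(- (255*u^5) + 705*u^4 - 558*u^3 - 6*u^2 + 141*u - 27)
    + h^3*(- (2316*u^5) + 3420*u^4 + 900*u^3 - 2652*u^2 + 504*u + 144)
    + h*(- (2567*u^5) + 945*u^4 + 3386*u^3 - 1022*u^2 - 915*u + 173)) / 32"
  by (subst coef.simps) (simp add: field_simps, algebra?)

lemma coef_2_12 [simp]:
  "coef u h 2 [1, 2] = (h^4*(725*u^5 - 1170*u^4 - 26*u^3 + 628*u^2 - 123*u - 34)
    + h^2*(3180*u^5 - 1818*u^4 - 3352*u^3 + 1516*u^2 + 604*u - 130)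
    + (525*u^5 - 714*u^3 + 189*u)) / 16"
  by (subst coef.simps) (simp add: field_simps, algebra?)

lemma coef_2_3 [simp]:
  "coef u h 2 [3] = (h^3*(- (2400*u^5) + 1575*u^4 + 2160*u^3 - 1050*u^2 - 360*u + 75)
    + h*(- (1360*u^5) + 315*u^4 + 1672*u^3 - 280*u^2 - 372*u + 25)) / 8"
  by (subst coef.simps) (simp add: field_simps, algebra?)

lemma coef_2_1111 [simp]:
  "coef u h 2 [1, 1, 1, 1] = (h^6*(195*u^6 - 730*u^5 + 953*u^4 - 412*u^3 - 107*u^2 + 118*u - 17)
    + h^4*(2867*u^6 - 6788*u^5 + 2415*u^4 + 4624*u^3 - 3487*u^2 + 180*u + 189)
    + h^2*(7569*u^6 - 8126*u^5 - 9519*u^4 + 10588*u^3 + 2211*u^2 - 2894*u + 171)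
    + (1915*u^6 - 3429*u^4 + 1689*u^2 - 175)) / 32"
  by (subst coef.simps) (simp add: field_simps, algebra?)

lemma coef_2_112 [simp]:
  "coef u h 2 [1, 1, 2] = (h^5*(- (1020*u^6) + 2585*u^5 - 1435*u^4 - 958*u^3 + 934*u^2 - 59*u - 47)
    + h^3*(- (9264*u^6) + 12540*u^5 + 6860*u^4 - 12516*u^3 + 444*u^2 + 2104*u - 168)
    + h*(- (10268*u^6) + 3465*u^5 + 15565*u^4 - 4326*u^3 - 5826*u^2 + 1085*u + 305)) / 32"
  by (subst coef.simps) (simp add: field_simps, algebra?)

lemma coef_2_13 [simp]:
  "coef u h 2 [1, 3] = (h^4*(6155*u^6 - 9710*u^5 - 2031*u^4 + 7816*u^3 - 1327*u^2 - 1050*u + 147)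
    + h^2*(24450*u^6 - 13338*u^5 - 31692*u^4 + 14268*u^3 + 9482*u^2 - 2818*u - 352)
    + (3995*u^6 - 6255*u^4 + 2397*u^2 - 137)) / 32"
  by (subst coef.simps) (simp add: field_simps, algebra?)

lemma coef_2_22 [simp]:
  "coef u h 2 [2, 2] = (h^4*(2545*u^6 - 3160*u^5 - 1854*u^4 + 2516*u^3 + 421*u^2 - 444*u - 24)
    + h^2*(13710*u^6 - 6660*u^5 - 17728*u^4 + 6648*u^3 + 5406*u^2 - 1124*u - 252)
    + (2305*u^6 - 3510*u^4 + 1257*u^2 - 52)) / 16"
  by (subst coef.simps) (simp add: field_simps, algebra?)

lemma coef_2_4 [simp]:
  "coef u h 2 [4] = (h^3*(- (9600*u^6) + 5775*u^5 + 11200*u^4 - 5250*u^3 - 3120*u^2 + 875*u + 120)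
    + h*(- (5440*u^6) + 1155*u^5 + 7840*u^4 - 1260*u^3 - 2664*u^2 + 245*u + 124)) / 8"
  by (subst coef.simps) (simp add: field_simps, algebra?)

lemma coef_3_1 [simp]:
  "coef u h 3 [1] = (h^4*(1105*u^4 - 960*u^3 - 534*u^2 + 368*u + 21)
    + h^2*(1180*u^4 - 544*u^3 - 1084*u^2 + 360*u + 88)
    + (105*u^4 - 126*u^2 + 21)) / 16"
  by (subst coef.simps) (simp add: field_simps, algebra?)

lemma coef_3_11 [simp]:
  "coef u h 3 [1, 1] = (h^5*(- (1405*u^5) + 2555*u^4 - 466*u^3 - 1082*u^2 + 367*u + 31)
    + h^3*(- (9728*u^5) + 7540*u^4 + 8392*u^3 - 5664*u^2 - 936*u + 396)
    + h*(- (4581*u^5) + 1155*u^4 + 5814*u^3 - 1134*u^2 - 1401*u + 147)) / 16"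
  by (subst coef.simps) (simp add: field_simps, algebra?)

lemma coef_3_2 [simp]:
  "coef u h 3 [2] = (h^4*(12155*u^5 - 9600*u^4 - 9226*u^3 + 5824*u^2 + 1215*u - 368)
    + h^2*(12980*u^5 - 5440*u^4 - 14476*u^3 + 4512*u^2 + 2784*u - 360)
    + (1155*u^5 - 1554*u^3 + 399*u)) / 16"
  by (subst coef.simps) (simp add: field_simps, algebra?)

lemma coef_3_111 [simp]:
  "coef u h 3 [1, 1, 1] = (h^6*(2620*u^6 - 7275*u^5 + 5409*u^4 + 1162*u^3 - 2490*u^2 + 513*u + 61)
    + h^4*(35274*u^6 - 56976*u^5 - 10998*u^4 + 48156*u^3 - 10758*u^2 - 5724*u + 1026)
    + h^2*(72498*u^6 - 44547*u^5 - 95391*u^4 + 51302*u^3 + 28440*u^2 - 11523*u - 779)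
    + (10010*u^6 - 16170*u^4 + 6630*u^2 - 470)) / 32"
  by (subst coef.simps) (simp add: field_simps, algebra?)

lemma coef_3_12 [simp]:
  "coef u h 3 [1, 2] = (h^5*(- (18265*u^6) + 30660*u^5 + 1899*u^4 - 21040*u^3 + 4701*u^2 + 2412*u - 367)
    + h^3*(- (126464*u^6) + 90480*u^5 + 140952*u^4 - 86800*u^3 - 33600*u^2 + 14496*u + 936)
    + h*(- (59553*u^6) + 13860*u^5 + 86859*u^4 - 15960*u^3 - 30051*u^2 + 3444*u + 1401)) / 32"
  by (subst coef.simps) (simp add: field_simps, algebra?)

lemma coef_3_3 [simp]:
  "coef u h 3 [3] = (h^4*(158015*u^6 - 115200*u^5 - 162261*u^4 + 96640*u^3 + 38613*u^2 - 14592*u - 1215)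
    + h^2*(168740*u^6 - 65280*u^5 - 224136*u^4 + 66880*u^3 + 68484*u^2 - 11904*u - 2784)
    + (15015*u^6 - 22869*u^4 + 8253*u^2 - 399)) / 32"
  by (subst coef.simps) (simp add: field_simps, algebra?)

lemma coef_4_1 [simp]:
  "coef u h 4 [1] = (h^5*(- (13560*u^5) + 12155*u^4 + 8760*u^3 - 6906*u^2 - 848*u + 399)
    + h^3*(- (22708*u^5) + 12980*u^4 + 22868*u^3 - 10176*u^2 - 3720*u + 756)
    + h*(- (5736*u^5) + 1155*u^4 + 7368*u^3 - 1134*u^2 - 1800*u + 147)) / 16"
  by (subst coef.simps) (simp add: field_simps, algebra?)

lemma coef_4_11 [simp]:
  "coef u h 4 [1, 1] = (h^6*(34445*u^6 - 63650*u^5 + 6905*u^4 + 37868*u^3 - 13249*u^2 - 3146*u + 827)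
    + h^4*(342461*u^6 - 298344*u^5 - 324099*u^4 + 264640*u^3 + 54999*u^2 - 39288*u - 369)
    + h^2*(306527*u^6 - 130578*u^5 - 412599*u^4 + 142644*u^3 + 127641*u^2 - 28818*u - 4817)
    + (25025*u^6 - 39039*u^4 + 14883*u^2 - 869)) / 32"
  by (subst coef.simps) (simp add: field_simps, algebra?)

lemma coef_4_2 [simp]:
  "coef u h 4 [2] = (h^5*(- (189840*u^6) + 158015*u^5 + 172920*u^4 - 124586*u^3 - 34760*u^2 + 17403*u + 848)
    + h^3*(- (317912*u^6) + 168740*u^5 + 387956*u^4 - 163856*u^3 - 105804*u^2 + 27156*u + 3720)
    + h*(- (80304*u^6) + 15015*u^5 + 117096*u^4 - 17094*u^3 - 40104*u^2 + 3591*u + 1800)) / 16"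
  by (subst coef.simps) (simp add: field_simps, algebra?)

lemma coef_5_1 [simp]:
  "coef u h 5 [1] = (h^6*(414125*u^6 - 379680*u^5 - 338935*u^4 + 287040*u^3 + 56271*u^2 - 37952*u - 869)
    + h^4*(978285*u^6 - 635824*u^5 - 1100011*u^4 + 592352*u^3 + 266607*u^2 - 93600*u - 7809)
    + h^2*(467135*u^6 - 160608*u^5 - 646791*u^4 + 176832*u^3 + 207849*u^2 - 36000*u - 8417)
    + (25025*u^6 - 39039*u^4 + 14883*u^2 - 869)) / 32"
  by (subst coef.simps) (simp add: field_simps, algebra?)

end

section \<open>The branch of the square root\<close>

text \<open>With \<open>w = (x - y) / 2\<close> one has \<open>x = w + g / w\<close>, and \<open>norm w = sqrt g\<close> only on the cut. As the complement of the
  cut is connected and \<open>w\<close> vanishes at infinity, \<open>norm w < sqrt g\<close> throughout.\<close>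

lemma resolvent_branch_sign:
  assumes g: "g > 0" and y: "is_resolvent_sqrt g y" and x: "x \<notin> \<real>"
  shows "Im (x - y x) * Im x \<le> 0"
proof -
  define D where "D = - complex_of_real ` {- 2 * sqrt g .. 2 * sqrt g}"
  define w where "w z = (z - y z) / 2" for z
  have an: "y analytic_on D" and sq: "\<And>z. z \<in> D \<Longrightarrow> (y z)\<^sup>2 = z\<^sup>2 - 4 * of_real g"
    and asy: "y \<sim>[at_infinity] (\<lambda>x. x)"
    using y by (auto simp: is_resolvent_sqrt_def D_def)
  have ww: "w z * ((z + y z) / 2) = of_real g" if "z \<in> D" for z
    using sq[OF that] by (simp add: w_def power2_eq_square algebra_simps)
  have wnz: "w z \<noteq> 0" if "z \<in> D" for z using ww[OF that] g by auto
  have zw: "z = w z + of_real g / w z" if "z \<in> D" for z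
  proof -
    have "of_real g / w z = (z + y z) / 2" using ww[OF that] wnz[OF that] by (simp add: field_simps)
    then show ?thesis by (simp add: w_def field_simps)
  qed
  have gw: "of_real g / w z = of_real (g / (norm (w z))\<^sup>2) * cnj (w z)" if "z \<in> D" for z
    using wnz[OF that] by (simp add: complex_norm_square[symmetric] field_simps)
  have ne: "norm (w z) \<noteq> sqrt g" if z: "z \<in> D" for z
  proof
    assume eq: "norm (w z) = sqrt g"
    then have "of_real g / w z = cnj (w z)" using gw[OF z] g by simp
    then have "z = of_real (2 * Re (w z))" using zw[OF z] complex_add_cnj[of "w z"] by simp
    moreover have "\<bar>Re (w z)\<bar> \<le> sqrt g" using abs_Re_le_cmod[of "w z"] eq by simp
    then have "2 * Re (w z) \<in> {- 2 * sqrt g .. 2 * sqrt g}" by auto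
    ultimately have "z \<in> complex_of_real ` {- 2 * sqrt g .. 2 * sqrt g}" by blast
    then show False using z by (simp add: D_def)
  qed
  have "connected D"
    unfolding D_def
  proof (rule connected_complement_bounded_convex)
    show "bounded (complex_of_real ` {- 2 * sqrt g .. 2 * sqrt g})"
      by (intro compact_imp_bounded compact_continuous_image continuous_intros compact_Icc)
    show "convex (complex_of_real ` {- 2 * sqrt g .. 2 * sqrt g})"
      by (intro convex_linear_image bounded_linear.linear bounded_linear_of_real convex_closed_interval | simp)+
  qed simp
  moreover have "continuous_on D (\<lambda>z. norm (w z))"
    unfolding w_def using analytic_imp_holomorphic[OF an] by (intro continuous_intros holomorphic_on_imp_continuous_on) auto
  ultimately have conn: "connected ((\<lambda>z. norm (w z)) ` D)"
    by (rule connected_continuous_image[rotated])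
  \<comment> \<open>Far out, \<open>y z / z\<close> is within 1 of 1, so \<open>1 + y z / z\<close>
    has modulus above 1 and \<open>(z + y z) / 2\<close> exceeds \<open>sqrt g\<close>. By
    \<open>ww\<close> its product with \<open>w z\<close> is \<open>g\<close>, which makes
    \<open>w z\<close> small.\<close>
  obtain z0 where z0: "z0 \<in> D" "norm (w z0) < sqrt g"
  proof -
    have "\<forall>\<^sub>F z in at_infinity. dist (if y z = 0 \<and> z = 0 then 1 else y z / z) 1 < 1"
      using asy unfolding asymp_equiv_def by (rule tendstoD) simp
    moreover have "\<forall>\<^sub>F z::complex in at_infinity. 2 * sqrt g < norm z"
      unfolding eventually_at_infinity by (rule exI[of _ "2 * sqrt g + 1"]) auto
    ultimately have "\<forall>\<^sub>F z in at_infinity. dist (if y z = 0 \<and> z = 0 then 1 else y z / z) 1 < 1 \<and> 2 * sqrt g < norm z"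
      by (rule eventually_conj)
    then obtain z where z: "dist (if y z = 0 \<and> z = 0 then 1 else y z / z) 1 < 1" "2 * sqrt g < norm z"
      using eventually_happens'[OF trivial_limit_at_infinity] by blast
    have nz: "z \<noteq> 0" using z(2) g by auto
    have zD: "z \<in> D"
    proof -
      have "norm (complex_of_real t) \<le> 2 * sqrt g" if "t \<in> {- 2 * sqrt g .. 2 * sqrt g}" for t using that by auto
      then show ?thesis using z(2) unfolding D_def by fastforce
    qed
    have "norm (y z / z - 1) < 1" using z(1) nz by (simp add: dist_norm)
    then have "norm (1 + y z / z) > 1"
      using norm_triangle_ineq4[of "1 + y z / z" "y z / z - 1"] by simp
    then have "norm z * norm (1 + y z / z) > norm z * 1" using nz by (intro mult_strict_left_mono) auto
    also have "norm z * norm (1 + y z / z) = norm (z + y z)"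
    proof -
      have "z * (1 + y z / z) = z + y z" using nz by (simp add: distrib_left)
      then show ?thesis by (simp only: norm_mult[symmetric])
    qed
    finally have big: "norm ((z + y z) / 2) > sqrt g" using z(2) by (simp add: norm_divide)
    have "norm (w z) * norm ((z + y z) / 2) = g" unfolding norm_mult[symmetric] ww[OF zD] using g by simp
    moreover have "norm (w z) * sqrt g < norm (w z) * norm ((z + y z) / 2)"
      using big wnz[OF zD] by (intro mult_strict_left_mono) auto
    moreover have "g = sqrt g * sqrt g" using g by simp
    ultimately have "norm (w z) * sqrt g < sqrt g * sqrt g" by linarith
    then have "norm (w z) < sqrt g" by (rule mult_right_less_imp_less) (use g in simp)
    then show ?thesis using that zD by blast
  qed
  have xD: "x \<in> D" using x by (auto simp: D_def)
  have lt: "norm (w x) < sqrt g"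
  proof (rule ccontr)
    assume "\<not> norm (w x) < sqrt g"
    then have "sqrt g \<in> {norm (w z0) .. norm (w x)}" using z0 by auto
    then have "sqrt g \<in> (\<lambda>z. norm (w z)) ` D"
      using connected_contains_Icc[OF conn, of "norm (w z0)" "norm (w x)"] z0(1) xD by blast
    then show False using ne by force
  qed
  \<comment> \<open>The term \<open>g / w\<close> is a positive multiple of the conjugate of
    \<open>w\<close>, so its imaginary part opposes that of \<open>w\<close>, and it prevails
    because \<open>norm (w x) < sqrt g\<close>.\<close>
  have "Im x = Im (w x + of_real g / w x)" using zw[OF xD] by (rule arg_cong)
  also have "\<dots> = Im (w x) * (1 - g / (norm (w x))\<^sup>2)"
    unfolding gw[OF xD] by (simp add: algebra_simps)
  finally have "Im (w x) * Im x = (Im (w x))\<^sup>2 * (1 - g / (norm (w x))\<^sup>2)"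
    by (simp add: power2_eq_square)
  moreover have "(norm (w x))\<^sup>2 \<le> g"
    using lt g by (metis abs_norm_cancel less_imp_le real_sqrt_abs real_sqrt_le_iff)
  then have "1 - g / (norm (w x))\<^sup>2 \<le> 0" using wnz[OF xD] by simp
  ultimately have "Im (w x) * Im x \<le> 0" by (simp add: mult_nonneg_nonpos)
  then show ?thesis by (simp add: w_def)
qed

section \<open>Matching the stated coefficients with the computed ones\<close>

text \<open>With \<open>X\<close> and \<open>G\<close> written through \<open>u\<close> and
  \<open>Y\<close>, the coefficient of order \<open>l\<close> times \<open>Y ^ (2 * l - 1)\<close>
  depends on \<open>u\<close> and \<open>h\<close> alone. In this and the next five lemmas
  \<open>s\<close> is the reciprocal of the highest power of \<open>Y\<close> in a denominator. It
  makes the claim a polynomial identity in \<open>u\<close>, \<open>h\<close>, \<open>Y\<close> and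
  \<open>s\<close>, and the relation between \<open>s\<close> and \<open>Y\<close> enters only at
  the end.\<close>

lemma resolvent_coeffs_1:
  fixes u h Y :: complex
  assumes Y: "Y \<noteq> 0" and X: "X = u * Y" and G: "G = Y^2 * (u^2 - 1) / 4"
  shows "resolvent_coeffs G h X Y ! 1 * Y = (h * (- (u) + 1)) / 2" (is "_ = ?P")
proof -
  define s where "s = 1 / Y^2"
  have s: "s * Y^2 = 1" using Y by (simp add: s_def)
  have yp: "Y^2 = Y * Y" by (rule power2_eq_square)
  have d: "a / Y^2 = a * s" "a / (2 * Y^2) = a * s / 2" "a / Y = a * Y * s" "a / (2 * Y) = a * Y * s / 2" for a
    unfolding s_def yp using Y by simp_all
  have "resolvent_coeffs G h X Y ! 1 * Y = (s * Y^2) * ?P"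
    unfolding X G by (simp add: resolvent_coeffs_def d, (algebra | (simp add: field_simps, algebra?)))
  then show ?thesis unfolding s by simp
qed

lemma resolvent_coeffs_2:
  fixes u h Y :: complex
  assumes Y: "Y \<noteq> 0" and X: "X = u * Y" and G: "G = Y^2 * (u^2 - 1) / 4"
  shows "resolvent_coeffs G h X Y ! 2 * Y^3 = (h^2 * (5*u^2 - 4*u - 1) + (u^2 - 1)) / 4" (is "_ = ?P")
proof -
  define s where "s = 1 / Y^5"
  have s: "s * Y^5 = 1" using Y by (simp add: s_def)
  have yp: "Y^5 = Y * Y^4" using power_Suc[of Y 4] by simp
  have d: "a / Y^5 = a * s" "a / (2 * Y^5) = a * s / 2" "a / Y^4 = a * Y * s" "a / (2 * Y^4) = a * Y * s / 2" for a
    unfolding s_def yp using Y by simp_all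
  have "resolvent_coeffs G h X Y ! 2 * Y^3 = (s * Y^5) * ?P"
    unfolding X G by (simp add: resolvent_coeffs_def d, (algebra | (simp add: field_simps, algebra?)))
  then show ?thesis unfolding s by simp
qed

lemma resolvent_coeffs_3:
  fixes u h Y :: complex
  assumes Y: "Y \<noteq> 0" and X: "X = u * Y" and G: "G = Y^2 * (u^2 - 1) / 4"
  shows "resolvent_coeffs G h X Y ! 3 * Y^5 =
    (h^3 * (- (30*u^3) + 25*u^2 + 10*u - 5)
      + h * (- (17*u^3) + 5*u^2 + 15*u - 3)) / 4" (is "_ = ?P")
proof -
  define s where "s = 1 / Y^8"
  have s: "s * Y^8 = 1" using Y by (simp add: s_def)
  have yp: "Y^8 = Y * Y^7" using power_Suc[of Y 7] by simp
  have d: "a / Y^8 = a * s" "a / (2 * Y^8) = a * s / 2" "a / Y^7 = a * Y * s" "a / (2 * Y^7) = a * Y * s / 2" for a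
    unfolding s_def yp using Y by simp_all
  have "resolvent_coeffs G h X Y ! 3 * Y^5 = (s * Y^8) * ?P"
    unfolding X G by (simp add: resolvent_coeffs_def d, (algebra | (simp add: field_simps, algebra?)))
  then show ?thesis unfolding s by simp
qed

lemma resolvent_coeffs_4:
  fixes u h Y :: complex
  assumes Y: "Y \<noteq> 0" and X: "X = u * Y" and G: "G = Y^2 * (u^2 - 1) / 4"
  shows "resolvent_coeffs G h X Y ! 4 * Y^7 =
    (h^4 * (1105*u^4 - 960*u^3 - 534*u^2 + 368*u + 21)
      + h^2 * (1180*u^4 - 544*u^3 - 1084*u^2 + 360*u + 88)
      + (105*u^4 - 126*u^2 + 21)) / 16" (is "_ = ?P")
proof -
  define s where "s = 1 / Y^11"
  have s: "s * Y^11 = 1" using Y by (simp add: s_def)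
  have yp: "Y^11 = Y * Y^10" using power_Suc[of Y 10] by simp
  have d: "a / Y^11 = a * s" "a / (2 * Y^11) = a * s / 2" "a / Y^10 = a * Y * s" "a / (2 * Y^10) = a * Y * s / 2" for a
    unfolding s_def yp using Y by simp_all
  have "resolvent_coeffs G h X Y ! 4 * Y^7 = (s * Y^11) * ?P"
    unfolding X G by (simp add: resolvent_coeffs_def d, (algebra | (simp add: field_simps, algebra?)))
  then show ?thesis unfolding s by simp
qed

lemma resolvent_coeffs_5:
  fixes u h Y :: complex
  assumes Y: "Y \<noteq> 0" and X: "X = u * Y" and G: "G = Y^2 * (u^2 - 1) / 4"
  shows "resolvent_coeffs G h X Y ! 5 * Y^9 =
    (h^5 * (- (13560*u^5) + 12155*u^4 + 8760*u^3 - 6906*u^2 - 848*u + 399)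
      + h^3 * (- (22708*u^5) + 12980*u^4 + 22868*u^3 - 10176*u^2 - 3720*u + 756)
      + h * (- (5736*u^5) + 1155*u^4 + 7368*u^3 - 1134*u^2 - 1800*u + 147)) / 16" (is "_ = ?P")
proof -
  define s where "s = 1 / Y^14"
  have s: "s * Y^14 = 1" using Y by (simp add: s_def)
  have yp: "Y^14 = Y * Y^13" using power_Suc[of Y 13] by simp
  have d: "a / Y^14 = a * s" "a / (2 * Y^14) = a * s / 2" "a / Y^13 = a * Y * s" "a / (2 * Y^13) = a * Y * s / 2" for a
    unfolding s_def yp using Y by simp_all
  have "resolvent_coeffs G h X Y ! 5 * Y^9 = (s * Y^14) * ?P"
    unfolding X G by (simp add: resolvent_coeffs_def d, (algebra | (simp add: field_simps, algebra?)))
  then show ?thesis unfolding s by simp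
qed

lemma resolvent_coeffs_6:
  fixes u h Y :: complex
  assumes Y: "Y \<noteq> 0" and X: "X = u * Y" and G: "G = Y^2 * (u^2 - 1) / 4"
  shows "resolvent_coeffs G h X Y ! 6 * Y^11 =
    (h^6 * (414125*u^6 - 379680*u^5 - 338935*u^4 + 287040*u^3 + 56271*u^2 - 37952*u - 869)
      + h^4 * (978285*u^6 - 635824*u^5 - 1100011*u^4 + 592352*u^3 + 266607*u^2 - 93600*u - 7809)
      + h^2 * (467135*u^6 - 160608*u^5 - 646791*u^4 + 176832*u^3 + 207849*u^2 - 36000*u - 8417)
      + (25025*u^6 - 39039*u^4 + 14883*u^2 - 869)) / 32" (is "_ = ?P")
proof -
  define s where "s = 1 / Y^17"
  have s: "s * Y^17 = 1" using Y by (simp add: s_def)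
  have yp: "Y^17 = Y * Y^16" using power_Suc[of Y 16] by simp
  have d: "a / Y^17 = a * s" "a / (2 * Y^17) = a * s / 2" "a / Y^16 = a * Y * s" "a / (2 * Y^16) = a * Y * s / 2" for a
    unfolding s_def yp using Y by simp_all
  have "resolvent_coeffs G h X Y ! 6 * Y^11 = (s * Y^17) * ?P"
    unfolding X G by (simp add: resolvent_coeffs_def d, (algebra | (simp add: field_simps, algebra?)))
  then show ?thesis unfolding s by simp
qed

section \<open>Expansion of the resolvent\<close>

context gbe_branch
begin

text \<open>Exact for every \<open>N > 0\<close>. The fluctuation carries a factor
  \<open>\<delta> N\<close>, so the resolvent coefficient of order \<open>Suc l\<close> comes from
  \<open>coef u h l [1]\<close>, and the one of order 0 from \<open>om u 1\<close>.\<close>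

lemma resolvent_conv_M:
  assumes N: "N > 0"
  shows "complex_of_real (g / real N) * gbe_resolvent g \<kappa> N x = y * om u 1 + y * \<delta> N * M [1] N"
proof -
  have "gbe_resolvent g \<kappa> N x = mean N (pstat N x 1)"
    by (simp add: gbe_resolvent_def mean_def pstat_def[abs_def])
  then have "complex_of_real (g / real N) * gbe_resolvent g \<kappa> N x = mean N (\<lambda>v. complex_of_real (g / real N) * pstat N x 1 v)"
    by (simp only: mean_cmult)
  also have "(\<lambda>v. complex_of_real (g / real N) * pstat N x 1 v) = (\<lambda>v. y * om u 1 + y * \<delta> N * ymon N [1] v)"
  proof (rule ext)
    fix v
    have "complex_of_real (g / real N) * pstat N x 1 v = of_real g * y ^ 1 * nstat N x 1 v / y"
      using y_nz by (simp add: nstat_def)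
    also have "\<dots> = y * p N 1 v"
      unfolding nstat_p[OF N] using y_nz by (simp add: power2_eq_square)
    also have "\<dots> = y * om u 1 + y * \<delta> N * ymon N [1] v"
      unfolding p_Y[OF N] by (simp add: algebra_simps)
    finally show "complex_of_real (g / real N) * pstat N x 1 v = y * om u 1 + y * \<delta> N * ymon N [1] v" .
  qed
  also have "mean N \<dots> = y * om u 1 + y * \<delta> N * M [1] N"
    unfolding M_def
    using mean_add[OF regular_const regular_mult[OF regular_const regular_ymon]] by (simp only: mean_const mean_cmult)
  finally show ?thesis .
qed

lemma resolvent_coeffs_eq:
  shows "resolvent_coeffs (of_real g) h x y ! 0 = y * om u 1"
    and "l < 6 \<Longrightarrow> (\<delta> N * y\<^sup>2) ^ Suc l * resolvent_coeffs (of_real g) h x y ! Suc l = y * \<delta> N * (coef u h l [1] * \<delta> N ^ l)"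
proof -
  have X: "x = u * y" using y_nz by (simp add: u_def)
  have G: "complex_of_real g = y ^ 2 * (u ^ 2 - 1) / 4"
  proof -
    have "y ^ 2 * (u ^ 2 - 1) = x ^ 2 - y ^ 2"
      using y_nz by (simp add: u_def power_divide right_diff_distrib)
    then show ?thesis using y2 by simp
  qed
  show "resolvent_coeffs (of_real g) h x y ! 0 = y * om u 1"
    using y_nz by (simp add: resolvent_coeffs_def u_def field_simps)
  assume "l < 6"
  then have "l \<in> {0, 1, 2, 3, 4, 5}" by auto
  then have c: "resolvent_coeffs (of_real g) h x y ! Suc l * y ^ (2 * l + 1) = coef u h l [1]"
    using resolvent_coeffs_1[OF y_nz X G, of h] resolvent_coeffs_2[OF y_nz X G, of h] resolvent_coeffs_3[OF y_nz X G, of h]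
      resolvent_coeffs_4[OF y_nz X G, of h] resolvent_coeffs_5[OF y_nz X G, of h] resolvent_coeffs_6[OF y_nz X G, of h]
      coef_0_1[of u h] coef_1_1[of u h] coef_2_1[of u h] coef_3_1[of u h] coef_4_1[of u h] coef_5_1[of u h]
    by (elim insertE emptyE) (simp_all only: Suc_numeral Suc_1 One_nat_def[symmetric] mult_1_right mult_zero_right add_0 power_one_right, simp_all)
  have e: "(\<delta> N * y\<^sup>2) ^ Suc l = y * \<delta> N * (y ^ (2 * l + 1) * \<delta> N ^ l)"
  proof -
    have "(y\<^sup>2) ^ Suc l = y ^ (2 * Suc l)" by (simp only: power_mult)
    also have "\<dots> = y * y ^ (2 * l + 1)" by simp
    finally show ?thesis unfolding power_mult_distrib by (simp only: power_Suc mult_ac)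
  qed
  show "(\<delta> N * y\<^sup>2) ^ Suc l * resolvent_coeffs (of_real g) h x y ! Suc l = y * \<delta> N * (coef u h l [1] * \<delta> N ^ l)"
    unfolding c[symmetric] e by (simp only: mult_ac)
qed

lemma resolvent_expansion:
  "(\<lambda>N. complex_of_real (g / real N) * gbe_resolvent g \<kappa> N x
       - (\<Sum>l=0..6. complex_of_real (g / (sqrt \<kappa> * real N)) ^ l * resolvent_coeffs (of_real g) h x y ! l))
    \<in> O(\<lambda>N. 1 / of_nat N ^ 7)"
proof -
  have \<epsilon>: "complex_of_real (g / (sqrt \<kappa> * real N)) = \<delta> N * y\<^sup>2" for N
    using y_nz by (simp add: \<delta>_def)
  have sum: "(\<Sum>l=0..6. complex_of_real (g / (sqrt \<kappa> * real N)) ^ l * resolvent_coeffs (of_real g) h x y ! l)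
     = y * om u 1 + y * \<delta> N * (\<Sum>l<6. coef u h l [1] * \<delta> N ^ l)" for N
  proof -
    have "{0..6::nat} = {..<Suc 6}" by auto
    then have "(\<Sum>l=0..6. complex_of_real (g / (sqrt \<kappa> * real N)) ^ l * resolvent_coeffs (of_real g) h x y ! l)
      = y * om u 1 + (\<Sum>l<6. (\<delta> N * y\<^sup>2) ^ Suc l * resolvent_coeffs (of_real g) h x y ! Suc l)"
      unfolding \<epsilon> by (simp only: sum.lessThan_Suc_shift resolvent_coeffs_eq(1) power_0 mult_1_left)
    also have "(\<Sum>l<6. (\<delta> N * y\<^sup>2) ^ Suc l * resolvent_coeffs (of_real g) h x y ! Suc l) = y * \<delta> N * (\<Sum>l<6. coef u h l [1] * \<delta> N ^ l)"
      unfolding sum_distrib_left by (intro sum.cong refl resolvent_coeffs_eq(2)) simp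
    finally show ?thesis .
  qed
  \<comment> \<open>Six terms of the moment suffice: the prefactor \<open>\<delta> N\<close>
    supplies the seventh power of \<open>1 / N\<close>.\<close>
  have "(\<lambda>N. y * (\<delta> N * (M [1] N - (\<Sum>l<6. coef u h l [1] * \<delta> N ^ l)))) \<in> O(\<lambda>N. 1 * (\<delta> N * \<delta> N ^ 6))"
    using M_expands[of 6 "[1]"] unfolding expands_def by (intro landau_o.big.mult) auto
  also have "(\<lambda>N. 1 * (\<delta> N * \<delta> N ^ 6)) = (\<lambda>N. (of_real (g / sqrt \<kappa>) / y\<^sup>2) ^ 7 * (1 / of_nat N ^ 7))"
  proof
    fix N
    have "\<delta> N = of_real (g / sqrt \<kappa>) / y\<^sup>2 * (1 / of_nat N)" by (simp add: \<delta>_def)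
    then have "\<delta> N ^ 7 = (of_real (g / sqrt \<kappa>) / y\<^sup>2) ^ 7 * (1 / of_nat N) ^ 7" by (simp only: power_mult_distrib)
    moreover have "\<delta> N ^ 7 = 1 * (\<delta> N * \<delta> N ^ 6)" using power_Suc[of "\<delta> N" 6] by simp
    ultimately show "1 * (\<delta> N * \<delta> N ^ 6) = (of_real (g / sqrt \<kappa>) / y\<^sup>2) ^ 7 * (1 / of_nat N ^ 7)"
      by (simp add: power_one_over)
  qed
  also have "O(\<lambda>N. (of_real (g / sqrt \<kappa>) / y\<^sup>2) ^ 7 * (1 / of_nat N ^ 7)) = O(\<lambda>N. 1 / of_nat N ^ 7 :: complex)"
    using g \<kappa> y_nz by (intro landau_o.big.cmult) simp
  finally have "(\<lambda>N. y * (\<delta> N * (M [1] N - (\<Sum>l<6. coef u h l [1] * \<delta> N ^ l)))) \<in> O(\<lambda>N. 1 / of_nat N ^ 7)" .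
  moreover have "\<forall>\<^sub>F N in sequentially. complex_of_real (g / real N) * gbe_resolvent g \<kappa> N x
       - (\<Sum>l=0..6. complex_of_real (g / (sqrt \<kappa> * real N)) ^ l * resolvent_coeffs (of_real g) h x y ! l)
     = y * (\<delta> N * (M [1] N - (\<Sum>l<6. coef u h l [1] * \<delta> N ^ l)))"
  proof (rule eventually_sequentiallyI[of 1])
    fix N :: nat assume "1 \<le> N"
    then have N: "N > 0" by simp
    show "complex_of_real (g / real N) * gbe_resolvent g \<kappa> N x
       - (\<Sum>l=0..6. complex_of_real (g / (sqrt \<kappa> * real N)) ^ l * resolvent_coeffs (of_real g) h x y ! l)
     = y * (\<delta> N * (M [1] N - (\<Sum>l<6. coef u h l [1] * \<delta> N ^ l)))"
      unfolding sum resolvent_conv_M[OF N] by (simp only: algebra_simps)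
  qed
  then have "?thesis \<longleftrightarrow> (\<lambda>N. y * (\<delta> N * (M [1] N - (\<Sum>l<6. coef u h l [1] * \<delta> N ^ l)))) \<in> O(\<lambda>N. 1 / of_nat N ^ 7)"
    by (rule landau_o.big.in_cong)
  ultimately show ?thesis by blast
qed

end

theorem mainTheorem1:
  fixes g \<kappa> :: real and h x :: complex and y :: "complex \<Rightarrow> complex"
  assumes "g > 0" and "\<kappa> > 0"
    and "x \<notin> \<real>"
    and "h = complex_of_real (sqrt \<kappa> - 1 / sqrt \<kappa>)"
    and "is_resolvent_sqrt g y"
  shows "(\<lambda>N. complex_of_real (g / real N) * gbe_resolvent g \<kappa> N x
              - (\<Sum>l=0..6. complex_of_real (g / (sqrt \<kappa> * real N)) ^ l
                          * resolvent_coeffs (of_real g) h x (y x) ! l))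
         \<in> O(\<lambda>N. 1 / of_nat N ^ 7)"
proof -
  have "Im x \<noteq> 0" using assms(3) by (simp add: complex_is_Real_iff)
  moreover have "x \<notin> complex_of_real ` {- 2 * sqrt g .. 2 * sqrt g}" using assms(3) by auto
  then have "(y x)\<^sup>2 = x\<^sup>2 - 4 * of_real g" using assms(5) by (simp add: is_resolvent_sqrt_def)
  \<comment> \<open>The function \<open>y\<close> enters only through its value at \<open>x\<close>:
    the square of that value, and the sign that singles out the branch.\<close>
  ultimately interpret gbe_branch g \<kappa> x "y x"
    using assms(1,2) resolvent_branch_sign[OF assms(1,5,3)] by unfold_locales auto
  show ?thesis using resolvent_expansion unfolding h_def assms(4) .
qed

end
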